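(* Suppose that $F$ satisfies conditions (P1), (P2), (P3), (G1), (G2$_\infty$) and (G3) of the context, and let $\mu_0$ be the $F$-invariant probability of (P3). Then there are constants $0<\xi<1$ and $R>0$, for which $\overline{\mathrm F}_{\Phi,h}:\mathbf S^\infty\to\mathbf S^\infty$ has a decomposition $\overline{\mathrm F}_{\Phi,h}=\mathrm P+\mathrm N$ with $\mathrm P^2=\mathrm P$, $\dim\operatorname{Im}(\mathrm P)=1$, $\mathrm P\mathrm N=\mathrm N\mathrm P=0$ and $\|\mathrm N^n\mu\|_{\mathbf S^\infty}\le R\xi^n\|\mu\|_{\mathbf S^\infty}$ for all $\mu\in\mathbf S^\infty$, $n\ge1$, such that for all observables $u\in B'_\infty$ and $v\in\Theta^\infty_{\mu_0}$, $$\left|\int (u\circ F^n)\,v\,d\mu_0-\int u\,d\mu_0\int v\,d\mu_0\right|\le\|v\mu_0\|_{\mathbf S^\infty}\,R\,R_4\,\xi^n\qquad\text{for all } n\ge1,$$ where $R_4=R_4(u)$ is the constant in the definition of $B'_\infty$.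
   Context: Setting. $M$ is a complete separable metric space and $K$ a compact metric space (Borel $\sigma$-algebras), $\Sigma=M\times K$, and $F:\Sigma\to\Sigma$, $F(x,y)=(f(x),G(x,y))$, with $f:M\to M$ and $G:\Sigma\to K$ measurable. $\pi_1(x,y)=x$, $\pi_2(x,y)=y$; a subscript $*$ denotes push-forward of measures. (P1) There is a class $\mathscr P_M$ of potentials $\varphi:M\to\mathbb R$ such that for each $\varphi\in\mathscr P_M$: (P1.1) there is an equilibrium state $m=m(\varphi)$ of $f$ for $\varphi$ (a probability measure) of the form $m=h\,\nu$ with $0<\inf h\le\sup h<\infty$ and $\mathcal L_\varphi h=\lambda h$ for some $\lambda>0$, where $\mathcal L_\varphi g(x)=\sum_{y\in f^{-1}(x)}g(y)e^{\varphi(y)}$, and $\nu$ is a conformal measure with Jacobian $\lambda e^{-\varphi}$ (i.e. $\nu(f(A))=\int_A\lambda e^{-\varphi}d\nu$ for measurable $A$ on which $f$ is injective); (P1.2) there are normed spaces (not necessarily Banach) of real functions on $M$, closed under pointwise multiplication, $h,h^{-1}\in(B_s,|\cdot|_s)\subset(B_w,|\cdot|_w)$, $|\cdot|_w\le|\cdot|_s$, such that $\mathcal L_\varphi:B_s\to B_s$ has spectrum $\{\lambda\}\cup\mathcal U$ with $\mathcal U$ contained in a disk of radius strictly smaller than $|\lambda|$; in particular $\overline{\mathcal L}_\varphi:=\lambda^{-1}\mathcal L_\varphi=\mathcal P_f+\mathcal N_f$ with $\mathcal P_f^2=\mathcal P_f$, $\dim\operatorname{Im}\mathcal P_f=1$,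 $\mathcal N_f\mathcal P_f=\mathcal P_f\mathcal N_f=0$, and there are $C_0>0$, $0\le r<1$ with $|\mathcal N_f^n g|_s\le C_0r^n|g|_s$ for all $g\in B_s$, $n\ge1$. Consequently $\overline{\mathcal L}_\varphi^*\nu=\nu$. (P2) There is a measurable partition of $M$ (up to $\nu$-null sets) into disjoint sets $P_1,\dots,P_{\deg(f)}$ such that each $f|_{P_i}:P_i\to M$ is a bijection and $\nu(\bigcup_iP_i)=\nu(M)$. Fix $\varphi\in\mathscr P_M$ with its $m,h,\nu,\lambda$, and let $\Phi=\varphi\circ\pi_1$. (P3) There is an $F$-invariant probability measure $\mu_0$ with $\pi_{1*}\mu_0=m$. A point $\gamma\in M$ is identified with the fibre $\{\gamma\}\times K$, and $F_\gamma:K\to K$ is $F_\gamma(y)=G(\gamma,y)$. (G1) There are a norm $\|\cdot\|_o$ on the space $\mathcal{SM}(K)$ of finite signed Borel measures on $K$ and $0\le\alpha<1$ such that, for every $\mu\in\mathcal{SM}(K)$: $\|F_{\gamma*}\mu\|_o\le\alpha\|\mu\|_o+|\mu(K)|$ for $\nu$-a.e. $\gamma$, and $\|F_{\gamma*}\mu\|_o\le\|\mu\|_o$ for every $\gamma$. (G3) $\|\mu\|_o=1$ for every probability measure $\mu$ on $K$. Measures and spaces. For a finite signed Borel measure $\mu$ on $\Sigma$ with Jordan decomposition $\mu=\mu^+-\mu^-$, write $\mu\in\mathbf{AB}_m$ if $\pi_{1*}\mu^\pm\ll m$. For positive $\mu\in\mathbf{AB}_m$ let $(\{\mu_\gamma\}_\gamma,\phi_1m)$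 be its (Rokhlin) disintegration along the fibres, $\mu_\gamma$ probability measures and $\phi_1=d\pi_{1*}\mu/dm$; the restriction $\mu|_\gamma$ is the measure $\phi_1(\gamma)\,\pi_{2*}\mu_\gamma$ on $K$. For signed $\mu$: $\mu|_\gamma=\mu^+|_\gamma-\mu^-|_\gamma$ and $\phi_1=\phi_1^+-\phi_1^-$. Set $\|\mu\|_\infty=\operatorname{ess\,sup}_{\gamma}\|\mu|_\gamma\|_o$ (with respect to $m$), $\mathbf L^\infty=\{\mu\in\mathbf{AB}_m:\|\mu\|_\infty<\infty\}$, $\mathbf S^\infty=\{\mu\in\mathbf L^\infty:\phi_1\in B_s\}$, $\|\mu\|_{\mathbf S^\infty}=|\phi_1|_s+\|\mu\|_\infty$. (G2$_\infty$) $B_w\subset L^\infty_\nu$ and for every $\mu\in\mathbf L^\infty$ its marginal density satisfies $|\phi_1|_\infty\le|\phi_1|_w\le\|\mu\|_\infty$ (in particular $|\phi_1|_w$ is assumed defined). Operators. $\mathcal L_{\varphi,h}(g)=\mathcal L_\varphi(gh)/h$. For a.e. $\gamma$ let $\gamma_i\in P_i$ be the point with $f(\gamma_i)=\gamma$. $\mathrm F_{\Phi,h}:\mathbf{AB}_m\to\mathbf{AB}_m$ is the linear operator such that, for positive $\mu$, the marginal of $\mathrm F_{\Phi,h}\mu$ is $\mathcal L_{\varphi,h}(\phi_1)m$ and its conditional measure on the fibre over $\gamma$ is $\frac{1}{h(\gamma)\mathcal L_{\varphi,h}(\phi_1)(\gamma)}\sum_i\phi_1(\gamma_i)h(\gamma_i)e^{\varphi(\gamma_i)}F_*\mu_{\gamma_i}$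 where $\mathcal L_{\varphi,h}(\phi_1)(\gamma)\ne0$ (a fixed probability elsewhere). Equivalently, for all $\mu$ and a.e. $\gamma$, $(\mathrm F_{\Phi,h}\mu)|_\gamma=\frac1{h(\gamma)}\sum_{i=1}^{\deg(f)}h(\gamma_i)e^{\varphi(\gamma_i)}F_{\gamma_i*}(\mu|_{\gamma_i})$. Put $\overline{\mathrm F}_{\Phi,h}=\lambda^{-1}\mathrm F_{\Phi,h}$. Observables. $B'_\infty$ is the set of (measurable) $u:\Sigma\to\mathbb R$ for which there is a constant $R_4=R_4(u)$ with $\left|\int u\,d\mu\right|\le R_4\|\mu\|_{\mathbf S^\infty}$ for all $\mu\in\mathbf S^\infty$. $\Theta^\infty_{\mu_0}=\{v:\Sigma\to\mathbb R:\ v\mu_0\in\mathbf S^\infty\}$, where $(v\mu_0)(A)=\int_Av\,d\mu_0$.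
   Formalization: In (G1) the ν-null exceptional set of γ is taken independent of μ; in (P1.2) multiplication by a fixed element of B_s (or B_w) is required to be bounded for its norm; the correlation bound is claimed when (u∘F^n)v is μ_0-integrable. *)

theory Defs
  imports "HOL-Probability.Probability"
begin

section \<open>Finite signed Borel measures\<close>

text \<open>Values on non-Borel sets are normalised to \<open>0\<close>, so that equality of signed measures is
  equality on Borel sets.\<close>

typedef (overloaded) 'a signed_measure =
  "{\<mu> :: 'a::topological_space set \<Rightarrow> real.
     (\<forall>A. A \<notin> sets borel \<longrightarrow> \<mu> A = 0) \<and>
     (\<forall>A :: nat \<Rightarrow> 'a set. range A \<subseteq> sets borel \<longrightarrow> disjoint_family A \<longrightarrow>
        (\<lambda>i. \<mu> (A i)) sums \<mu> (\<Union>i. A i))}"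
  morphisms sm_val Abs_signed_measure
  by (rule exI[of _ "\<lambda>_. 0"]) auto

setup_lifting type_definition_signed_measure

instantiation signed_measure :: (topological_space) real_vector
begin

lift_definition zero_signed_measure :: "'a signed_measure" is "\<lambda>_. 0"
  by auto

lift_definition plus_signed_measure :: "'a signed_measure \<Rightarrow> 'a signed_measure \<Rightarrow> 'a signed_measure"
  is "\<lambda>\<mu> \<eta> A. \<mu> A + \<eta> A"
  by (auto intro!: sums_add)

lift_definition uminus_signed_measure :: "'a signed_measure \<Rightarrow> 'a signed_measure"
  is "\<lambda>\<mu> A. - \<mu> A"
  by (auto intro!: sums_minus)

lift_definition minus_signed_measure :: "'a signed_measure \<Rightarrow> 'a signed_measure \<Rightarrow> 'a signed_measure"
  is "\<lambda>\<mu> \<eta> A. \<mu> A - \<eta> A"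
  by (auto intro!: sums_diff)

lift_definition scaleR_signed_measure :: "real \<Rightarrow> 'a signed_measure \<Rightarrow> 'a signed_measure"
  is "\<lambda>c \<mu> A. c * \<mu> A"
  by (auto intro!: sums_mult)

instance
  by standard (transfer; simp add: fun_eq_iff algebra_simps)+

end

definition signed_of :: "'a::topological_space measure \<Rightarrow> 'a signed_measure" where
  "signed_of M = Abs_signed_measure (measure M)"

definition push_signed :: "('a::topological_space \<Rightarrow> 'b::topological_space) \<Rightarrow>
    'a signed_measure \<Rightarrow> 'b signed_measure" where
  "push_signed T \<mu> =
     Abs_signed_measure (\<lambda>A. if A \<in> sets borel then sm_val \<mu> (T -` A) else 0)"

definition weighted_measure :: "'a::topological_space measure \<Rightarrow> ('a \<Rightarrow> real) \<Rightarrow> 'a signed_measure" where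
  "weighted_measure M v =
     Abs_signed_measure (\<lambda>A. if A \<in> sets borel then (LINT x:A|M. v x) else 0)"

definition jordan_decomp :: "'a::topological_space signed_measure \<Rightarrow> 'a measure \<times> 'a measure" where
  "jordan_decomp \<mu> = (THE (p, n).
     finite_measure p \<and> finite_measure n \<and> sets p = sets borel \<and> sets n = sets borel \<and>
     (\<exists>H\<in>sets borel. emeasure p (- H) = 0 \<and> emeasure n H = 0) \<and>
     (\<forall>A\<in>sets borel. sm_val \<mu> A = measure p A - measure n A))"

definition pos_measure :: "'a::topological_space signed_measure \<Rightarrow> 'a measure" where
  "pos_measure \<mu> = fst (jordan_decomp \<mu>)"

definition neg_measure :: "'a::topological_space signed_measure \<Rightarrow> 'a measure" where
  "neg_measure \<mu> = snd (jordan_decomp \<mu>)"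

definition signed_integrable :: "'a::topological_space signed_measure \<Rightarrow> ('a \<Rightarrow> real) \<Rightarrow> bool" where
  "signed_integrable \<mu> u \<longleftrightarrow> integrable (pos_measure \<mu>) u \<and> integrable (neg_measure \<mu>) u"

definition signed_integral :: "'a::topological_space signed_measure \<Rightarrow> ('a \<Rightarrow> real) \<Rightarrow> real" where
  "signed_integral \<mu> u = integral\<^sup>L (pos_measure \<mu>) u - integral\<^sup>L (neg_measure \<mu>) u"

definition is_norm :: "('a::real_vector \<Rightarrow> real) \<Rightarrow> bool" where
  "is_norm N \<longleftrightarrow> (\<forall>x. 0 \<le> N x \<and> (N x = 0 \<longleftrightarrow> x = 0)) \<and>
     (\<forall>x y. N (x + y) \<le> N x + N y) \<and> (\<forall>c x. N (c *\<^sub>R x) = \<bar>c\<bar> * N x)"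

definition linear_op_on :: "'a::real_vector set \<Rightarrow> ('a \<Rightarrow> 'a) \<Rightarrow> bool" where
  "linear_op_on V T \<longleftrightarrow> (\<forall>x\<in>V. T x \<in> V) \<and>
     (\<forall>x\<in>V. \<forall>y\<in>V. T (x + y) = T x + T y) \<and> (\<forall>c. \<forall>x\<in>V. T (c *\<^sub>R x) = c *\<^sub>R T x)"

text \<open>Unlike \<^const>\<open>esssup\<close>, this does not require \<open>u\<close> to be measurable; it is applied to
  \<open>\<gamma> \<mapsto> \<parallel>\<mu>|\<^sub>\<gamma>\<parallel>\<close> for an arbitrary norm on signed measures, where measurability is not known.\<close>

definition ess_sup :: "'a measure \<Rightarrow> ('a \<Rightarrow> real) \<Rightarrow> ereal" where
  "ess_sup M u = Inf {C. AE x in M. ereal (u x) \<le> C}"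


section \<open>Equilibrium states\<close>

definition invariant_prob :: "('a::topological_space \<Rightarrow> 'a) \<Rightarrow> 'a measure \<Rightarrow> bool" where
  "invariant_prob f \<eta> \<longleftrightarrow> prob_space \<eta> \<and> sets \<eta> = sets borel \<and> distr \<eta> borel f = \<eta>"

text \<open>A finite measurable partition is given by its labelling function; the join of its first
  \<open>n\<close> preimages is labelled by itineraries of length \<open>n\<close>. The convention \<open>ln 0 = 0\<close> gives
  \<open>0 ln 0 = 0\<close>.\<close>

definition partition_entropy :: "'a measure \<Rightarrow> ('a \<Rightarrow> 'b) \<Rightarrow> real" where
  "partition_entropy M X =
     - (\<Sum>a\<in>X ` space M. measure M (X -` {a} \<inter> space M) * ln (measure M (X -` {a} \<inter> space M)))"

definition ks_entropy :: "'a measure \<Rightarrow> ('a \<Rightarrow> 'a) \<Rightarrow> ereal" where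
  "ks_entropy M f =
     (SUP X\<in>{X :: 'a \<Rightarrow> nat. X \<in> measurable M (count_space UNIV) \<and> finite (range X)}.
        ereal (lim (\<lambda>n. partition_entropy M (\<lambda>x. map (\<lambda>i. X ((f ^^ i) x)) [0..<n]) / real n)))"

definition equilibrium_state ::
    "('a::topological_space \<Rightarrow> 'a) \<Rightarrow> ('a \<Rightarrow> real) \<Rightarrow> 'a measure \<Rightarrow> bool" where
  "equilibrium_state f \<phi> m \<longleftrightarrow> invariant_prob f m \<and> integrable m \<phi> \<and>
     (\<forall>\<eta>. invariant_prob f \<eta> \<and> integrable \<eta> \<phi> \<longrightarrow>
        ks_entropy \<eta> f + ereal (integral\<^sup>L \<eta> \<phi>) \<le> ks_entropy m f + ereal (integral\<^sup>L m \<phi>))"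


section \<open>The base dynamics\<close>

definition transfer :: "('a \<Rightarrow> 'a) \<Rightarrow> ('a \<Rightarrow> real) \<Rightarrow> ('a \<Rightarrow> real) \<Rightarrow> 'a \<Rightarrow> real" where
  "transfer f \<phi> g x = (\<Sum>\<^sub>\<infinity>y\<in>f -` {x}. g y * exp (\<phi> y))"

definition conformal ::
    "('a::topological_space \<Rightarrow> 'a) \<Rightarrow> ('a \<Rightarrow> real) \<Rightarrow> real \<Rightarrow> 'a measure \<Rightarrow> bool" where
  "conformal f \<phi> lam \<nu> \<longleftrightarrow> (\<forall>A\<in>sets borel. inj_on f A \<longrightarrow>
     emeasure \<nu> (f ` A) = (\<integral>\<^sup>+x\<in>A. ennreal (lam * exp (- \<phi> x)) \<partial>\<nu>))"

definition conformal_equilibrium ::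
    "('a::topological_space \<Rightarrow> 'a) \<Rightarrow> ('a \<Rightarrow> real) \<Rightarrow> 'a measure \<Rightarrow> ('a \<Rightarrow> real) \<Rightarrow> 'a measure \<Rightarrow>
     real \<Rightarrow> bool" where
  "conformal_equilibrium f \<phi> m h \<nu> lam \<longleftrightarrow>
     equilibrium_state f \<phi> m \<and>
     sets \<nu> = sets borel \<and> h \<in> borel_measurable borel \<and> m = density \<nu> (\<lambda>x. ennreal (h x)) \<and>
     (\<exists>a b. 0 < a \<and> (\<forall>x. a \<le> h x \<and> h x \<le> b)) \<and>
     0 < lam \<and> (AE x in \<nu>. transfer f \<phi> h x = lam * h x) \<and>
     conformal f \<phi> lam \<nu>"

text \<open>Spaces of functions on the base are spaces of functions modulo \<open>\<nu>\<close>-null sets (they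
  contain Radon-Nikodym densities and embed into \<open>L\<^sup>\<infinity>(\<nu>)\<close>): they are represented by sets of
  functions closed under \<open>\<nu>\<close>-a.e. equality, and equality of elements is \<open>\<nu>\<close>-a.e. equality.
  Closedness under multiplication is meant in the normed sense: multiplication by a fixed
  element is a bounded operator.\<close>

definition normed_function_space ::
    "'a measure \<Rightarrow> ('a \<Rightarrow> real) set \<Rightarrow> (('a \<Rightarrow> real) \<Rightarrow> real) \<Rightarrow> bool" where
  "normed_function_space \<nu> B N \<longleftrightarrow>
     B \<subseteq> borel_measurable (completion \<nu>) \<and>
     (\<forall>g k. g \<in> B \<longrightarrow> (AE x in \<nu>. g x = k x) \<longrightarrow> k \<in> B) \<and>
     (\<lambda>x. 0) \<in> B \<and>
     (\<forall>g\<in>B. \<forall>k\<in>B. (\<lambda>x. g x + k x) \<in> B \<and> N (\<lambda>x. g x + k x) \<le> N g + N k) \<and>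
     (\<forall>c. \<forall>g\<in>B. (\<lambda>x. c * g x) \<in> B \<and> N (\<lambda>x. c * g x) = \<bar>c\<bar> * N g) \<and>
     (\<forall>g\<in>B. 0 \<le> N g \<and> (N g = 0 \<longleftrightarrow> (AE x in \<nu>. g x = 0))) \<and>
     (\<forall>g\<in>B. \<exists>C. \<forall>k\<in>B. (\<lambda>x. g x * k x) \<in> B \<and> N (\<lambda>x. g x * k x) \<le> C * N k)"

definition ae_linear_op_on ::
    "'a measure \<Rightarrow> ('a \<Rightarrow> real) set \<Rightarrow> (('a \<Rightarrow> real) \<Rightarrow> ('a \<Rightarrow> real)) \<Rightarrow> bool" where
  "ae_linear_op_on \<nu> B T \<longleftrightarrow>
     (\<forall>g\<in>B. T g \<in> B) \<and>
     (\<forall>g\<in>B. \<forall>k\<in>B. (AE x in \<nu>. g x = k x) \<longrightarrow> (AE x in \<nu>. T g x = T k x)) \<and>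
     (\<forall>g\<in>B. \<forall>k\<in>B. AE x in \<nu>. T (\<lambda>y. g y + k y) x = T g x + T k x) \<and>
     (\<forall>c. \<forall>g\<in>B. AE x in \<nu>. T (\<lambda>y. c * g y) x = c * T g x)"

text \<open>The spectrum of an operator on a real space is that of its complexification, here the
  space of complex functions with real and imaginary parts in \<open>B\<close>; \<open>z\<close> is a regular value if
  \<open>z - T\<close> has a bounded two-sided inverse.\<close>

definition cplx_space :: "('a \<Rightarrow> real) set \<Rightarrow> ('a \<Rightarrow> complex) set" where
  "cplx_space B = {g. (\<lambda>x. Re (g x)) \<in> B \<and> (\<lambda>x. Im (g x)) \<in> B}"

definition cplx_norm :: "(('a \<Rightarrow> real) \<Rightarrow> real) \<Rightarrow> ('a \<Rightarrow> complex) \<Rightarrow> real" where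
  "cplx_norm N g = N (\<lambda>x. Re (g x)) + N (\<lambda>x. Im (g x))"

definition cplx_op ::
    "(('a \<Rightarrow> real) \<Rightarrow> ('a \<Rightarrow> real)) \<Rightarrow> ('a \<Rightarrow> complex) \<Rightarrow> ('a \<Rightarrow> complex)" where
  "cplx_op T g x = Complex (T (\<lambda>y. Re (g y)) x) (T (\<lambda>y. Im (g y)) x)"

definition spectrum_on ::
    "'a measure \<Rightarrow> ('a \<Rightarrow> real) set \<Rightarrow> (('a \<Rightarrow> real) \<Rightarrow> real) \<Rightarrow> (('a \<Rightarrow> real) \<Rightarrow> ('a \<Rightarrow> real)) \<Rightarrow>
     complex set" where
  "spectrum_on \<nu> B N T = {z. \<not> (\<exists>S C. \<forall>g\<in>cplx_space B.
     S g \<in> cplx_space B \<and> cplx_norm N (S g) \<le> C * cplx_norm N g \<and>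
     (AE x in \<nu>. z * S g x - cplx_op T (S g) x = g x) \<and>
     (AE x in \<nu>. S (\<lambda>y. z * g y - cplx_op T g y) x = g x))}"

definition base_spectral_gap ::
    "('a \<Rightarrow> 'a) \<Rightarrow> ('a \<Rightarrow> real) \<Rightarrow> ('a \<Rightarrow> real) \<Rightarrow> 'a measure \<Rightarrow> real \<Rightarrow>
     ('a \<Rightarrow> real) set \<Rightarrow> (('a \<Rightarrow> real) \<Rightarrow> real) \<Rightarrow> ('a \<Rightarrow> real) set \<Rightarrow> (('a \<Rightarrow> real) \<Rightarrow> real) \<Rightarrow> bool" where
  "base_spectral_gap f \<phi> h \<nu> lam Bs Ns Bw Nw \<longleftrightarrow>
     normed_function_space \<nu> Bs Ns \<and> normed_function_space \<nu> Bw Nw \<and>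
     Bs \<subseteq> Bw \<and> (\<forall>g\<in>Bs. Nw g \<le> Ns g) \<and>
     h \<in> Bs \<and> (\<lambda>x. 1 / h x) \<in> Bs \<and>
     (\<forall>g\<in>Bs. transfer f \<phi> g \<in> Bs) \<and>
     (\<exists>U \<rho>. spectrum_on \<nu> Bs Ns (transfer f \<phi>) = insert (of_real lam) U \<and>
        \<rho> < \<bar>lam\<bar> \<and> (\<forall>z\<in>U. cmod z \<le> \<rho>)) \<and>
     (\<exists>P N C r. ae_linear_op_on \<nu> Bs P \<and> ae_linear_op_on \<nu> Bs N \<and>
        (\<forall>g\<in>Bs. AE x in \<nu>. transfer f \<phi> g x / lam = P g x + N g x) \<and>
        (\<forall>g\<in>Bs. AE x in \<nu>. P (P g) x = P g x) \<and>
        (\<exists>e\<in>Bs. \<not> (AE x in \<nu>. P e x = 0) \<and> (\<forall>g\<in>Bs. \<exists>c. AE x in \<nu>. P g x = c * P e x)) \<and>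
        (\<forall>g\<in>Bs. AE x in \<nu>. N (P g) x = 0) \<and> (\<forall>g\<in>Bs. AE x in \<nu>. P (N g) x = 0) \<and>
        0 < C \<and> 0 \<le> r \<and> r < 1 \<and>
        (\<forall>g\<in>Bs. \<forall>n\<ge>1. Ns ((N ^^ n) g) \<le> C * r ^ n * Ns g))"

definition full_branches ::
    "('a::topological_space \<Rightarrow> 'a) \<Rightarrow> 'a measure \<Rightarrow> nat \<Rightarrow> (nat \<Rightarrow> 'a set) \<Rightarrow> bool" where
  "full_branches f \<nu> d Q \<longleftrightarrow>
     (\<forall>i<d. Q i \<in> sets borel \<and> bij_betw f (Q i) UNIV) \<and> disjoint_family_on Q {..<d} \<and>
     emeasure \<nu> (\<Union>i<d. Q i) = emeasure \<nu> UNIV"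


section \<open>Skew products and measures absolutely continuous along the base\<close>

definition skew_product :: "('m \<Rightarrow> 'm) \<Rightarrow> ('m \<times> 'k \<Rightarrow> 'k) \<Rightarrow> 'm \<times> 'k \<Rightarrow> 'm \<times> 'k" where
  "skew_product f G z = (f (fst z), G z)"

definition AB :: "'m::topological_space measure \<Rightarrow> ('m \<times> 'k::topological_space) signed_measure set" where
  "AB m = {\<mu>. absolutely_continuous m (distr (pos_measure \<mu>) borel fst) \<and>
               absolutely_continuous m (distr (neg_measure \<mu>) borel fst)}"

definition marginal_density ::
    "'m::topological_space measure \<Rightarrow> ('m \<times> 'k::topological_space) signed_measure \<Rightarrow> 'm \<Rightarrow> real" where
  "marginal_density m \<mu> \<gamma> =
     enn2real (RN_deriv m (distr (pos_measure \<mu>) borel fst) \<gamma>) -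
     enn2real (RN_deriv m (distr (neg_measure \<mu>) borel fst) \<gamma>)"

definition disintegration ::
    "'m::topological_space measure \<Rightarrow> ('m \<times> 'k::topological_space) measure \<Rightarrow>
     ('m \<Rightarrow> ('m \<times> 'k) measure) \<Rightarrow> ('m \<Rightarrow> real) \<Rightarrow> bool" where
  "disintegration m p \<kappa> \<phi>\<^sub>1 \<longleftrightarrow>
     \<kappa> \<in> measurable borel (prob_algebra borel) \<and>
     (\<forall>\<gamma>. emeasure (\<kappa> \<gamma>) ({\<gamma>} \<times> UNIV) = 1) \<and>
     \<phi>\<^sub>1 \<in> borel_measurable borel \<and> (\<forall>\<gamma>. 0 \<le> \<phi>\<^sub>1 \<gamma>) \<and>
     distr p borel fst = density m (\<lambda>\<gamma>. ennreal (\<phi>\<^sub>1 \<gamma>)) \<and>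
     (\<forall>E\<in>sets borel. emeasure p E = (\<integral>\<^sup>+\<gamma>. ennreal (\<phi>\<^sub>1 \<gamma>) * emeasure (\<kappa> \<gamma>) E \<partial>m))"

text \<open>\<open>fibre_restriction m \<mu> r\<close> says that \<open>r\<close> is a version of \<open>\<gamma> \<mapsto> \<mu>|\<^sub>\<gamma>\<close>, which is determined
  only up to \<open>m\<close>-null sets.\<close>

definition pos_fibre_restriction ::
    "'m::topological_space measure \<Rightarrow> ('m \<times> 'k::topological_space) measure \<Rightarrow>
     ('m \<Rightarrow> 'k signed_measure) \<Rightarrow> bool" where
  "pos_fibre_restriction m p r \<longleftrightarrow> (\<exists>\<kappa> \<phi>\<^sub>1. disintegration m p \<kappa> \<phi>\<^sub>1 \<and>
     (AE \<gamma> in m. r \<gamma> = \<phi>\<^sub>1 \<gamma> *\<^sub>R signed_of (distr (\<kappa> \<gamma>) borel snd)))"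

definition fibre_restriction ::
    "'m::topological_space measure \<Rightarrow> ('m \<times> 'k::topological_space) signed_measure \<Rightarrow>
     ('m \<Rightarrow> 'k signed_measure) \<Rightarrow> bool" where
  "fibre_restriction m \<mu> r \<longleftrightarrow> (\<exists>r\<^sub>p r\<^sub>n. pos_fibre_restriction m (pos_measure \<mu>) r\<^sub>p \<and>
     pos_fibre_restriction m (neg_measure \<mu>) r\<^sub>n \<and> (AE \<gamma> in m. r \<gamma> = r\<^sub>p \<gamma> - r\<^sub>n \<gamma>))"

text \<open>Versions of \<open>\<gamma> \<mapsto> \<mu>|\<^sub>\<gamma>\<close> exist and agree a.e. for \<open>\<mu> \<in> AB m\<close>, so the infimum below is over
  a single value.\<close>

definition fibre_sup_norm ::
    "('k::topological_space signed_measure \<Rightarrow> real) \<Rightarrow> 'm::topological_space measure \<Rightarrow>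
     ('m \<times> 'k) signed_measure \<Rightarrow> ereal" where
  "fibre_sup_norm No m \<mu> = (INF r\<in>{r. fibre_restriction m \<mu> r}. ess_sup m (\<lambda>\<gamma>. No (r \<gamma>)))"

definition L_inf ::
    "('k::topological_space signed_measure \<Rightarrow> real) \<Rightarrow> 'm::topological_space measure \<Rightarrow>
     ('m \<times> 'k) signed_measure set" where
  "L_inf No m = {\<mu> \<in> AB m. fibre_sup_norm No m \<mu> < \<infinity>}"

definition S_inf ::
    "('k::topological_space signed_measure \<Rightarrow> real) \<Rightarrow> 'm::topological_space measure \<Rightarrow>
     ('m \<Rightarrow> real) set \<Rightarrow> ('m \<times> 'k) signed_measure set" where
  "S_inf No m Bs = {\<mu> \<in> L_inf No m. marginal_density m \<mu> \<in> Bs}"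

definition S_inf_norm ::
    "('k::topological_space signed_measure \<Rightarrow> real) \<Rightarrow> 'm::topological_space measure \<Rightarrow>
     (('m \<Rightarrow> real) \<Rightarrow> real) \<Rightarrow> ('m \<times> 'k) signed_measure \<Rightarrow> real" where
  "S_inf_norm No m Ns \<mu> = Ns (marginal_density m \<mu>) + real_of_ereal (fibre_sup_norm No m \<mu>)"

text \<open>The exceptional null set in the contraction estimate is independent of the signed measure,
  since the estimate is applied fibrewise to measures that vary with \<open>\<gamma>\<close>.\<close>

definition fibre_contraction ::
    "('m \<times> 'k::topological_space \<Rightarrow> 'k) \<Rightarrow> 'm measure \<Rightarrow> ('k signed_measure \<Rightarrow> real) \<Rightarrow> bool" where
  "fibre_contraction G \<nu> No \<longleftrightarrow> (\<exists>\<alpha>. 0 \<le> \<alpha> \<and> \<alpha> < 1 \<and>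
     (AE \<gamma> in \<nu>. \<forall>\<mu>. No (push_signed (\<lambda>y. G (\<gamma>, y)) \<mu>) \<le> \<alpha> * No \<mu> + \<bar>sm_val \<mu> UNIV\<bar>)) \<and>
     (\<forall>\<gamma> \<mu>. No (push_signed (\<lambda>y. G (\<gamma>, y)) \<mu>) \<le> No \<mu>)"

definition normalized_on_probs :: "('k::topological_space signed_measure \<Rightarrow> real) \<Rightarrow> bool" where
  "normalized_on_probs No \<longleftrightarrow>
     (\<forall>p. prob_space p \<and> sets p = sets borel \<longrightarrow> No (signed_of p) = 1)"

definition weak_norm_bounds ::
    "('k::topological_space signed_measure \<Rightarrow> real) \<Rightarrow> 'm::topological_space measure \<Rightarrow> 'm measure \<Rightarrow>
     ('m \<Rightarrow> real) set \<Rightarrow> (('m \<Rightarrow> real) \<Rightarrow> real) \<Rightarrow> bool" where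
  "weak_norm_bounds No m \<nu> Bw Nw \<longleftrightarrow>
     (\<forall>g\<in>Bw. g \<in> borel_measurable (completion \<nu>) \<and> ess_sup \<nu> (\<lambda>x. \<bar>g x\<bar>) < \<infinity>) \<and>
     (\<forall>\<mu>\<in>L_inf No m. marginal_density m \<mu> \<in> Bw \<and>
        ess_sup \<nu> (\<lambda>x. \<bar>marginal_density m \<mu> x\<bar>) \<le> ereal (Nw (marginal_density m \<mu>)) \<and>
        ereal (Nw (marginal_density m \<mu>)) \<le> fibre_sup_norm No m \<mu>)"

text \<open>The operator is determined by the restrictions of its values to almost every fibre; the
  point \<open>\<gamma>\<^sub>i\<close> is \<open>inv_into (Q i) f \<gamma>\<close>.\<close>

definition skew_transfer ::
    "('m::topological_space \<Rightarrow> 'm) \<Rightarrow> ('m \<times> 'k::topological_space \<Rightarrow> 'k) \<Rightarrow> ('m \<Rightarrow> real) \<Rightarrow>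
     ('m \<Rightarrow> real) \<Rightarrow> 'm measure \<Rightarrow> nat \<Rightarrow> (nat \<Rightarrow> 'm set) \<Rightarrow>
     ('m \<times> 'k) signed_measure \<Rightarrow> ('m \<times> 'k) signed_measure" where
  "skew_transfer f G \<phi> h m d Q \<mu> = (THE \<eta>. \<eta> \<in> AB m \<and>
     (\<forall>r. fibre_restriction m \<mu> r \<longrightarrow> fibre_restriction m \<eta>
        (\<lambda>\<gamma>. (1 / h \<gamma>) *\<^sub>R (\<Sum>i<d. let \<gamma>\<^sub>i = inv_into (Q i) f \<gamma> in
           (h \<gamma>\<^sub>i * exp (\<phi> \<gamma>\<^sub>i)) *\<^sub>R push_signed (\<lambda>y. G (\<gamma>\<^sub>i, y)) (r \<gamma>\<^sub>i)))))"

definition admissible_observable ::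
    "('k::topological_space signed_measure \<Rightarrow> real) \<Rightarrow> 'm::topological_space measure \<Rightarrow>
     ('m \<Rightarrow> real) set \<Rightarrow> (('m \<Rightarrow> real) \<Rightarrow> real) \<Rightarrow> ('m \<times> 'k \<Rightarrow> real) \<Rightarrow> real \<Rightarrow> bool" where
  "admissible_observable No m Bs Ns u R\<^sub>4 \<longleftrightarrow> u \<in> borel_measurable borel \<and>
     (\<forall>\<mu>\<in>S_inf No m Bs. signed_integrable \<mu> u \<and>
        \<bar>signed_integral \<mu> u\<bar> \<le> R\<^sub>4 * S_inf_norm No m Ns \<mu>)"

definition admissible_densities ::
    "('k::topological_space signed_measure \<Rightarrow> real) \<Rightarrow> 'm::topological_space measure \<Rightarrow>
     ('m \<Rightarrow> real) set \<Rightarrow> ('m \<times> 'k) measure \<Rightarrow> ('m \<times> 'k \<Rightarrow> real) set" where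
  "admissible_densities No m Bs \<mu>\<^sub>0 =
     {v. v \<in> borel_measurable borel \<and> integrable \<mu>\<^sub>0 v \<and> weighted_measure \<mu>\<^sub>0 v \<in> S_inf No m Bs}"

end

theory Submission
  imports Defs
begin

text \<open>By conformality of \<open>\<nu>\<close> the operator \<open>\<lambda>\<^sup>-\<^sup>1F\<^sub>\<Phi>\<^sub>,\<^sub>h\<close> is the push-forward \<open>F\<^sub>*\<close> of signed measures:
  substituting along the inverse branches turns \<open>h\<^sup>-\<^sup>1\<Sum>\<^sub>i h(\<gamma>\<^sub>i)e\<^sup>\<phi>F\<^sub>*\<mu>|\<^sub>\<gamma>\<^sub>i\<close> into \<open>\<lambda>F\<^sub>*\<mu>\<close>. Hence
  \<open>P\<mu> = \<mu>(\<Sigma>)\<mu>\<^sub>0\<close>, and \<open>N\<^sup>n\<mu> = F\<^sub>*\<^sup>n\<mu> - P\<mu>\<close> for \<open>n \<ge> 1\<close>. The marginal density of \<open>N\<^sup>n\<mu>\<close> decays because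
  the base operator has a spectral gap, and then its fibre norm decays by the Lasota--Yorke inequality
  \<open>\<parallel>F\<^sub>*\<mu>\<parallel>\<^sub>\<infinity> \<le> \<alpha>\<parallel>\<mu>\<parallel>\<^sub>\<infinity> + |\<phi>\<^sub>1|\<^sub>s\<close>. Finally the correlation is the integral of \<open>u\<close> against \<open>N\<^sup>n(v\<mu>\<^sub>0)\<close>.\<close>


section \<open>Signed measures and their Jordan decomposition\<close>

text \<open>In the definitions, \<open>\<mu>|\<^sub>\<gamma>\<close> and the marginal density pass
  through the Jordan decomposition, which respects neither sums nor push-forwards, and they are
  fixed only up to null sets. The fibre calculus therefore runs on \<open>fibre_version\<close>: a
  family of signed measures that integrates to a given one is a.e. unique and determines it, so
  linearity, the operator and both parts of the norm can be read off from any such family. Its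
  existence on \<open>AB m\<close> is a disintegration theorem for Polish spaces. No spectral theory
  is applied to the space of measures, which need not be complete: only the base operator is split,
  and the projection above it is written down explicitly. The chain sup norm <= weak norm <= strong
  norm for marginal densities makes the total mass continuous, and this ties the two projections
  together. The Lasota-Yorke inequality is applied to the mass-zero differences
  \<open>(T ^^ n) \<mu> - P \<mu>\<close>. It gives a recursion a_(n+1) <= \<alpha> a_n + L \<xi>^n,
  so \<xi> has to exceed \<alpha> strictly and dominate the base rate.\<close>

lemma sm_val_notin: "A \<notin> sets borel \<Longrightarrow> sm_val \<mu> A = 0"
  using sm_val[of \<mu>] by auto

lemma sm_val_sums:
  assumes "\<And>i. A i \<in> sets borel" "disjoint_family A"
  shows "(\<lambda>i. sm_val \<mu> (A i)) sums sm_val \<mu> (\<Union>i::nat. A i)"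
  using sm_val[of \<mu>] assms by auto

lemma sm_val_Abs:
  assumes "\<And>A. A \<notin> sets borel \<Longrightarrow> g A = 0"
    and "\<And>A. (\<And>i::nat. A i \<in> sets borel) \<Longrightarrow> disjoint_family A \<Longrightarrow> (\<lambda>i. g (A i)) sums g (\<Union>i. A i)"
  shows "sm_val (Abs_signed_measure g) = g"
  by (rule Abs_signed_measure_inverse) (use assms in auto)

lemma sm_eqI: "(\<And>A. A \<in> sets borel \<Longrightarrow> sm_val \<mu> A = sm_val \<eta> A) \<Longrightarrow> \<mu> = \<eta>"
  by (metis sm_val_inject sm_val_notin ext)

lemma sm_val_empty [simp]: "sm_val \<mu> {} = 0"
proof -
  have "(\<lambda>i::nat. sm_val \<mu> {}) sums sm_val \<mu> (\<Union>i::nat. {})"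
    by (rule sm_val_sums) (auto simp: disjoint_family_on_def)
  then have "(\<lambda>i::nat. sm_val \<mu> {}) \<longlonglongrightarrow> 0"
    by (simp add: sums_iff summable_LIMSEQ_zero)
  then show ?thesis by (simp add: LIMSEQ_const_iff)
qed

lemma sm_val_Un:
  assumes "A \<in> sets borel" "B \<in> sets borel" "A \<inter> B = {}"
  shows "sm_val \<mu> (A \<union> B) = sm_val \<mu> A + sm_val \<mu> B"
proof -
  have s: "(\<lambda>i. sm_val \<mu> (binaryset A B i)) sums sm_val \<mu> (\<Union>i. binaryset A B i)"
    using assms by (intro sm_val_sums) (auto simp: disjoint_family_on_def binaryset_def)
  moreover have "(\<lambda>i. sm_val \<mu> (binaryset A B i)) sums (sm_val \<mu> A + sm_val \<mu> B)"
    by (rule binaryset_sums) simp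
  ultimately show ?thesis by (metis UN_binaryset_eq sums_unique2)
qed

lemma sm_val_split:
  assumes "A \<in> sets borel" "B \<in> sets borel"
  shows "sm_val \<mu> A = sm_val \<mu> (A \<inter> B) + sm_val \<mu> (A - B)"
proof -
  have "sm_val \<mu> ((A \<inter> B) \<union> (A - B)) = sm_val \<mu> (A \<inter> B) + sm_val \<mu> (A - B)"
    using assms by (intro sm_val_Un) auto
  then show ?thesis by (simp add: Int_Diff_Un)
qed

lemmas sm_val_simps [simp] = zero_signed_measure.rep_eq plus_signed_measure.rep_eq
  uminus_signed_measure.rep_eq minus_signed_measure.rep_eq scaleR_signed_measure.rep_eq

text \<open>If a set has subsets of arbitrarily large value, it splits into two pieces of value
  larger than 1, and one of them inherits the property. Iterating peels off infinitely many disjoint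
  sets of value larger than 1, against countable additivity.\<close>

lemma sm_val_bounded: "\<exists>C. \<forall>A. \<bar>sm_val \<mu> A\<bar> \<le> C"
proof (rule ccontr)
  assume *: "\<not> ?thesis"
  define unb where "unb X \<longleftrightarrow> X \<in> sets borel \<and> (\<forall>C. \<exists>B\<in>sets borel. B \<subseteq> X \<and> C < \<bar>sm_val \<mu> B\<bar>)" for X
  have U: "unb UNIV"
    unfolding unb_def
  proof safe
    fix C
    obtain A where A: "max 0 C < \<bar>sm_val \<mu> A\<bar>" using * by (meson not_le)
    then have "A \<in> sets borel" using sm_val_notin[of A \<mu>] by (cases "A \<in> sets borel") auto
    then show "\<exists>B\<in>sets borel. B \<subseteq> UNIV \<and> C < \<bar>sm_val \<mu> B\<bar>" using A by auto
  qed auto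
  have step: "\<exists>Y. unb Y \<and> Y \<subseteq> X \<and> 1 < \<bar>sm_val \<mu> (X - Y)\<bar>" if "unb X" for X
  proof -
    have X: "X \<in> sets borel" using that by (simp add: unb_def)
    \<comment> \<open>The threshold is chosen so that B and X - B both have absolute value above 1;
      either of them may then be the piece that is peeled off.\<close>
    have "\<exists>B\<in>sets borel. B \<subseteq> X \<and> 1 + \<bar>sm_val \<mu> X\<bar> < \<bar>sm_val \<mu> B\<bar>"
      using that by (simp add: unb_def)
    then obtain B where B: "B \<in> sets borel" "B \<subseteq> X" "1 + \<bar>sm_val \<mu> X\<bar> < \<bar>sm_val \<mu> B\<bar>"
      by auto
    have XB: "sm_val \<mu> X = sm_val \<mu> B + sm_val \<mu> (X - B)"
      using sm_val_split[OF X B(1), of \<mu>] B(2) by (simp add: Int_absorb1)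
    have "unb B \<or> unb (X - B)"
    proof (rule ccontr)
      assume "\<not> ?thesis"
      then have "\<exists>C. \<forall>A\<in>sets borel. A \<subseteq> B \<longrightarrow> \<bar>sm_val \<mu> A\<bar> \<le> C"
          "\<exists>C. \<forall>A\<in>sets borel. A \<subseteq> X - B \<longrightarrow> \<bar>sm_val \<mu> A\<bar> \<le> C"
        using B(1) X by (simp_all add: unb_def not_less)
      then obtain C1 C2 where C: "\<And>A. A \<in> sets borel \<Longrightarrow> A \<subseteq> B \<Longrightarrow> \<bar>sm_val \<mu> A\<bar> \<le> C1"
         "\<And>A. A \<in> sets borel \<Longrightarrow> A \<subseteq> X - B \<Longrightarrow> \<bar>sm_val \<mu> A\<bar> \<le> C2"
        by metis
      have "\<exists>A\<in>sets borel. A \<subseteq> X \<and> C1 + C2 < \<bar>sm_val \<mu> A\<bar>"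
        using \<open>unb X\<close> by (simp add: unb_def)
      then obtain A where A: "A \<in> sets borel" "A \<subseteq> X" "C1 + C2 < \<bar>sm_val \<mu> A\<bar>"
        by auto
      have "\<bar>sm_val \<mu> (A \<inter> B)\<bar> \<le> C1" "\<bar>sm_val \<mu> (A - B)\<bar> \<le> C2"
        using A B by (auto intro!: C)
      with A(3) sm_val_split[OF A(1) B(1), of \<mu>] show False by linarith
    qed
    then show ?thesis
    proof
      assume "unb B"
      then show ?thesis using B XB by (intro exI[of _ B]) auto
    next
      assume "unb (X - B)"
      moreover have "X - (X - B) = B" using B by auto
      ultimately show ?thesis using B XB by (intro exI[of _ "X - B"]) auto
    qed
  qed
  obtain X where X: "\<And>n. unb (X n)" "\<And>n. X (Suc n) \<subseteq> X n \<and> 1 < \<bar>sm_val \<mu> (X n - X (Suc n))\<bar>"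
  proof -
    have "\<exists>X. \<forall>n. unb (X n) \<and> (X (Suc n) \<subseteq> X n \<and> 1 < \<bar>sm_val \<mu> (X n - X (Suc n))\<bar>)"
      using U step by (intro dependent_nat_choice) auto
    then show ?thesis using that by blast
  qed
  \<comment> \<open>\<open>disjoint_family_Suc\<close> speaks of increasing sequences, hence the
    complements.\<close>
  have "disjoint_family (\<lambda>n. - X (Suc n) - - X n)"
    using X(2) by (intro disjoint_family_Suc) auto
  then have "disjoint_family (\<lambda>n. X n - X (Suc n))"
    by (simp add: disjoint_family_on_def) blast
  moreover have "X n - X (Suc n) \<in> sets borel" for n
    using X(1) by (auto simp: unb_def)
  ultimately have "(\<lambda>n. sm_val \<mu> (X n - X (Suc n))) \<longlonglongrightarrow> 0"
    using sm_val_sums[of "\<lambda>n. X n - X (Suc n)" \<mu>] by (auto simp: sums_iff summable_LIMSEQ_zero)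
  then have "eventually (\<lambda>n. \<bar>sm_val \<mu> (X n - X (Suc n))\<bar> < 1) sequentially"
    by (auto dest!: order_tendstoD(2)[OF tendsto_rabs_zero, of _ _ 1])
  then obtain n where "\<bar>sm_val \<mu> (X n - X (Suc n))\<bar> < 1"
    by (auto simp: eventually_sequentially)
  then show False using X(2)[of n] by linarith
qed

text \<open>The witness is the positive variation. It is superadditive on disjoint sets and, by
  cutting each subset along the pieces, countably subadditive; boundedness of the signed measure
  makes it finite.\<close>

lemma ex_dominating_measure:
  fixes \<mu> :: "'a::topological_space signed_measure"
  shows "\<exists>p. finite_measure p \<and> sets p = sets borel \<and> (\<forall>A\<in>sets borel. sm_val \<mu> A \<le> measure p A)"
proof -
  \<comment> \<open>\<open>ennreal\<close> sends negative values to 0, so only sets of positive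
    value count, and the empty set keeps the supremum at 0 or above.\<close>
  define g where "g A = (SUP B\<in>{B\<in>sets borel. B \<subseteq> A}. ennreal (sm_val \<mu> B))" for A
  obtain C where C: "\<And>A. \<bar>sm_val \<mu> A\<bar> \<le> C" using sm_val_bounded by blast
  have gle: "ennreal (sm_val \<mu> B) \<le> g A" if "B \<in> sets borel" "B \<subseteq> A" for A B
    unfolding g_def using that by (intro SUP_upper) auto
  have mono: "g A \<le> g B" if "A \<subseteq> B" for A B
    unfolding g_def using that by (intro SUP_subset_mono) auto
  have add: "g X + g Y \<le> g (X \<union> Y)" if "X \<inter> Y = {}" for X Y
  proof -
    have 1: "ennreal (sm_val \<mu> A) + ennreal (sm_val \<mu> B) \<le> g (X \<union> Y)"
      if "A \<in> sets borel" "A \<subseteq> X" "B \<in> sets borel" "B \<subseteq> Y" for A B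
    proof (cases "sm_val \<mu> A \<ge> 0 \<and> sm_val \<mu> B \<ge> 0")
      case True
      have "sm_val \<mu> (A \<union> B) = sm_val \<mu> A + sm_val \<mu> B"
        using that \<open>X \<inter> Y = {}\<close> by (intro sm_val_Un) auto
      then have "ennreal (sm_val \<mu> A) + ennreal (sm_val \<mu> B) = ennreal (sm_val \<mu> (A \<union> B))"
        using True by simp
      also have "\<dots> \<le> g (X \<union> Y)" using that by (intro gle) auto
      finally show ?thesis .
    next
      \<comment> \<open>One of the two summands is 0 in \<open>ennreal\<close>, so a single set
        bounds the sum.\<close>
      case False
      moreover have "ennreal (sm_val \<mu> A) \<le> g (X \<union> Y)" "ennreal (sm_val \<mu> B) \<le> g (X \<union> Y)"
        using that by (auto intro!: gle)
      ultimately show ?thesis by (auto simp: ennreal_neg not_le less_imp_le)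
    qed
    have "g X + g Y = (SUP A\<in>{B\<in>sets borel. B \<subseteq> X}. ennreal (sm_val \<mu> A) + g Y)"
      unfolding g_def[of X] by (subst ennreal_SUP_add_left) auto
    also have "\<dots> \<le> g (X \<union> Y)"
    proof (rule SUP_least)
      fix A assume A: "A \<in> {B\<in>sets borel. B \<subseteq> X}"
      have "ennreal (sm_val \<mu> A) + g Y = (SUP B\<in>{B\<in>sets borel. B \<subseteq> Y}. ennreal (sm_val \<mu> A) + ennreal (sm_val \<mu> B))"
        unfolding g_def[of Y] by (subst ennreal_SUP_add_right) auto
      also have "\<dots> \<le> g (X \<union> Y)" using A 1 by (intro SUP_least) auto
      finally show "ennreal (sm_val \<mu> A) + g Y \<le> g (X \<union> Y)" .
    qed
    finally show ?thesis .
  qed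
  have fin: "(\<Sum>i<n. g (A i)) \<le> g (\<Union>i<n. A i)" if "disjoint_family A" for A :: "nat \<Rightarrow> _" and n
  proof (induction n)
    case (Suc n)
    have "(\<Sum>i<Suc n. g (A i)) \<le> g (\<Union>i<n. A i) + g (A n)"
      unfolding sum.lessThan_Suc by (rule add_right_mono[OF Suc])
    also have "\<dots> \<le> g ((\<Union>i<n. A i) \<union> A n)"
    proof (rule add)
      have "A i \<inter> A n = {}" if "i < n" for i
        using \<open>disjoint_family A\<close> that by (intro disjoint_family_onD) auto
      then show "(\<Union>i<n. A i) \<inter> A n = {}" by auto
    qed
    also have "(\<Union>i<n. A i) \<union> A n = (\<Union>i<Suc n. A i)" by (auto simp: less_Suc_eq)
    finally show ?case .
  qed simp
  have cadd: "countably_additive (sets borel) g"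
  proof (rule countably_additiveI)
    fix A :: "nat \<Rightarrow> 'a set" assume A: "range A \<subseteq> sets borel" "disjoint_family A"
    show "(\<Sum>i. g (A i)) = g (\<Union>i. A i)"
    proof (rule antisym)
      show "(\<Sum>i. g (A i)) \<le> g (\<Union>i. A i)"
      proof (rule suminf_le_const)
        fix n
        have "(\<Sum>i<n. g (A i)) \<le> g (\<Union>i<n. A i)" by (rule fin[OF A(2)])
        also have "\<dots> \<le> g (\<Union>i. A i)" by (rule mono) auto
        finally show "(\<Sum>i<n. g (A i)) \<le> g (\<Union>i. A i)" .
      qed auto
      show "g (\<Union>i. A i) \<le> (\<Sum>i. g (A i))"
        unfolding g_def[of "\<Union>i. A i"]
      proof (rule SUP_least)
        fix B assume B: "B \<in> {B \<in> sets borel. B \<subseteq> (\<Union>i. A i)}"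
        have "(\<lambda>i. sm_val \<mu> (B \<inter> A i)) sums sm_val \<mu> (\<Union>i. B \<inter> A i)"
          using A B by (intro sm_val_sums) (auto simp: disjoint_family_on_def)
        also have "(\<Union>i. B \<inter> A i) = B" using B by auto
        finally have "(\<lambda>n. ennreal (\<Sum>i<n. sm_val \<mu> (B \<inter> A i))) \<longlonglongrightarrow> ennreal (sm_val \<mu> B)"
          unfolding sums_def by (rule tendsto_ennrealI)
        moreover have "ennreal (\<Sum>i<n. sm_val \<mu> (B \<inter> A i)) \<le> (\<Sum>i. g (A i))" for n
        proof -
          \<comment> \<open>The partial sum has terms of both signs; positive parts are taken before
            \<open>ennreal\<close> is moved inside.\<close>
          have "ennreal (\<Sum>i<n. sm_val \<mu> (B \<inter> A i)) \<le> ennreal (\<Sum>i<n. max 0 (sm_val \<mu> (B \<inter> A i)))"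
            by (intro ennreal_leI sum_mono) auto
          also have "\<dots> = (\<Sum>i<n. ennreal (sm_val \<mu> (B \<inter> A i)))"
            by (subst sum_ennreal[symmetric]) (auto simp: ennreal_max_0)
          also have "\<dots> \<le> (\<Sum>i<n. g (A i))"
            using A B by (intro sum_mono gle) auto
          also have "\<dots> \<le> (\<Sum>i. g (A i))" by (rule sum_le_suminf) auto
          finally show ?thesis .
        qed
        ultimately show "ennreal (sm_val \<mu> B) \<le> (\<Sum>i. g (A i))"
          by (intro LIMSEQ_le_const2) auto
      qed
    qed
  qed
  have pos: "positive (sets borel) g"
    by (simp add: positive_def g_def)
  define p where "p = measure_of (UNIV::'a set) (sets borel) g"
  have sp: "sets p = sets borel" unfolding p_def
    by (metis sets_measure_of_conv sets.sigma_sets_eq sets.space_closed space_borel)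
  have ep: "emeasure p A = g A" if "A \<in> sets borel" for A
    unfolding p_def using pos cadd that
    by (intro emeasure_measure_of_sigma) (auto intro: sets.sigma_algebra_axioms[of borel, simplified])
  have gC: "g A \<le> ennreal C" for A
    unfolding g_def by (intro SUP_least ennreal_leI) (use C in \<open>auto simp: abs_le_iff\<close>)
  have fm: "finite_measure p"
  proof
    show "emeasure p (space p) \<noteq> \<infinity>"
      using ep[of UNIV] gC[of UNIV] sets_eq_imp_space_eq[OF sp] by (auto simp: top_unique)
  qed
  interpret finite_measure p by fact
  have "sm_val \<mu> A \<le> measure p A" if "A \<in> sets borel" for A
  proof -
    have "ennreal (sm_val \<mu> A) \<le> ennreal (measure p A)"
      using gle[OF that subset_refl] ep[OF that] emeasure_eq_measure[of A] by simp
    then show ?thesis by (simp add: ennreal_le_iff)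
  qed
  with fm sp show ?thesis by blast
qed

lemma ex_measure_of_nonneg:
  fixes \<mu> :: "'a::topological_space signed_measure"
  assumes "\<And>A. A \<in> sets borel \<Longrightarrow> 0 \<le> sm_val \<mu> A"
  shows "\<exists>p. finite_measure p \<and> sets p = sets borel \<and> (\<forall>A\<in>sets borel. measure p A = sm_val \<mu> A)"
proof -
  define p where "p = measure_of (UNIV::'a set) (sets borel) (\<lambda>A. ennreal (sm_val \<mu> A))"
  have sp: "sets p = sets borel" unfolding p_def
    by (metis sets_measure_of_conv sets.sigma_sets_eq sets.space_closed space_borel)
  have cadd: "countably_additive (sets borel) (\<lambda>A. ennreal (sm_val \<mu> A))"
  proof (rule countably_additiveI)
    fix A :: "nat \<Rightarrow> 'a set" assume A: "range A \<subseteq> sets borel" "disjoint_family A"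
    have "(\<lambda>i. sm_val \<mu> (A i)) sums sm_val \<mu> (\<Union>i. A i)"
      using A by (intro sm_val_sums) auto
    then show "(\<Sum>i. ennreal (sm_val \<mu> (A i))) = ennreal (sm_val \<mu> (\<Union> (range A)))"
      using assms A by (intro suminf_ennreal_eq) auto
  qed
  have ep: "emeasure p A = ennreal (sm_val \<mu> A)" if "A \<in> sets borel" for A
    unfolding p_def using cadd that
    by (intro emeasure_measure_of_sigma)
       (auto intro: sets.sigma_algebra_axioms[of borel, simplified] simp: positive_def)
  have fm: "finite_measure p"
    by standard (simp add: ep sets_eq_imp_space_eq[OF sp])
  have "measure p A = sm_val \<mu> A" if "A \<in> sets borel" for A
    using ep[OF that] assms[OF that] by (simp add: measure_def)
  with fm sp show ?thesis by blast
qed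

section \<open>Images, densities and restrictions of signed measures\<close>

lemma sm_val_signed_of:
  fixes M :: "'a::topological_space measure"
  assumes "finite_measure M" "sets M = sets borel"
  shows "sm_val (signed_of M) A = measure M A"
proof -
  interpret finite_measure M by fact
  have "sm_val (Abs_signed_measure (measure M)) = measure M"
    using assms(2) by (intro sm_val_Abs finite_measure_UNION) (auto simp: measure_notin_sets)
  then show ?thesis by (simp add: signed_of_def)
qed

lemma vimage_borel: "T \<in> borel_measurable borel \<Longrightarrow> A \<in> sets borel \<Longrightarrow> T -` A \<in> sets borel"
  using measurable_sets[of T borel borel A] by simp

lemma sm_val_push:
  fixes T :: "'a::topological_space \<Rightarrow> 'b::topological_space"
  assumes T: "T \<in> borel_measurable borel" and A: "A \<in> sets borel"
  shows "sm_val (push_signed T \<mu>) A = sm_val \<mu> (T -` A)"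
proof -
  have "sm_val (Abs_signed_measure (\<lambda>A. if A \<in> sets borel then sm_val \<mu> (T -` A) else 0)) = (\<lambda>A. if A \<in> sets borel then sm_val \<mu> (T -` A) else 0)"
  proof (rule sm_val_Abs)
    fix A :: "nat \<Rightarrow> 'b set" assume A: "\<And>i. A i \<in> sets borel" "disjoint_family A"
    then have "(\<lambda>i. sm_val \<mu> (T -` A i)) sums sm_val \<mu> (\<Union>i. T -` A i)"
      using T by (intro sm_val_sums) (auto simp: disjoint_family_on_def vimage_borel)
    then show "(\<lambda>i. if A i \<in> sets borel then sm_val \<mu> (T -` A i) else 0) sums
        (if (\<Union>i. A i) \<in> sets borel then sm_val \<mu> (T -` (\<Union>i. A i)) else 0)"
      using A by (auto simp: vimage_UN)
  qed simp
  then show ?thesis using assms by (simp add: push_signed_def)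
qed

lemma sm_val_push_UNIV [simp]:
  "T \<in> borel_measurable borel \<Longrightarrow> sm_val (push_signed T \<mu>) UNIV = sm_val \<mu> UNIV"
  by (simp add: sm_val_push)

lemma push_signed_add: "T \<in> borel_measurable borel \<Longrightarrow>
    push_signed T (\<mu> + \<eta>) = push_signed T \<mu> + push_signed T \<eta>"
  and push_signed_diff: "T \<in> borel_measurable borel \<Longrightarrow>
    push_signed T (\<mu> - \<eta>) = push_signed T \<mu> - push_signed T \<eta>"
  and push_signed_scaleR: "T \<in> borel_measurable borel \<Longrightarrow>
    push_signed T (c *\<^sub>R \<mu>) = c *\<^sub>R push_signed T \<mu>"
  by (auto intro!: sm_eqI simp: sm_val_push)

lemma push_signed_funpow:
  fixes T :: "'a::topological_space \<Rightarrow> 'a"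
  assumes "T \<in> borel_measurable borel"
  shows "(push_signed T ^^ n) \<mu> = push_signed (T ^^ n) \<mu>"
proof (induction n)
  case 0
  have "id \<in> borel_measurable (borel :: 'a measure)" by (simp add: id_def)
  then show ?case by (intro sm_eqI) (simp add: sm_val_push)
next
  case (Suc n)
  have Tn: "T ^^ n \<in> borel_measurable borel" for n
    using assms by (induction n) (auto intro: measurable_comp simp: id_def)
  have "sm_val (push_signed T (push_signed (T ^^ n) \<mu>)) A = sm_val (push_signed (T ^^ Suc n) \<mu>) A"
    if "A \<in> sets borel" for A
    using that by (simp add: sm_val_push[OF assms] sm_val_push[OF Tn] sm_val_push[OF Tn[of "Suc n", simplified]]
      vimage_borel[OF assms] vimage_comp)
  then have "push_signed T (push_signed (T ^^ n) \<mu>) = push_signed (T ^^ Suc n) \<mu>"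
    by (rule sm_eqI)
  moreover have "(push_signed T ^^ Suc n) \<mu> = push_signed T ((push_signed T ^^ n) \<mu>)" by simp
  ultimately show ?case using Suc.IH by (simp only:)
qed

lemma sm_val_weighted:
  fixes M :: "'a::topological_space measure"
  assumes s: "sets M = sets borel" and v: "integrable M v" and A: "A \<in> sets borel"
  shows "sm_val (weighted_measure M v) A = (LINT x:A|M. v x)"
proof -
  have "sm_val (Abs_signed_measure (\<lambda>A. if A \<in> sets borel then (LINT x:A|M. v x) else 0)) =
      (\<lambda>A. if A \<in> sets borel then (LINT x:A|M. v x) else 0)"
  proof (rule sm_val_Abs)
    fix A :: "nat \<Rightarrow> 'a set" assume A: "\<And>i. A i \<in> sets borel" "disjoint_family A"
    have [measurable]: "A i \<in> sets M" for i using A s by auto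
    have i: "set_integrable M B v" if "B \<in> sets M" for B
      unfolding set_integrable_def using integrable_mult_indicator[OF that v] by simp
    have "(\<lambda>i. LINT x:A i|M. v x) sums (LINT x:(\<Union>i. A i)|M. v x)"
      unfolding sums_def
    proof (rule Lim_transform_eventually)
      have "(\<lambda>n. LINT x:(\<Union>i<n. A i)|M. v x) \<longlonglongrightarrow> (LINT x:(\<Union>n. \<Union>i<n. A i)|M. v x)"
        by (intro set_integral_cont_up i) (auto simp: incseq_def intro: less_le_trans)
      also have "(\<Union>n. \<Union>i<n. A i) = (\<Union>i. A i)" by blast
      finally show "(\<lambda>n. LINT x:(\<Union>i<n. A i)|M. v x) \<longlonglongrightarrow> (LINT x:(\<Union>i. A i)|M. v x)" .
      show "\<forall>\<^sub>F n in sequentially. (LINT x:(\<Union>i<n. A i)|M. v x) = (\<Sum>i<n. LINT x:A i|M. v x)"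
        using A(2) i by (intro always_eventually allI set_integral_finite_Union)
          (auto simp: disjoint_family_on_def)
    qed
    then show "(\<lambda>i. if A i \<in> sets borel then (LINT x:A i|M. v x) else 0) sums
        (if (\<Union>i. A i) \<in> sets borel then (LINT x:(\<Union>i. A i)|M. v x) else 0)"
      using A by auto
  qed simp
  then show ?thesis using assms by (simp add: weighted_measure_def)
qed

section \<open>Existence and uniqueness of the Jordan decomposition\<close>

definition sm_restrict :: "'a::topological_space set \<Rightarrow> 'a signed_measure \<Rightarrow> 'a signed_measure" where
  "sm_restrict H \<mu> = Abs_signed_measure (\<lambda>A. if A \<in> sets borel then sm_val \<mu> (A \<inter> H) else 0)"

lemma sm_val_restrict:
  fixes \<mu> :: "'a::topological_space signed_measure"
  assumes "H \<in> sets borel" "A \<in> sets borel"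
  shows "sm_val (sm_restrict H \<mu>) A = sm_val \<mu> (A \<inter> H)"
proof -
  have "sm_val (Abs_signed_measure (\<lambda>A. if A \<in> sets borel then sm_val \<mu> (A \<inter> H) else 0)) = (\<lambda>A. if A \<in> sets borel then sm_val \<mu> (A \<inter> H) else 0)"
  proof (rule sm_val_Abs)
    fix A :: "nat \<Rightarrow> 'a set" assume A: "\<And>i. A i \<in> sets borel" "disjoint_family A"
    then have "(\<lambda>i. sm_val \<mu> (A i \<inter> H)) sums sm_val \<mu> (\<Union>i. A i \<inter> H)"
      using assms(1) by (intro sm_val_sums) (auto simp: disjoint_family_on_def)
    then show "(\<lambda>i. if A i \<in> sets borel then sm_val \<mu> (A i \<inter> H) else 0) sums
        (if (\<Union>i. A i) \<in> sets borel then sm_val \<mu> ((\<Union>i. A i) \<inter> H) else 0)"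
      using A by auto
  qed simp
  then show ?thesis using assms by (simp add: sm_restrict_def)
qed

text \<open>The predicate under the description operator in \<open>jordan_decomp\<close>, named so
  that its existence and uniqueness can be stated.\<close>

definition jordan_pair :: "'a::topological_space signed_measure \<Rightarrow> 'a measure \<Rightarrow> 'a measure \<Rightarrow> bool" where
  "jordan_pair \<mu> p n \<longleftrightarrow>
     finite_measure p \<and> finite_measure n \<and> sets p = sets borel \<and> sets n = sets borel \<and>
     (\<exists>H\<in>sets borel. emeasure p (- H) = 0 \<and> emeasure n H = 0) \<and>
     (\<forall>A\<in>sets borel. sm_val \<mu> A = measure p A - measure n A)"

text \<open>A dominating measure \<open>p0\<close> makes \<open>p0 - \<mu>\<close> a measure
  \<open>n1\<close>, so \<mu> is a difference of two finite measures. Their Hahn decomposition gives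
  a set H on which \<mu> is nonnegative and off which it is nonpositive; the two parts are the
  restrictions of \<mu>.\<close>

lemma ex_jordan_pair: "\<exists>p n. jordan_pair \<mu> p n"
proof -
  obtain p0 where p0: "finite_measure p0" "sets p0 = sets borel"
    "\<And>A. A \<in> sets borel \<Longrightarrow> sm_val \<mu> A \<le> measure p0 A"
    using ex_dominating_measure[of \<mu>] by blast
  obtain n0 where n0: "finite_measure n0" "sets n0 = sets borel"
    "\<And>A. A \<in> sets borel \<Longrightarrow> - sm_val \<mu> A \<le> measure n0 A"
    using ex_dominating_measure[of "- \<mu>"] by auto
  interpret p0: finite_measure p0 by fact
  note s = sm_val_signed_of[OF p0(1,2)]
  obtain n1 where n1: "finite_measure n1" "sets n1 = sets borel"
    "\<And>A. A \<in> sets borel \<Longrightarrow> measure n1 A = measure p0 A - sm_val \<mu> A"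
    using ex_measure_of_nonneg[of "signed_of p0 - \<mu>"] p0(3) s by auto
  interpret n1: finite_measure n1 by fact
  obtain H where H: "H \<in> sets borel" 
    "\<And>X. X \<in> sets borel \<Longrightarrow> X \<subseteq> H \<Longrightarrow> measure n1 X \<le> measure p0 X"
    "\<And>X. X \<in> sets borel \<Longrightarrow> X \<inter> H = {} \<Longrightarrow> measure p0 X \<le> measure n1 X"
  proof -
    have "\<exists>Y\<in>sets p0. Y \<subseteq> UNIV \<and> (\<forall>X\<in>sets p0. X \<subseteq> Y \<longrightarrow> emeasure n1 X \<le> emeasure p0 X) \<and>
      (\<forall>X\<in>sets p0. X \<subseteq> UNIV \<longrightarrow> X \<inter> Y = {} \<longrightarrow> emeasure p0 X \<le> emeasure n1 X)"
      using p0(2) n1(2) by (intro unsigned_Hahn_decomposition) auto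
    then show ?thesis
      using that p0(2) by (auto simp: p0.emeasure_eq_measure n1.emeasure_eq_measure)
  qed
  have mu: "sm_val \<mu> A = measure p0 A - measure n1 A" if "A \<in> sets borel" for A
    using n1(3)[OF that] by simp
  obtain p where p: "finite_measure p" "sets p = sets borel"
    "\<And>A. A \<in> sets borel \<Longrightarrow> measure p A = sm_val \<mu> (A \<inter> H)"
    using ex_measure_of_nonneg[of "sm_restrict H \<mu>"] H
    by (auto simp: sm_val_restrict mu)
  obtain n where n: "finite_measure n" "sets n = sets borel"
    "\<And>A. A \<in> sets borel \<Longrightarrow> measure n A = - sm_val \<mu> (A - H)"
  proof -
    have "\<exists>p. finite_measure p \<and> sets p = sets borel \<and> (\<forall>A\<in>sets borel. measure p A = sm_val (- sm_restrict (-H) \<mu>) A)"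
    proof (rule ex_measure_of_nonneg)
      fix A :: "'a set" assume A: "A \<in> sets borel"
      then have "sm_val \<mu> (A \<inter> - H) \<le> 0" using H by (subst mu) auto
      then show "0 \<le> sm_val (- sm_restrict (- H) \<mu>) A"
        using A H(1) by (simp add: sm_val_restrict borel_comp)
    qed
    then show ?thesis
      using that H(1) by (auto simp: sm_val_restrict borel_comp Diff_eq)
  qed
  interpret p: finite_measure p by fact
  interpret n: finite_measure n by fact
  have "jordan_pair \<mu> p n"
    unfolding jordan_pair_def
  proof (intro conjI bexI[of _ H] ballI)
    show "sm_val \<mu> A = measure p A - measure n A" if "A \<in> sets borel" for A
      using sm_val_split[OF that H(1), of \<mu>] p(3)[OF that] n(3)[OF that] by simp
    show "emeasure p (- H) = 0" "emeasure n H = 0"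
      using H(1) by (simp_all add: p.emeasure_eq_measure n.emeasure_eq_measure p n borel_comp)
  qed (use p n H in auto)
  then show ?thesis by blast
qed

lemma measure_eq_0_mono:
  assumes "emeasure M C = 0" "C \<in> sets M" "B \<subseteq> C"
  shows "measure M B = 0"
  using emeasure_mono[OF assms(3,2)] assms(1) by (simp add: measure_def)

text \<open>On H - H' the first pair makes \<mu> nonnegative and the second makes it nonpositive, so
  it vanishes there, and likewise on H' - H. Hence both positive parts of A equal the value of \<mu>
  on the intersection of A, H and H'.\<close>

lemma jordan_pair_unique:
  assumes "jordan_pair \<mu> p n" "jordan_pair \<mu> p' n'"
  shows "p = p' \<and> n = n'"
proof -
  obtain H where H: "H \<in> sets borel" "emeasure p (- H) = 0" "emeasure n H = 0"
    using assms(1) by (auto simp: jordan_pair_def)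
  obtain H' where H': "H' \<in> sets borel" "emeasure p' (- H') = 0" "emeasure n' H' = 0"
    using assms(2) by (auto simp: jordan_pair_def)
  have [simp]: "sets p = sets borel" "sets n = sets borel" "sets p' = sets borel" "sets n' = sets borel"
    and mu: "\<And>A. A \<in> sets borel \<Longrightarrow> sm_val \<mu> A = measure p A - measure n A"
    and mu': "\<And>A. A \<in> sets borel \<Longrightarrow> sm_val \<mu> A = measure p' A - measure n' A"
    using assms by (auto simp: jordan_pair_def)
  interpret p: finite_measure p using assms by (simp add: jordan_pair_def)
  interpret n: finite_measure n using assms by (simp add: jordan_pair_def)
  interpret p': finite_measure p' using assms by (simp add: jordan_pair_def)
  interpret n': finite_measure n' using assms by (simp add: jordan_pair_def)
  have z: "measure p B = 0" if "B \<subseteq> - H" for B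
    using H(1,2) that by (intro measure_eq_0_mono[of p "- H"]) (auto simp: borel_comp)
  have z': "measure p' B = 0" if "B \<subseteq> - H'" for B
    using H'(1,2) that by (intro measure_eq_0_mono[of p' "- H'"]) (auto simp: borel_comp)
  have y: "measure n B = 0" if "B \<subseteq> H" for B
    using H(1,3) that by (intro measure_eq_0_mono[of n "H"]) (auto simp: borel_comp)
  have y': "measure n' B = 0" if "B \<subseteq> H'" for B
    using H'(1,3) that by (intro measure_eq_0_mono[of n' "H'"]) (auto simp: borel_comp)
  have pp: "measure p A = measure p' A" if A: "A \<in> sets borel" for A
  proof -
    have 1: "sm_val \<mu> (A \<inter> H - H') = 0" 
    proof -
      have "sm_val \<mu> (A \<inter> H - H') = measure p (A \<inter> H - H') - measure n (A \<inter> H - H')"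
        using A H(1) H'(1) by (intro mu) auto
      moreover have "measure n (A \<inter> H - H') = 0" by (rule y) auto
      moreover have "sm_val \<mu> (A \<inter> H - H') = measure p' (A \<inter> H - H') - measure n' (A \<inter> H - H')"
        using A H(1) H'(1) by (intro mu') auto
      moreover have "measure p' (A \<inter> H - H') = 0" by (rule z') auto
      ultimately show ?thesis
        using measure_nonneg[of p "A \<inter> H - H'"] measure_nonneg[of n' "A \<inter> H - H'"] by linarith
    qed
    have 2: "sm_val \<mu> (A \<inter> H' - H) = 0" 
    proof -
      have "sm_val \<mu> (A \<inter> H' - H) = measure p (A \<inter> H' - H) - measure n (A \<inter> H' - H)"
        using A H(1) H'(1) by (intro mu) auto
      moreover have "measure p (A \<inter> H' - H) = 0" by (rule z) auto
      moreover have "sm_val \<mu> (A \<inter> H' - H) = measure p' (A \<inter> H' - H) - measure n' (A \<inter> H' - H)"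
        using A H(1) H'(1) by (intro mu') auto
      moreover have "measure n' (A \<inter> H' - H) = 0" by (rule y') auto
      ultimately show ?thesis
        using measure_nonneg[of p' "A \<inter> H' - H"] measure_nonneg[of n "A \<inter> H' - H"] by linarith
    qed
    have "measure p A = measure p (A \<inter> H) + measure p (A - H)"
      using A H(1) p.finite_measure_Union[of "A \<inter> H" "A - H"] by (simp add: Int_Diff_Un Int_Diff_disjoint)
    also have "\<dots> = sm_val \<mu> (A \<inter> H)"
    proof -
      have "measure p (A - H) = 0" by (rule z) auto
      moreover have "measure n (A \<inter> H) = 0" by (rule y) auto
      ultimately show ?thesis using A H(1) mu[of "A \<inter> H"] by simp
    qed
    also have "\<dots> = sm_val \<mu> (A \<inter> H \<inter> H')"
      using sm_val_split[of "A \<inter> H" H' \<mu>] A H(1) H'(1) 1 by simp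
    also have "\<dots> = sm_val \<mu> (A \<inter> H' \<inter> H)" by (simp add: Int_ac)
    also have "\<dots> = sm_val \<mu> (A \<inter> H')"
      using sm_val_split[of "A \<inter> H'" H \<mu>] A H(1) H'(1) 2 by simp
    also have "\<dots> = measure p' (A \<inter> H') + measure p' (A - H')"
    proof -
      have "measure p' (A - H') = 0" by (rule z') auto
      moreover have "measure n' (A \<inter> H') = 0" by (rule y') auto
      ultimately show ?thesis using A H'(1) mu'[of "A \<inter> H'"] by simp
    qed
    also have "\<dots> = measure p' A"
      using A H'(1) p'.finite_measure_Union[of "A \<inter> H'" "A - H'"] by (simp add: Int_Diff_Un Int_Diff_disjoint)
    finally show ?thesis .
  qed
  then have "p = p'"
    by (intro measure_eqI) (auto simp: p.emeasure_eq_measure p'.emeasure_eq_measure)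
  moreover have "n = n'"
    using pp mu mu' by (intro measure_eqI) (auto simp: n.emeasure_eq_measure n'.emeasure_eq_measure)
  ultimately show ?thesis by simp
qed

lemma jordan_pair_pos_neg: "jordan_pair \<mu> (pos_measure \<mu>) (neg_measure \<mu>)"
proof -
  obtain p n where pn: "jordan_pair \<mu> p n" using ex_jordan_pair by blast
  have "jordan_decomp \<mu> = (p, n)"
    unfolding jordan_decomp_def jordan_pair_def[symmetric]
  proof (rule the_equality)
    fix x assume "case x of (p, n) \<Rightarrow> jordan_pair \<mu> p n"
    then show "x = (p, n)" using jordan_pair_unique[OF pn] by (cases x) auto
  qed (use pn in simp)
  then show ?thesis using pn by (simp add: pos_measure_def neg_measure_def)
qed

lemma finite_pos_measure: "finite_measure (pos_measure \<mu>)"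
  and finite_neg_measure: "finite_measure (neg_measure \<mu>)"
  and sets_pos_measure [simp, measurable_cong]: "sets (pos_measure \<mu>) = sets borel"
  and sets_neg_measure [simp, measurable_cong]: "sets (neg_measure \<mu>) = sets borel"
  and sm_val_pos_neg: "A \<in> sets borel \<Longrightarrow> sm_val \<mu> A = measure (pos_measure \<mu>) A - measure (neg_measure \<mu>) A"
  using jordan_pair_pos_neg[of \<mu>] by (auto simp: jordan_pair_def)

text \<open>Expressing both parts through \<mu> itself lets bounds and null sets known for \<mu>
  pass to its positive and negative part.\<close>

lemma ex_hahn_set:
  "\<exists>H\<in>sets borel. \<forall>A\<in>sets borel. measure (pos_measure \<mu>) A = sm_val \<mu> (A \<inter> H) \<and>
     measure (neg_measure \<mu>) A = - sm_val \<mu> (A - H)"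
proof -
  obtain H where H: "H \<in> sets borel" "emeasure (pos_measure \<mu>) (- H) = 0" "emeasure (neg_measure \<mu>) H = 0"
    using jordan_pair_pos_neg[of \<mu>] by (auto simp: jordan_pair_def)
  interpret p: finite_measure "pos_measure \<mu>" by (rule finite_pos_measure)
  interpret n: finite_measure "neg_measure \<mu>" by (rule finite_neg_measure)
  show ?thesis
  proof (intro bexI[of _ H] ballI conjI)
    fix A :: "'a set" assume A: "A \<in> sets borel"
    have 1: "measure (pos_measure \<mu>) (A - H) = 0"
      using H by (intro measure_eq_0_mono[of _ "- H"]) (auto simp: borel_comp)
    have 2: "measure (neg_measure \<mu>) (A \<inter> H) = 0"
      using H by (intro measure_eq_0_mono[of _ H]) auto
    have "measure (pos_measure \<mu>) A = measure (pos_measure \<mu>) (A \<inter> H) + measure (pos_measure \<mu>) (A - H)"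
      using A H(1) p.finite_measure_Union[of "A \<inter> H" "A - H"] by (simp add: Int_Diff_Un Int_Diff_disjoint)
    with 1 2 show "measure (pos_measure \<mu>) A = sm_val \<mu> (A \<inter> H)"
      using A H(1) by (simp add: sm_val_pos_neg)
    have "measure (neg_measure \<mu>) A = measure (neg_measure \<mu>) (A \<inter> H) + measure (neg_measure \<mu>) (A - H)"
      using A H(1) n.finite_measure_Union[of "A \<inter> H" "A - H"] by (simp add: Int_Diff_Un Int_Diff_disjoint)
    with 1 2 show "measure (neg_measure \<mu>) A = - sm_val \<mu> (A - H)"
      using A H(1) by (simp add: sm_val_pos_neg)
  qed fact
qed


text \<open>This is equality of the differences p - n' and p' - n, phrased with sums because
  \<open>ennreal\<close> has no usable subtraction.\<close>

lemma nn_integral_sum_eq: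
  fixes p n p' n' :: "'a measure"
  assumes s: "sets n = sets p" "sets p' = sets p" "sets n' = sets p"
    and e: "\<And>A. A \<in> sets p \<Longrightarrow> emeasure p A + emeasure n A = emeasure p' A + emeasure n' A"
    and u: "u \<in> borel_measurable p"
  shows "integral\<^sup>N p u + integral\<^sup>N n u = integral\<^sup>N p' u + integral\<^sup>N n' u"
  using u
proof (induction u rule: borel_measurable_induct)
  case (cong f g)
  have "space n = space p" "space p' = space p" "space n' = space p"
    using s by (auto dest: sets_eq_imp_space_eq)
  with cong have "integral\<^sup>N p f = integral\<^sup>N p g" "integral\<^sup>N n f = integral\<^sup>N n g"
    "integral\<^sup>N p' f = integral\<^sup>N p' g" "integral\<^sup>N n' f = integral\<^sup>N n' g"
    by (auto intro!: nn_integral_cong)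
  then show ?case using cong by simp
next
  case (set A)
  then show ?case using e[of A] s by simp
next
  case (mult u c)
  have [measurable_cong]: "sets n = sets p" "sets p' = sets p" "sets n' = sets p" by fact+
  note [measurable] = mult(2)
  show ?case using mult.IH
    by (simp add: nn_integral_cmult flip: distrib_left)
next
  case (add u v)
  have [measurable_cong]: "sets n = sets p" "sets p' = sets p" "sets n' = sets p" by fact+
  note [measurable] = add(1,3)
  show ?case using add.IH
    by (simp add: nn_integral_add) (metis (no_types, lifting) add.assoc add.left_commute)
next
  case (seq U)
  have [measurable_cong]: "sets n = sets p" "sets p' = sets p" "sets n' = sets p" by fact+
  note [measurable] = seq(1)
  have inc: "incseq (\<lambda>i. integral\<^sup>N M (U i))" for M
    using \<open>incseq U\<close> by (auto simp: incseq_def le_fun_def intro!: nn_integral_mono)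
  have "integral\<^sup>N M (\<lambda>x. SUP i. U i x) = (SUP i. integral\<^sup>N M (U i))" if "sets M = sets p" for M
    using \<open>incseq U\<close> that seq(1) measurable_cong_sets[OF that refl]
    by (intro nn_integral_monotone_convergence_SUP) auto
  then show ?case
    using seq.IH s by (simp add: image_comp ennreal_SUP_add[OF inc inc, symmetric])
qed

text \<open>The pair p, n need not be mutually singular. The Jordan parts are minimal, hence
  dominated by p and n, so integrability passes to them; the identity
  \<open>pos_measure \<mu>\<close> + n = p + \<open>neg_measure \<mu>\<close> then carries over to
  integrals.\<close>

lemma signed_integral_eq_diff:
  assumes fin: "finite_measure p" "finite_measure n"
    and s: "sets p = sets borel" "sets n = sets borel"
    and \<mu>: "\<And>A. A \<in> sets borel \<Longrightarrow> sm_val \<mu> A = measure p A - measure n A"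
    and u: "integrable p u" "integrable n u"
  shows "signed_integral \<mu> u = integral\<^sup>L p u - integral\<^sup>L n u"
proof -
  interpret p: finite_measure p by fact
  interpret n: finite_measure n by fact
  let ?p = "pos_measure \<mu>" and ?n = "neg_measure \<mu>"
  interpret P: finite_measure ?p by (rule finite_pos_measure)
  interpret N: finite_measure ?n by (rule finite_neg_measure)
  obtain H where H: "H \<in> sets borel" "\<And>A. A \<in> sets borel \<Longrightarrow> measure ?p A = sm_val \<mu> (A \<inter> H)"
    "\<And>A. A \<in> sets borel \<Longrightarrow> measure ?n A = - sm_val \<mu> (A - H)"
    using ex_hahn_set[of \<mu>] by blast
  have le1: "emeasure ?p A \<le> emeasure p A" if "A \<in> sets borel" for A
  proof -
    have "measure ?p A \<le> measure p (A \<inter> H)"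
      using that H(1) measure_nonneg[of n "A \<inter> H"] by (subst H) (auto simp: \<mu>)
    also have "\<dots> \<le> measure p A" using that s by (intro p.finite_measure_mono) auto
    finally show ?thesis by (simp add: p.emeasure_eq_measure P.emeasure_eq_measure)
  qed
  have le2: "emeasure ?n A \<le> emeasure n A" if "A \<in> sets borel" for A
  proof -
    have "measure ?n A \<le> measure n (A - H)"
      using that H(1) measure_nonneg[of p "A - H"] by (subst H) (auto simp: \<mu>)
    also have "\<dots> \<le> measure n A" using that s by (intro n.finite_measure_mono) auto
    finally show ?thesis by (simp add: n.emeasure_eq_measure N.emeasure_eq_measure)
  qed
  have [measurable]: "u \<in> borel_measurable borel"
    using u(1) s(1) by (metis borel_measurable_integrable measurable_cong_sets)
  have le1': "integral\<^sup>N ?p f \<le> integral\<^sup>N p f" for f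
    using le1 s by (intro nn_integral_mono_measure)
      (auto simp: le_measure)
  have le2': "integral\<^sup>N ?n f \<le> integral\<^sup>N n f" for f
    using le2 s by (intro nn_integral_mono_measure)
      (auto simp: le_measure)
  have ui: "integrable ?p u" "integrable ?n u"
    using u le1'[of "\<lambda>x. ennreal (norm (u x))"] le2'[of "\<lambda>x. ennreal (norm (u x))"]
    by (auto simp: integrable_iff_bounded measurable_cong_sets[OF s(1) refl] measurable_cong_sets[OF s(2) refl])
  have eq: "integral\<^sup>N ?p f + integral\<^sup>N n f = integral\<^sup>N p f + integral\<^sup>N ?n f" 
    if "f \<in> borel_measurable borel" for f :: "_ \<Rightarrow> ennreal"
  proof (rule nn_integral_sum_eq)
    fix A assume "A \<in> sets ?p"
    then have A: "A \<in> sets borel" by simp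
    have "measure ?p A + measure n A = measure p A + measure ?n A"
      using sm_val_pos_neg[OF A, of \<mu>] \<mu>[OF A] by simp
    then show "emeasure ?p A + emeasure n A = emeasure p A + emeasure ?n A"
      by (simp add: p.emeasure_eq_measure P.emeasure_eq_measure n.emeasure_eq_measure
        N.emeasure_eq_measure flip: ennreal_plus)
  qed (use s that measurable_cong_sets[OF sets_pos_measure[of \<mu>] refl] in auto)
  have fin: "integral\<^sup>N M (\<lambda>x. ennreal (f x)) = ennreal (integral\<^sup>L M (\<lambda>x. max 0 (f x)))"
    if "integrable M f" for M and f :: "_ \<Rightarrow> real"
    using that by (subst nn_integral_eq_integral[symmetric]) (auto simp: ennreal_max_0)
  have eqr: "integral\<^sup>L ?p (\<lambda>x. max 0 (f x)) + integral\<^sup>L n (\<lambda>x. max 0 (f x)) =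
       integral\<^sup>L p (\<lambda>x. max 0 (f x)) + integral\<^sup>L ?n (\<lambda>x. max 0 (f x))"
    if "integrable ?p f" "integrable ?n f" "integrable p f" "integrable n f" 
      "f \<in> borel_measurable borel" for f :: "'a \<Rightarrow> real"
    using eq[of "\<lambda>x. ennreal (f x)"] that
    by (simp add: fin ennreal_plus[symmetric] del: ennreal_plus)
  have spl: "integral\<^sup>L M u = integral\<^sup>L M (\<lambda>x. max 0 (u x)) - integral\<^sup>L M (\<lambda>x. max 0 (- u x))"
    if "integrable M u" for M
  proof -
    have "integrable M (\<lambda>x. max 0 (u x))" "integrable M (\<lambda>x. max 0 (- u x))"
      using that by (auto intro!: integrable_max)
    then have "integral\<^sup>L M (\<lambda>x. max 0 (u x)) - integral\<^sup>L M (\<lambda>x. max 0 (- u x)) =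
        (LINT x|M. max 0 (u x) - max 0 (- u x))"
      by simp
    also have "\<dots> = integral\<^sup>L M u"
      by (intro Bochner_Integration.integral_cong) auto
    finally show ?thesis by simp
  qed
  show ?thesis
    unfolding signed_integral_def
    using eqr[of u] eqr[of "\<lambda>x. - u x"] u ui spl[OF u(1)] spl[OF u(2)] spl[OF ui(1)] spl[OF ui(2)]
    by simp
qed

text \<open>The weight is split into positive and negative part. Their images under T may overlap
  and so need not be the Jordan parts of the image, which is why the integral must be computable
  from an arbitrary difference of measures.\<close>

lemma signed_integral_push_weighted:
  fixes T :: "'a::topological_space \<Rightarrow> 'b::topological_space" and u :: "'b \<Rightarrow> real"
  assumes M: "sets M = sets borel" and T: "T \<in> borel_measurable borel"
    and w: "integrable M w" and u: "u \<in> borel_measurable borel"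
    and uw: "integrable M (\<lambda>z. u (T z) * w z)"
  shows "signed_integral (push_signed T (weighted_measure M w)) u = (LINT z|M. u (T z) * w z)"
proof -
  note [measurable_cong] = M and [measurable] = T u
  have [measurable]: "w \<in> borel_measurable borel"
    using w M by (metis borel_measurable_integrable measurable_cong_sets)
  define P where "P k = distr (density M (\<lambda>z. ennreal (k z))) borel T" for k :: "'a \<Rightarrow> real"
  have sP [simp]: "sets (P k) = sets borel" for k by (simp add: P_def)
  have eP: "emeasure (P k) A = ennreal (LINT z:(T -` A)|M. k z)" 
    if k: "integrable M k" "\<And>x. 0 \<le> k x" "A \<in> sets borel" for k A
  proof -
    have [measurable]: "k \<in> borel_measurable borel"
      using k M by (metis borel_measurable_integrable measurable_cong_sets)
    have TA [measurable]: "T -` A \<in> sets M" using vimage_borel[OF T that(3)] M by simp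
    have "emeasure (P k) A = (\<integral>\<^sup>+z. ennreal (k z) * indicator (T -` A) z \<partial>M)"
      using that(3) sets_eq_imp_space_eq[OF M] TA unfolding P_def
      by (subst emeasure_distr) (auto simp: emeasure_density)
    also have "\<dots> = (\<integral>\<^sup>+z. ennreal (indicator (T -` A) z * k z) \<partial>M)"
      by (intro nn_integral_cong) (auto simp: indicator_def)
    also have "\<dots> = ennreal (LINT z|M. indicator (T -` A) z * k z)"
      using k integrable_mult_indicator[OF TA k(1)] by (intro nn_integral_eq_integral) auto
    finally show ?thesis by (simp add: set_lebesgue_integral_def)
  qed
  have fP: "finite_measure (P k)" if "integrable M k" "\<And>x. 0 \<le> k x" for k
    using eP[OF that, of UNIV] by (intro finite_measureI) (simp add: P_def)
  have mP: "measure (P k) A = (LINT z:(T -` A)|M. k z)"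
    if "integrable M k" "\<And>x. 0 \<le> k x" "A \<in> sets borel" for k A
    using eP[OF that] that(2) by (simp add: measure_def set_lebesgue_integral_def integral_nonneg_AE)
  have iP: "integrable (P k) u" "integral\<^sup>L (P k) u = (LINT z|M. u (T z) * k z)"
    if "integrable M k" "\<And>x. 0 \<le> k x" "integrable M (\<lambda>z. u (T z) * k z)" for k
  proof -
    have [measurable]: "k \<in> borel_measurable borel"
      using that M by (metis borel_measurable_integrable measurable_cong_sets)
    show "integrable (P k) u" unfolding P_def
      using that by (subst integrable_distr_eq) (auto simp: integrable_density mult.commute)
    show "integral\<^sup>L (P k) u = (LINT z|M. u (T z) * k z)" unfolding P_def
      using that by (subst integral_distr) (auto simp: integral_density mult.commute)
  qed
  define wp wn where "wp z = max 0 (w z)" and "wn z = max 0 (- w z)" for z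
  have wpn: "integrable M wp" "integrable M wn" "\<And>z. 0 \<le> wp z" "\<And>z. 0 \<le> wn z" "\<And>z. w z = wp z - wn z"
    using integrable_max[of M "\<lambda>_. 0" w] integrable_max[of M "\<lambda>_. 0" "\<lambda>z. - w z"] w
    by (auto simp: wp_def[abs_def] wn_def[abs_def])
  have [measurable]: "wp \<in> borel_measurable borel" "wn \<in> borel_measurable borel"
    by (auto simp: wp_def[abs_def] wn_def[abs_def])
  have u2: "integrable M (\<lambda>z. u (T z) * wp z)" "integrable M (\<lambda>z. u (T z) * wn z)"
    by (rule Bochner_Integration.integrable_bound[OF uw],
        auto simp: wp_def wn_def abs_mult intro!: mult_left_mono)+
  have "signed_integral (push_signed T (weighted_measure M w)) u = integral\<^sup>L (P wp) u - integral\<^sup>L (P wn) u"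
  proof (rule signed_integral_eq_diff)
    fix A :: "'b set" assume A: "A \<in> sets borel"
    have TA: "T -` A \<in> sets M" using vimage_borel[OF T A] M by simp
    have "sm_val (push_signed T (weighted_measure M w)) A = (LINT z:(T -` A)|M. wp z - wn z)"
      using A by (simp add: sm_val_push[OF T] sm_val_weighted[OF M w] vimage_borel[OF T] wpn(5))
    also have "\<dots> = measure (P wp) A - measure (P wn) A"
      using wpn A integrable_mult_indicator[OF TA wpn(1)] integrable_mult_indicator[OF TA wpn(2)]
      by (simp add: mP set_integral_diff set_integrable_def)
    finally show "sm_val (push_signed T (weighted_measure M w)) A = measure (P wp) A - measure (P wn) A" .
  qed (use fP iP wpn u2 in auto)
  also have "\<dots> = (LINT z|M. u (T z) * w z)"
    using u2 by (simp add: iP wpn(1-4) wpn(5) right_diff_distrib)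
  finally show ?thesis .
qed

section \<open>Disintegration over the base\<close>

text \<open>With digits 0 and 1 in base 4 every tail is at most 1/3, so no carry occurs and the
  digits can be read off by \<open>floor\<close>. In base 2 the expansion would be
  ambiguous.\<close>

lemma base4_digit:
  fixes a :: "nat \<Rightarrow> bool"
  defines "t \<equiv> (\<Sum>n. of_bool (a n) / 4 ^ Suc n :: real)"
  shows "0 \<le> t" "t < 1" "\<lfloor>4 ^ Suc n * t\<rfloor> mod 4 = of_bool (a n)"
proof -
  have geo: "(\<lambda>k. (1/4::real) * (1/4) ^ k) sums ((1/4) * (1 / (1 - 1/4)))"
    by (intro sums_mult geometric_sums) auto
  have tail: "summable (\<lambda>k. of_bool (b k) / 4 ^ Suc k :: real)"
      "0 \<le> (\<Sum>k. of_bool (b k) / 4 ^ Suc k :: real)" "(\<Sum>k. of_bool (b k) / 4 ^ Suc k :: real) < 1" for b :: "nat \<Rightarrow> bool"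
  proof -
    have le: "of_bool (b k) / 4 ^ Suc k \<le> (1/4::real) * (1/4) ^ k" for k
      by (simp add: power_divide)
    show s: "summable (\<lambda>k. of_bool (b k) / 4 ^ Suc k :: real)"
      by (rule summable_comparison_test'[OF sums_summable[OF geo], of 0]) (use le in auto)
    show "0 \<le> (\<Sum>k. of_bool (b k) / 4 ^ Suc k :: real)"
      by (rule suminf_nonneg[OF s]) simp
    have "(\<Sum>k. of_bool (b k) / 4 ^ Suc k :: real) \<le> (\<Sum>k. (1/4::real) * (1/4) ^ k)"
      by (rule suminf_le[OF le s sums_summable[OF geo]])
    also have "\<dots> = 1/3" using geo by (simp add: sums_iff)
    finally show "(\<Sum>k. of_bool (b k) / 4 ^ Suc k :: real) < 1" by simp
  qed
  show "0 \<le> t" "t < 1" using tail[of a] by (auto simp: t_def)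
  \<comment> \<open>Multiplying by 4^(n+1) gives 4 Z + a_n + R, where Z collects the digits before
    position n and R, in [0,1), the digits after it.\<close>
  define R where "R = (\<Sum>k. of_bool (a (k + Suc n)) / 4 ^ Suc k :: real)"
  define Z where "Z = (\<Sum>k<n. of_bool (a k) * 4 ^ (n - Suc k) :: int)"
  have "t = (\<Sum>k. of_bool (a (k + Suc n)) / 4 ^ Suc (k + Suc n)) + (\<Sum>k<Suc n. of_bool (a k) / 4 ^ Suc k)"
    unfolding t_def by (rule suminf_split_initial_segment[OF tail(1)])
  also have "(\<Sum>k. of_bool (a (k + Suc n)) / 4 ^ Suc (k + Suc n)) = R / 4 ^ Suc n"
    unfolding R_def by (subst suminf_divide[OF tail(1)[of "\<lambda>k. a (k + Suc n)"], symmetric]) (simp add: power_add mult_ac)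
  finally have "4 ^ Suc n * t = R + 4 ^ Suc n * (\<Sum>k<Suc n. of_bool (a k) / 4 ^ Suc k)"
    by (simp add: distrib_left)
  also have "4 ^ Suc n * (\<Sum>k<Suc n. of_bool (a k) / 4 ^ Suc k) = real_of_int (4 * Z + of_bool (a n))"
  proof -
    have "4 ^ Suc n * (of_bool (a k) / 4 ^ Suc k) = (4 * (of_bool (a k) * 4 ^ (n - Suc k)) :: real)" if "k < n" for k
    proof -
      have "(4::real) ^ Suc n = 4 ^ Suc k * (4 * 4 ^ (n - Suc k))"
        using that by (simp flip: power_add power_Suc)
      then show ?thesis by simp
    qed
    then have "(\<Sum>k<n. 4 ^ Suc n * (of_bool (a k) / 4 ^ Suc k)) = (\<Sum>k<n. 4 * (of_bool (a k) * 4 ^ (n - Suc k)) :: real)"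
      by (intro sum.cong) auto
    also have "\<dots> = real_of_int (4 * Z)"
      by (simp add: Z_def sum_distrib_left del: sum_of_bool_mult_eq)
    finally show ?thesis
      by (simp add: distrib_left sum_distrib_left del: sum_of_bool_mult_eq)
  qed
  finally have "4 ^ Suc n * t = R + real_of_int (4 * Z + of_bool (a n))" .
  then have "\<lfloor>4 ^ Suc n * t\<rfloor> = 4 * Z + of_bool (a n)"
    using tail(2,3)[of "\<lambda>k. a (k + Suc n)"] by (intro floor_unique) (auto simp: R_def)
  then show "\<lfloor>4 ^ Suc n * t\<rfloor> mod 4 = of_bool (a n)" by simp
qed

text \<open>A point is coded by the bits "the i-th point of a dense sequence is closer than
  1/(n+1)". The decoder takes for each n the least such i and passes to the limit. It is defined and
  measurable on all reals, so nothing has to be known about the range of the code.\<close>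

lemma ex_real_coding:
  "\<exists>(X :: 'k::polish_space \<Rightarrow> real) (D :: real \<Rightarrow> 'k). X \<in> borel_measurable borel \<and>
     D \<in> borel_measurable borel \<and> (\<forall>y. D (X y) = y) \<and> (\<forall>y. 0 \<le> X y \<and> X y < 1)"
proof -
  obtain S :: "'k set" where S: "countable S" "\<And>U. open U \<Longrightarrow> U \<noteq> {} \<Longrightarrow> \<exists>d\<in>S. d \<in> U"
    using countable_dense_exists[where 'a='k] by metis
  then have "S \<noteq> {}" using S(2)[of UNIV] by auto
  define q where "q = from_nat_into S"
  have q: "\<exists>i. dist (q i) y < e" if "0 < e" for y e
  proof -
    have "ball y e \<noteq> {}" using that by simp
    then obtain d where "d \<in> S" "d \<in> ball y e" using S(2)[OF open_ball] by blast
    then show ?thesis using S(1) \<open>S \<noteq> {}\<close>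
      by (metis dist_commute from_nat_into_surj mem_ball q_def)
  qed
  define a where "a y j = (case prod_decode j of (i, n) \<Rightarrow> dist (q i) y < inverse (real (Suc n)))" for y j
  define X where "X y = (\<Sum>j. of_bool (a y j) / 4 ^ Suc j :: real)" for y
  define i where "i n t = (LEAST i. \<lfloor>4 ^ Suc (prod_encode (i, n)) * t\<rfloor> mod 4 = 1)" for n :: nat and t :: real
  define good where "good t \<longleftrightarrow> Cauchy (\<lambda>n. q (i n t))" for t
  \<comment> \<open>Completeness turns the measurable condition \<open>good\<close> into
    convergence; elsewhere the value \<open>q 0\<close> is arbitrary.\<close>
  define D where "D t = (if good t then lim (\<lambda>n. q (i n t)) else q 0)" for t
  have Xm: "X \<in> borel_measurable borel"
    unfolding X_def a_def of_bool_def case_prod_unfold by measurable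
  have im [measurable]: "i n \<in> measurable borel (count_space UNIV)" for n
    unfolding i_def by measurable
  have qm [measurable]: "(\<lambda>t. q (i n t)) \<in> borel_measurable borel" for n
    by (rule measurable_compose[OF im]) simp
  have gm [measurable]: "Measurable.pred borel good"
    unfolding good_def using sets_Collect_Cauchy[of "\<lambda>n t. q (i n t)" borel] by (simp add: pred_def)
  have Dm: "D \<in> borel_measurable borel"
  proof (rule borel_measurable_LIMSEQ_metric)
    show "(\<lambda>t. if good t then q (i n t) else q 0) \<in> borel_measurable borel" for n
      by measurable
    show "(\<lambda>n. if good t then q (i n t) else q 0) \<longlonglongrightarrow> D t" for t
      by (auto simp: D_def good_def convergent_LIMSEQ_iff[symmetric] Cauchy_convergent_iff[symmetric])
  qed
  have DX: "D (X y) = y" for y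
  proof -
    have dig: "(\<lfloor>4 ^ Suc (prod_encode (k, n)) * X y\<rfloor> mod 4 = 1) \<longleftrightarrow> dist (q k) y < inverse (real (Suc n))" for k n
      unfolding X_def base4_digit(3) by (simp add: a_def)
    have "dist (q (i n (X y))) y < inverse (real (Suc n))" for n
      unfolding i_def dig by (rule LeastI_ex) (use q in auto)
    then have "(\<lambda>n. dist (q (i n (X y))) y) \<longlonglongrightarrow> 0"
      by (intro tendsto_sandwich[OF _ _ tendsto_const LIMSEQ_inverse_real_of_nat])
         (auto intro!: always_eventually less_imp_le)
    then have "(\<lambda>n. q (i n (X y))) \<longlonglongrightarrow> y" by (subst tendsto_dist_iff)
    then show ?thesis
      unfolding D_def good_def by (auto simp: limI LIMSEQ_imp_Cauchy)
  qed
  have "0 \<le> X y \<and> X y < 1" for y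
    unfolding X_def using base4_digit(1,2)[of "a y"] by simp
  then show ?thesis using Xm Dm DX by blast
qed


text \<open>Testing the inequality on the set where g < f gives f - g integral 0 there. Finiteness
  of the integral of f makes the subtraction legitimate.\<close>

lemma AE_le_of_set_nn_integral_le:
  assumes fin: "finite_measure M" and f: "f \<in> borel_measurable M" and g: "g \<in> borel_measurable M"
    and int: "(\<integral>\<^sup>+x. f x \<partial>M) \<noteq> \<infinity>"
    and le: "\<And>B. B \<in> sets M \<Longrightarrow> (\<integral>\<^sup>+x\<in>B. f x \<partial>M) \<le> (\<integral>\<^sup>+x\<in>B. g x \<partial>M)"
  shows "AE x in M. f x \<le> (g x :: ennreal)"
proof -
  note [measurable] = f g
  define B where "B = {x \<in> space M. g x < f x}"
  have B [measurable]: "B \<in> sets M" unfolding B_def by measurable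
  have fB: "(\<integral>\<^sup>+x\<in>B. g x \<partial>M) \<le> (\<integral>\<^sup>+x\<in>B. f x \<partial>M)"
    by (intro nn_integral_mono) (auto simp: B_def indicator_def)
  have fBf: "(\<integral>\<^sup>+x\<in>B. f x \<partial>M) \<noteq> \<infinity>"
  proof -
    have "(\<integral>\<^sup>+x\<in>B. f x \<partial>M) \<le> (\<integral>\<^sup>+x. f x \<partial>M)"
      by (intro nn_integral_mono) (auto simp: indicator_def)
    with int show ?thesis by (auto simp: top_unique)
  qed
  have gBf: "(\<integral>\<^sup>+x\<in>B. g x \<partial>M) \<noteq> \<infinity>"
    using fBf fB by (auto simp: top_unique)
  have "(\<integral>\<^sup>+x. f x * indicator B x - g x * indicator B x \<partial>M) = (\<integral>\<^sup>+x\<in>B. f x \<partial>M) - (\<integral>\<^sup>+x\<in>B. g x \<partial>M)"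
    by (intro nn_integral_diff gBf) (auto simp: B_def indicator_def)
  also have "\<dots> = 0" using le[OF B] fBf by (simp add: diff_eq_0_iff_ennreal less_top)
  finally have "AE x in M. f x * indicator B x - g x * indicator B x = 0"
    by (subst (asm) nn_integral_0_iff_AE) auto
  moreover have "AE x in M. g x * indicator B x \<noteq> \<infinity>"
    using gBf by (intro nn_integral_PInf_AE) auto
  ultimately show ?thesis
    using AE_space
  proof eventually_elim
    case (elim x)
    show ?case
    proof (rule ccontr)
      assume "\<not> f x \<le> g x"
      then have "x \<in> B" using elim by (auto simp: B_def)
      then show False using elim \<open>\<not> f x \<le> g x\<close>
        by (auto simp: diff_eq_0_iff_ennreal)
    qed
  qed
qed

lemma emeasure_uniform_less:
  fixes c :: ennreal
  assumes "c \<le> 1"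
  shows "emeasure (uniform_measure lborel {0<..<1::real}) {u. ennreal u < c} = c"
proof -
  obtain r where r: "c = ennreal r" "0 \<le> r" "r \<le> 1"
    using assms by (cases c) (auto simp: ennreal_le_1 top_unique)
  \<comment> \<open>For r = 0 the set is empty even at negative u, because \<open>ennreal\<close>
    sends those to 0; for r > 0 it contains all negative u.\<close>
  have "ennreal u < c \<longleftrightarrow> r \<noteq> 0 \<and> u < r" for u
    using r by (cases "u < 0") (auto simp: ennreal_less_iff ennreal_neg)
  then have *: "{u. ennreal u < c} = (if r = 0 then {} else {..<r})" by auto
  have "{0<..<1} \<inter> {u. ennreal u < c} = {0<..<r}" unfolding * using r(2,3) by auto
  moreover have "{u. ennreal u < c} \<in> sets lborel" unfolding * by simp
  ultimately have "emeasure (uniform_measure lborel {0<..<1::real}) {u. ennreal u < c} =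
      emeasure lborel {0<..<r} / emeasure lborel {0<..<1::real}"
    by (subst emeasure_uniform_measure) (simp_all only:, simp)
  then show ?thesis using r(1,2) divide_ennreal[of r 1] by simp
qed

text \<open>A conditional distribution function controls exactly these slabs. They are stable under
  intersection and generate the product Borel sets.\<close>

lemma emeasure_slab_generator:
  fixes p q :: "('a::second_countable_topology \<times> real) measure"
  assumes fin: "finite_measure p" and s: "sets p = sets borel" "sets q = sets borel"
    and eq: "\<And>B x. B \<in> sets borel \<Longrightarrow> emeasure p (B \<times> {..<x}) = emeasure q (B \<times> {..<x})"
  shows "p = q"
proof (rule measure_eqI_generator_eq_countable)
  let ?E = "{B \<times> {..<x} | B x. B \<in> sets borel} :: ('a \<times> real) set set"
  let ?A = "range (\<lambda>i::nat. UNIV \<times> {..<real i}) :: ('a \<times> real) set set"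
  interpret finite_measure p by fact
  show "Int_stable ?E"
  proof (rule Int_stableI)
    fix a b assume "a \<in> ?E" "b \<in> ?E"
    then obtain B x C y where *: "a = B \<times> {..<x}" "b = C \<times> {..<y}" "B \<in> sets borel" "C \<in> sets borel" by auto
    then have "a \<inter> b = (B \<inter> C) \<times> {..<min x y}" by auto
    then show "a \<inter> b \<in> ?E" using * by blast
  qed
  show "?E \<subseteq> Pow UNIV" by auto
  show "emeasure p X = emeasure q X" if "X \<in> ?E" for X using that eq by auto
  have "sets (borel :: ('a \<times> real) measure) = sigma_sets UNIV ?E"
  proof -
    have "(borel :: ('a \<times> real) measure) = borel \<Otimes>\<^sub>M borel" by (simp add: borel_prod)
    also have "sets \<dots> = sets (sigma (UNIV :: 'a set) (sets borel) \<Otimes>\<^sub>M sigma UNIV (range (lessThan :: real \<Rightarrow> _)))"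
    proof (rule sets_pair_measure_cong)
      show "sets (borel :: 'a measure) = sets (sigma UNIV (sets borel))"
        using sets.sigma_sets_eq[of "borel :: 'a measure"] by simp
      show "sets (borel :: real measure) = sets (sigma UNIV (range lessThan))"
        by (simp add: borel_Iio)
    qed
    also have "\<dots> = sets (sigma (UNIV \<times> UNIV) {a \<times> b | a b. a \<in> sets borel \<and> b \<in> range lessThan})"
    proof (subst sigma_prod)
      have "(UNIV :: real set) = \<Union>(range (\<lambda>i::nat. {..<real i}))" using reals_Archimedean2 by auto
      then show "\<exists>E\<subseteq>range (lessThan :: real \<Rightarrow> _). countable E \<and> UNIV = \<Union>E"
        by (intro exI[of _ "range (\<lambda>i::nat. {..<real i})"]) auto
    qed (auto intro!: exI[of _ "{UNIV}"])
    also have "{a \<times> b | a b. a \<in> sets borel \<and> b \<in> range (lessThan :: real \<Rightarrow> _)} = ?E" by auto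
    finally show ?thesis by simp
  qed
  then show "sets p = sigma_sets UNIV ?E" "sets q = sigma_sets UNIV ?E" using s by auto
  show "?A \<subseteq> ?E" by auto
  show "\<Union>?A = UNIV" using reals_Archimedean2 by auto
  show "countable ?A" by auto
  show "emeasure p X \<noteq> \<infinity>" if "X \<in> ?A" for X by simp
qed


text \<open>The quantile transform of the conditional distribution functions gives the kernel as the image
  of Lebesgue measure under a jointly measurable map. It is first built for a real-valued second
  coordinate and then carried over by a Borel coding.\<close>

lemma ex_quantile_map:
  fixes p :: "('m::polish_space \<times> real) measure"
  assumes fin: "finite_measure p" and s: "sets p = sets borel"
    and unit: "AE z in p. 0 \<le> snd z \<and> snd z < 1"
  defines "U \<equiv> uniform_measure lborel {0<..<1::real}"
  shows "\<exists>T. T \<in> borel_measurable (borel \<Otimes>\<^sub>M borel) \<and>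
    p = distr (distr p borel fst \<Otimes>\<^sub>M U) borel (\<lambda>z. (fst z, T z))"
proof -
  note [measurable_cong] = s
  interpret p: finite_measure p by fact
  have [measurable]: "fst \<in> measurable p borel" "snd \<in> measurable p borel" 
    by (simp_all add: measurable_cong_sets[OF s refl] borel_prod[symmetric])
  interpret U: prob_space U
    unfolding U_def by (rule prob_space_uniform_measure) auto
  have sU [measurable_cong, simp]: "sets U = sets borel" by (simp add: U_def)
  define p1 where "p1 = distr p borel fst"
  have s1 [measurable_cong, simp]: "sets p1 = sets borel" by (simp add: p1_def)
  interpret p1: finite_measure p1
    unfolding p1_def by (rule p.finite_measure_distr) simp
  interpret pU: pair_sigma_finite p1 U ..
  have e1: "emeasure p1 B = emeasure p (B \<times> UNIV)" if "B \<in> sets borel" for B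
    unfolding p1_def using that sets_eq_imp_space_eq[OF s]
    by (subst emeasure_distr) (auto intro!: arg_cong[of _ _ "emeasure p"])
  \<comment> \<open>Cutting p at height q and projecting: the density of this measure with respect
    to the first marginal will be the conditional probability that the second coordinate is below
    q.\<close>
  define pq where "pq q = distr (density p (indicator {z. snd z < q})) borel fst" for q :: real
  have spq [measurable_cong, simp]: "sets (pq q) = sets borel" for q by (simp add: pq_def)
  have slab [measurable]: "B \<times> {..<q} \<in> sets p" if "B \<in> sets borel" for B and q :: real
    using that by (simp add: s borel_prod[symmetric])
  have epq: "emeasure (pq q) B = emeasure p (B \<times> {..<q})" if [measurable]: "B \<in> sets borel" for q B
  proof -
    have "emeasure (pq q) B = (\<integral>\<^sup>+z. indicator {z. snd z < q} z * indicator (fst -` B \<inter> space p) z \<partial>p)"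
      unfolding pq_def using that by (simp add: emeasure_distr emeasure_density)
    also have "\<dots> = (\<integral>\<^sup>+z. indicator (B \<times> {..<q}) z \<partial>p)"
      by (intro nn_integral_cong) (auto simp: indicator_def)
    finally show ?thesis by simp
  qed
  have ac: "absolutely_continuous p1 (pq q)" for q
    unfolding absolutely_continuous_def
  proof (auto simp: null_sets_def)
    fix B assume B: "B \<in> sets borel" "emeasure p1 B = 0"
    have "emeasure p (B \<times> {..<q}) \<le> emeasure p (B \<times> UNIV)"
      using B by (intro emeasure_mono) (auto simp: s borel_prod[symmetric])
    then show "emeasure (pq q) B = 0" using B by (simp add: epq e1)
  qed
  define g where "g q = RN_deriv p1 (pq q)" for q
  have gm [measurable]: "g q \<in> borel_measurable borel" for q
    unfolding g_def using borel_measurable_RN_deriv[of p1 "pq q"] by simp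
  have gd: "density p1 (g q) = pq q" for q
    unfolding g_def by (rule p1.density_RN_deriv[OF ac]) simp
  have gi: "(\<integral>\<^sup>+x\<in>B. g q x \<partial>p1) = emeasure p (B \<times> {..<q})" if "B \<in> sets borel" for q B
    using that arg_cong[OF gd, of "\<lambda>M. emeasure M B" q] by (simp add: emeasure_density epq)
  have gmono: "AE x in p1. g q x \<le> g q' x" if "q \<le> q'" for q q'
  proof (rule AE_le_of_set_nn_integral_le)
    show "(\<integral>\<^sup>+x. g q x \<partial>p1) \<noteq> \<infinity>" using gi[of UNIV q] by simp
    show "(\<integral>\<^sup>+x\<in>B. g q x \<partial>p1) \<le> (\<integral>\<^sup>+x\<in>B. g q' x \<partial>p1)" if "B \<in> sets p1" for B
      using that \<open>q \<le> q'\<close> by (auto simp: gi intro!: emeasure_mono)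
  qed (auto intro: p1.finite_measure_axioms)
  have g1: "AE x in p1. g q x \<le> 1" for q
  proof (rule AE_le_of_set_nn_integral_le)
    show "(\<integral>\<^sup>+x. g q x \<partial>p1) \<noteq> \<infinity>" using gi[of UNIV q] by simp
    show "(\<integral>\<^sup>+x\<in>B. g q x \<partial>p1) \<le> (\<integral>\<^sup>+x\<in>B. 1 \<partial>p1)" if "B \<in> sets p1" for B
      using that by (auto simp: gi e1 s borel_prod[symmetric] intro!: emeasure_mono)
  qed (auto intro: p1.finite_measure_axioms)
  \<comment> \<open>Restricting to rational levels leaves countably many exceptional null sets, so
    monotonicity and the bound 1 hold simultaneously.\<close>
  have gAE: "AE x in p1. \<forall>q\<in>\<rat>. g q x \<le> 1 \<and> (\<forall>q'\<in>\<rat>. q \<le> q' \<longrightarrow> g q x \<le> g q' x)"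
    by (simp add: AE_ball_countable countable_rat AE_conj_iff g1) (use gmono in \<open>auto intro!: AE_impI\<close>)
  \<comment> \<open>T is the generalised inverse of the conditional distribution function at level
    \<open>snd z\<close>. The conditions 1 <= q and 0 < q keep it in [0,1] even on the null set
    where \<open>g\<close> is not monotone.\<close>
  define W where "W z q \<longleftrightarrow> 1 \<le> q \<or> (0 < q \<and> ennreal (snd z) < g q (fst z))" for z q
  define T where "T z = Inf {q\<in>\<rat>. W z q}" for z
  have Tless: "T z < x \<longleftrightarrow> (\<exists>q\<in>\<rat>. W z q \<and> q < x)" for z x
  proof -
    have "{q\<in>\<rat>. W z q} \<noteq> {}" by (auto simp: W_def intro!: exI[of _ 1])
    moreover have "bdd_below {q\<in>\<rat>. W z q}" by (intro bdd_belowI[of _ 0]) (auto simp: W_def)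
    ultimately show ?thesis unfolding T_def by (subst cInf_less_iff) auto
  qed
  have Tm [measurable]: "T \<in> borel_measurable (borel \<Otimes>\<^sub>M borel)"
  proof (rule borel_measurable_iff_less[THEN iffD2], rule allI)
    fix x
    have "{z \<in> space (borel \<Otimes>\<^sub>M borel). \<exists>q\<in>\<rat>. W z q \<and> q < x} \<in> sets (borel \<Otimes>\<^sub>M borel)"
      unfolding W_def using countable_rat by measurable
    then show "{z \<in> space (borel \<Otimes>\<^sub>M borel). T z < x} \<in> sets (borel \<Otimes>\<^sub>M borel)"
      by (simp add: Tless)
  qed
  define p' where "p' = distr (p1 \<Otimes>\<^sub>M U) borel (\<lambda>z. (fst z, T z))"
  have m': "(\<lambda>z. (fst z, T z)) \<in> measurable (p1 \<Otimes>\<^sub>M U) borel"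
    unfolding borel_prod[symmetric] by measurable
  have Usec: "{u. ennreal u < g q y} \<in> sets borel" for q y by measurable
  have ep': "emeasure p' (B \<times> {..<x}) = (\<integral>\<^sup>+y\<in>B. emeasure U {u. T (y, u) < x} \<partial>p1)"
    if [measurable]: "B \<in> sets borel" for B x
  proof -
    have "emeasure p' (B \<times> {..<x}) = emeasure (p1 \<Otimes>\<^sub>M U) ((\<lambda>z. (fst z, T z)) -` (B \<times> {..<x}) \<inter> space (p1 \<Otimes>\<^sub>M U))"
      unfolding p'_def using that by (intro emeasure_distr m') (auto simp: borel_prod[symmetric])
    also have "\<dots> = (\<integral>\<^sup>+y. emeasure U (Pair y -` ((\<lambda>z. (fst z, T z)) -` (B \<times> {..<x}) \<inter> space (p1 \<Otimes>\<^sub>M U))) \<partial>p1)"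
      using that by (intro U.emeasure_pair_measure_alt measurable_sets[OF m'])
        (auto simp: borel_prod[symmetric])
    also have "\<dots> = (\<integral>\<^sup>+y\<in>B. emeasure U {u. T (y, u) < x} \<partial>p1)"
    proof (rule nn_integral_cong)
      fix y
      have "Pair y -` ((\<lambda>z. (fst z, T z)) -` (B \<times> {..<x}) \<inter> space (p1 \<Otimes>\<^sub>M U)) = (if y \<in> B then {u. T (y, u) < x} else {})"
        by (auto simp: space_pair_measure sets_eq_imp_space_eq[OF s1] sets_eq_imp_space_eq[OF sU])
      then show "emeasure U (Pair y -` ((\<lambda>z. (fst z, T z)) -` (B \<times> {..<x}) \<inter> space (p1 \<Otimes>\<^sub>M U))) =
          emeasure U {u. T (y, u) < x} * indicator B y"
        by simp
    qed
    finally show ?thesis .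
  qed
  have "p = p'"
  proof (rule emeasure_slab_generator[OF fin s])
    show "sets p' = sets borel" by (simp add: p'_def)
    fix B :: "'m set" and x :: real assume B [measurable]: "B \<in> sets borel"
    \<comment> \<open>Outside (0,1] both sides are settled by the range of the second coordinate and
      of T; in the third case q < x <= 1 excludes the first alternative of \<open>W\<close>.\<close>
    consider "x \<le> 0" | "1 < x" | "0 < x" "x \<le> 1" by linarith
    then show "emeasure p (B \<times> {..<x}) = emeasure p' (B \<times> {..<x})"
    proof cases
      case 1
      then have "\<not> T z < x" for z by (auto simp: Tless W_def)
      then have "emeasure p' (B \<times> {..<x}) = 0" by (simp add: ep')
      moreover have "emeasure p (B \<times> {..<x}) = 0"
      proof -
        have "AE z in p. z \<notin> B \<times> {..<x}" using unit by eventually_elim (use 1 in auto)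
        then show ?thesis using AE_iff_null_sets[OF slab[OF B]] by (auto simp: null_sets_def)
      qed
      ultimately show ?thesis by simp
    next
      case 2
      have "T z < x" for z
        unfolding Tless using 2 by (intro bexI[of _ 1]) (auto simp: W_def)
      then have "emeasure p' (B \<times> {..<x}) = emeasure p1 B"
        using U.emeasure_space_1 sets_eq_imp_space_eq[OF sU] by (simp add: ep')
      also have "\<dots> = emeasure p (B \<times> {..<x})"
        unfolding e1[OF B] using unit 2
        by (intro emeasure_eq_AE) (auto simp: s borel_prod[symmetric])
      finally show ?thesis by simp
    next
      case 3
      \<comment> \<open>Interlacing with the points x - x/(n+1) makes the chosen rationals increase
        to x from below; for n = 0 the left endpoint is 0, so all of them are positive.\<close>
      have "\<exists>q\<in>\<rat>. x - x / (n + 1) < q \<and> q < x - x / (n + 2)" for n :: nat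
        using 3 by (intro Rats_dense_in_real) (simp add: field_simps)
      then obtain r :: "nat \<Rightarrow> real" where r: "\<And>n. r n \<in> \<rat>"
        "\<And>n. x - x / real (n + 1) < r n" "\<And>n. r n < x - x / real (n + 2)"
        by metis
      have inc: "incseq r"
      proof (rule incseq_SucI)
        fix n show "r n \<le> r (Suc n)" using r(3)[of n] r(2)[of "Suc n"] by (simp add: algebra_simps)
      qed
      have rx: "r n < x" "0 < r n" for n
      proof -
        have "0 < x / real (n + 2)" "x / real (n + 1) \<le> x" using 3 by (simp_all add: field_simps)
        with r(2,3)[of n] show "r n < x" "0 < r n" by linarith+
      qed
      have rlim: "\<exists>n. q < r n" if "q < x" for q
      proof -
        obtain n where "x / (x - q) < real n" using reals_Archimedean2 by blast
        then have "x < (x - q) * real (n + 1)" using that 3 by (simp add: field_simps)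
        then have "x / real (n + 1) < x - q" using that by (simp add: field_simps)
        then show ?thesis using r(2)[of n] by (intro exI[of _ n]) linarith
      qed
      have "emeasure p' (B \<times> {..<x}) = (\<integral>\<^sup>+y. (SUP n. g (r n) y * indicator B y) \<partial>p1)"
        unfolding ep'[OF B]
      proof (rule nn_integral_cong_AE)
        show "AE y in p1. emeasure U {u. T (y, u) < x} * indicator B y = (SUP n. g (r n) y * indicator B y)"
          using gAE
        proof eventually_elim
          case (elim y)
          \<comment> \<open>This is left continuity: the strict inequality T < x is witnessed by a
            rational level below x, which monotonicity replaces by some \<open>r n\<close>.\<close>
          have "{u. T (y, u) < x} = (\<Union>n. {u. ennreal u < g (r n) y})"
          proof (intro set_eqI iffI)
            fix u assume "u \<in> {u. T (y, u) < x}"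
            then obtain q where q: "q \<in> \<rat>" "q < x" "W (y, u) q" by (auto simp: Tless)
            then have "ennreal u < g q y" using 3 by (auto simp: W_def)
            moreover obtain n where "q < r n" using rlim q by auto
            moreover have "g q y \<le> g (r n) y" using elim q r(1)[of n] \<open>q < r n\<close> by auto
            ultimately have "ennreal u < g (r n) y" by order
            then show "u \<in> (\<Union>n. {u. ennreal u < g (r n) y})" by blast
          next
            fix u assume "u \<in> (\<Union>n. {u. ennreal u < g (r n) y})"
            then obtain n where "ennreal u < g (r n) y" by auto
            then show "u \<in> {u. T (y, u) < x}"
              using r(1)[of n] rx[of n] by (auto simp: Tless W_def intro!: bexI[of _ "r n"])
          qed
          then have "emeasure U {u. T (y, u) < x} = emeasure U (\<Union>n. {u. ennreal u < g (r n) y})"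
            by simp
          also have "\<dots> = (SUP n. emeasure U {u. ennreal u < g (r n) y})"
          proof (rule SUP_emeasure_incseq[symmetric])
            show "range (\<lambda>n. {u. ennreal u < g (r n) y}) \<subseteq> sets U" using Usec by auto
            show "incseq (\<lambda>n. {u. ennreal u < g (r n) y})"
            proof (rule incseq_SucI)
              fix n
              have "g (r n) y \<le> g (r (Suc n)) y"
                using elim r(1)[of n] r(1)[of "Suc n"] incseq_SucD[OF inc, of n] by blast
              then show "{u. ennreal u < g (r n) y} \<subseteq> {u. ennreal u < g (r (Suc n)) y}"
                by (auto intro: less_le_trans)
            qed
          qed
          also have "\<dots> = (SUP n. g (r n) y)"
            unfolding U_def using elim r(1) by (intro SUP_cong refl emeasure_uniform_less) auto
          finally show ?case by (auto simp: indicator_def)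
        qed
      qed
      also have "\<dots> = (SUP n. \<integral>\<^sup>+y\<in>B. g (r n) y \<partial>p1)"
      proof (rule nn_integral_monotone_convergence_SUP_AE)
        show "AE y in p1. g (r n) y * indicator B y \<le> g (r (Suc n)) y * indicator B y" for n
          using gmono[OF incseq_SucD[OF inc], of n] by eventually_elim (auto simp: indicator_def)
      qed auto
      also have "\<dots> = (SUP n. emeasure p (B \<times> {..<r n}))" by (simp add: gi)
      also have "\<dots> = emeasure p (\<Union>n. B \<times> {..<r n})"
        using inc by (intro SUP_emeasure_incseq) (auto simp: incseq_def less_le_trans)
      also have "(\<Union>n. B \<times> {..<r n}) = B \<times> {..<x}"
        using rlim rx by (auto intro: less_trans)
      finally show ?thesis by simp
    qed
  qed
  with Tm show ?thesis unfolding p'_def p1_def by blast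
qed

text \<open>The second coordinate is coded as a real, represented by the quantile map and decoded
  again. The conditional measure over \<gamma> is the law of a random point with first coordinate
  \<gamma>, hence it lives on that fibre for every \<gamma>, not just almost every one.\<close>

lemma ex_disintegration:
  fixes p :: "('m::polish_space \<times> 'k::polish_space) measure"
  assumes fin: "finite_measure p" and s: "sets p = sets borel"
    and m: "sigma_finite_measure m" "sets m = sets borel"
    and ac: "absolutely_continuous m (distr p borel fst)"
  shows "\<exists>\<kappa> d. disintegration m p \<kappa> d"
proof -
  note [measurable_cong] = s m(2)
  interpret p: finite_measure p by fact
  interpret m: sigma_finite_measure m by fact
  obtain X :: "'k \<Rightarrow> real" and D where X [measurable]: "X \<in> borel_measurable borel" and
    D [measurable]: "D \<in> borel_measurable borel" and DX: "\<And>y. D (X y) = y" "\<And>y. 0 \<le> X y \<and> X y < 1"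
    using ex_real_coding by blast
  define U where "U = uniform_measure lborel {0<..<1::real}"
  interpret U: prob_space U
    unfolding U_def by (rule prob_space_uniform_measure) auto
  have sU [measurable_cong, simp]: "sets U = sets borel" by (simp add: U_def)
  have mX: "(\<lambda>z. (fst z, X (snd z))) \<in> measurable p borel"
    unfolding borel_prod[symmetric] measurable_cong_sets[OF s refl] by measurable
  have mf: "fst \<in> measurable p borel"
    unfolding borel_prod[symmetric] measurable_cong_sets[OF s refl] by measurable
  define p' where "p' = distr p borel (\<lambda>z. (fst z, X (snd z)))"
  have "\<exists>T. T \<in> borel_measurable (borel \<Otimes>\<^sub>M borel) \<and>
    p' = distr (distr p' borel fst \<Otimes>\<^sub>M U) borel (\<lambda>z. (fst z, T z))"
    unfolding U_def
  proof (rule ex_quantile_map)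
    show "finite_measure p'" unfolding p'_def by (rule p.finite_measure_distr[OF mX])
    show "sets p' = sets borel" by (simp add: p'_def)
    show "AE z in p'. 0 \<le> snd z \<and> snd z < 1"
      unfolding p'_def using DX(2) by (subst AE_distr_iff[OF mX]) (auto simp: borel_prod[symmetric])
  qed
  then obtain T where T [measurable]: "T \<in> borel_measurable (borel \<Otimes>\<^sub>M borel)" 
    and pT: "p' = distr (distr p' borel fst \<Otimes>\<^sub>M U) borel (\<lambda>z. (fst z, T z))" by blast
  define p1 where "p1 = distr p borel fst"
  have s1 [measurable_cong, simp]: "sets p1 = sets borel" by (simp add: p1_def)
  interpret p1: finite_measure p1
    unfolding p1_def by (rule p.finite_measure_distr[OF mf])
  have p1': "distr p' borel fst = p1"
    unfolding p'_def p1_def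
    by (subst distr_distr[OF _ mX]) (auto simp: o_def borel_prod[symmetric])
  have mD: "(\<lambda>z. (fst z, D (snd z))) \<in> measurable borel (borel :: ('m \<times> 'k) measure)"
    unfolding borel_prod[symmetric] by measurable
  have mT: "(\<lambda>z. (fst z, T z)) \<in> measurable (p1 \<Otimes>\<^sub>M U) borel"
    unfolding borel_prod[symmetric] by measurable
  have mDT: "(\<lambda>z. (fst z, D (T z))) \<in> measurable (p1 \<Otimes>\<^sub>M U) borel"
    unfolding borel_prod[symmetric] by measurable
  have "p = distr p borel (\<lambda>z. z)" using s by (simp add: distr_id2)
  also have "\<dots> = distr p' borel (\<lambda>z. (fst z, D (snd z)))"
    unfolding p'_def by (subst distr_distr[OF mD mX]) (simp add: o_def DX(1))
  also have "\<dots> = distr (p1 \<Otimes>\<^sub>M U) borel (\<lambda>z. (fst z, D (T z)))"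
    by (subst pT, subst p1', subst distr_distr[OF mD mT]) (simp add: o_def)
  finally have pDT: "p = distr (p1 \<Otimes>\<^sub>M U) borel (\<lambda>z. (fst z, D (T z)))" .
  define \<kappa> where "\<kappa> \<gamma> = distr U borel (\<lambda>u. (\<gamma>, D (T (\<gamma>, u))))" for \<gamma> :: 'm
  have mk: "(\<lambda>u. (\<gamma>, D (T (\<gamma>, u)))) \<in> measurable U borel" for \<gamma>
    unfolding borel_prod[symmetric] by measurable
  have sk: "\<kappa> \<in> measurable borel (prob_algebra borel)"
  proof (rule measurable_prob_algebraI)
    show "prob_space (\<kappa> \<gamma>)" for \<gamma> unfolding \<kappa>_def by (rule U.prob_space_distr[OF mk])
    have [measurable]: "(\<lambda>x. U) \<in> measurable borel (subprob_algebra borel)"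
      by (intro measurable_const) (simp add: space_subprob_algebra U.subprob_space_axioms)
    show "\<kappa> \<in> measurable borel (subprob_algebra borel)"
      unfolding \<kappa>_def[abs_def]
    proof (rule measurable_distr2)
      show "(\<lambda>(\<gamma>, u). (\<gamma>, D (T (\<gamma>, u)))) \<in> measurable (borel \<Otimes>\<^sub>M borel) borel"
        unfolding borel_prod[symmetric] by measurable
    qed measurable
  qed
  have ek: "emeasure p E = (\<integral>\<^sup>+\<gamma>. emeasure (\<kappa> \<gamma>) E \<partial>p1)" if E: "E \<in> sets borel" for E
  proof -
    have "emeasure p E = emeasure (p1 \<Otimes>\<^sub>M U) ((\<lambda>z. (fst z, D (T z))) -` E \<inter> space (p1 \<Otimes>\<^sub>M U))"
      by (subst pDT) (rule emeasure_distr[OF mDT E])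
    also have "\<dots> = (\<integral>\<^sup>+\<gamma>. emeasure U (Pair \<gamma> -` ((\<lambda>z. (fst z, D (T z))) -` E \<inter> space (p1 \<Otimes>\<^sub>M U))) \<partial>p1)"
      by (rule U.emeasure_pair_measure_alt[OF measurable_sets[OF mDT E]])
    also have "\<dots> = (\<integral>\<^sup>+\<gamma>. emeasure (\<kappa> \<gamma>) E \<partial>p1)"
      unfolding \<kappa>_def
      by (intro nn_integral_cong, subst emeasure_distr[OF mk E])
         (auto simp: space_pair_measure sets_eq_imp_space_eq[OF s1] sets_eq_imp_space_eq[OF sU]
           intro!: arg_cong[of _ _ "emeasure U"])
    finally show ?thesis .
  qed
  \<comment> \<open>Passing to a real density changes the Radon-Nikodym derivative only where it is
    infinite, a null set because p is finite.\<close>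
  define d where "d \<gamma> = enn2real (RN_deriv m p1 \<gamma>)" for \<gamma>
  have RNm [measurable]: "RN_deriv m p1 \<in> borel_measurable borel"
    using borel_measurable_RN_deriv[of m p1] by (simp add: measurable_cong_sets[OF m(2) refl])
  have dm [measurable]: "d \<in> borel_measurable borel" unfolding d_def by measurable
  have dens: "density m (RN_deriv m p1) = p1"
    using ac m(2) by (intro m.density_RN_deriv) (auto simp: p1_def)
  have "(\<integral>\<^sup>+\<gamma>. RN_deriv m p1 \<gamma> \<partial>m) = emeasure p1 UNIV"
    by (subst dens[symmetric]) (simp add: emeasure_density sets_eq_imp_space_eq[OF m(2)])
  then have "AE \<gamma> in m. RN_deriv m p1 \<gamma> \<noteq> \<infinity>"
    by (intro nn_integral_PInf_AE) auto
  then have dR: "AE \<gamma> in m. ennreal (d \<gamma>) = RN_deriv m p1 \<gamma>"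
    by eventually_elim (simp add: d_def ennreal_enn2real_if)
  have dd: "p1 = density m (\<lambda>\<gamma>. ennreal (d \<gamma>))"
    using dR by (subst dens[symmetric]) (intro density_cong, auto)
  have "disintegration m p \<kappa> d"
    unfolding disintegration_def
  proof (intro conjI ballI allI)
    fix \<gamma> :: 'm
    have "{\<gamma>} \<times> UNIV \<in> sets (borel :: ('m \<times> 'k) measure)" by (simp add: borel_prod[symmetric])
    then have "emeasure (\<kappa> \<gamma>) ({\<gamma>} \<times> UNIV) = emeasure U (space U)"
      unfolding \<kappa>_def by (subst emeasure_distr[OF mk]) (auto intro!: arg_cong[of _ _ "emeasure U"])
    then show "emeasure (\<kappa> \<gamma>) ({\<gamma>} \<times> UNIV) = 1" by (simp add: U.emeasure_space_1)
    show "0 \<le> d \<gamma>" by (simp add: d_def)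
  next
    fix E :: "('m \<times> 'k) set" assume E: "E \<in> sets borel"
    have "(\<lambda>\<gamma>. emeasure (\<kappa> \<gamma>) E) \<in> borel_measurable borel"
      by (rule measurable_compose[OF measurable_prob_algebraD[OF sk] measurable_emeasure_subprob_algebra[OF E]])
    then show "emeasure p E = (\<integral>\<^sup>+\<gamma>. ennreal (d \<gamma>) * emeasure (\<kappa> \<gamma>) E \<partial>m)"
      unfolding ek[OF E] by (subst dd) (simp add: nn_integral_density)
  qed (use sk dd in \<open>auto simp: p1_def\<close>)
  then show ?thesis by blast
qed

section \<open>Versions of the restriction to fibres\<close>

text \<open>A version of \<open>\<gamma> \<mapsto> \<mu>|\<^sub>\<gamma>\<close> can be recognised without the Jordan decomposition of \<open>\<mu>\<close>.
  The bound by an integrable function makes this closed under the transfer operator.\<close>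

definition fibre_version ::
    "'m::topological_space measure \<Rightarrow> ('m \<times> 'k::topological_space) signed_measure \<Rightarrow>
     ('m \<Rightarrow> 'k signed_measure) \<Rightarrow> bool" where
  "fibre_version m \<mu> r \<longleftrightarrow>
     (\<exists>D. integrable m D \<and> (\<forall>\<gamma> A. \<bar>sm_val (r \<gamma>) A\<bar> \<le> D \<gamma>)) \<and>
     (\<forall>E\<in>sets borel. (\<lambda>\<gamma>. sm_val (r \<gamma>) (Pair \<gamma> -` E)) \<in> borel_measurable borel \<and>
        (LINT \<gamma>|m. sm_val (r \<gamma>) (Pair \<gamma> -` E)) = sm_val \<mu> E)"

lemma Times_borel [measurable]:
  fixes A :: "'a::second_countable_topology set" and B :: "'b::second_countable_topology set"
  shows "A \<in> sets borel \<Longrightarrow> B \<in> sets borel \<Longrightarrow> A \<times> B \<in> sets borel"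
  by (simp add: borel_prod[symmetric])

lemma Pair_vimage_borel:
  fixes E :: "('a::second_countable_topology \<times> 'b::second_countable_topology) set"
  assumes "E \<in> sets borel" shows "Pair x -` E \<in> sets borel"
proof -
  have "Pair x \<in> measurable borel (borel :: ('a \<times> 'b) measure)"
    unfolding borel_prod[symmetric] by measurable
  then show ?thesis using assms by (rule vimage_borel)
qed

text \<open>Countability turns "for each set, almost everywhere" into "almost everywhere, as
  measures". The class consists of finite intersections from a countable basis; the empty
  intersection supplies the whole space.\<close>

lemma ex_countable_determining_class:
  "\<exists>\<E>. countable \<E> \<and> \<E> \<subseteq> sets borel \<and> (\<forall>\<mu> \<eta> :: 'a::second_countable_topology signed_measure.
    (\<forall>A\<in>\<E>. sm_val \<mu> A = sm_val \<eta> A) \<longrightarrow> \<mu> = \<eta>)"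
proof -
  obtain \<B> :: "'a set set" where \<B>: "countable \<B>" "topological_basis \<B>"
    using ex_countable_basis by blast
  define \<E> where "\<E> = Inter ` {F. finite F \<and> F \<subseteq> \<B>}"
  have cE: "countable \<E>" unfolding \<E>_def
    by (intro countable_image countable_Collect_finite_subset \<B>)
  have op: "open A" if "A \<in> \<E>" for A
    using that topological_basis_open[OF \<B>(2)] by (auto simp: \<E>_def intro!: open_Inter)
  then have Eb: "\<E> \<subseteq> sets borel" by auto
  have UE: "UNIV \<in> \<E>" by (auto simp: \<E>_def intro!: image_eqI[of _ _ "{}"])
  have BE: "\<B> \<subseteq> \<E>" by (auto simp: \<E>_def intro!: image_eqI[of _ _ "{_}"])
  have IE: "Int_stable \<E>"
  proof (rule Int_stableI)
    fix a b assume "a \<in> \<E>" "b \<in> \<E>"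
    then obtain F H where "a = \<Inter>F" "b = \<Inter>H" "finite F" "finite H" "F \<subseteq> \<B>" "H \<subseteq> \<B>"
      by (auto simp: \<E>_def)
    then show "a \<inter> b \<in> \<E>"
      unfolding \<E>_def by (intro image_eqI[of _ _ "F \<union> H"]) auto
  qed
  have sE: "sets borel = sigma_sets UNIV \<E>"
  proof
    have "sets borel = sigma_sets UNIV \<B>"
      using arg_cong[OF borel_eq_countable_basis[OF \<B>], of sets] by (simp only: sets_measure_of Pow_UNIV subset_UNIV)
    also have "\<dots> \<subseteq> sigma_sets UNIV \<E>" by (rule sigma_sets_mono'[OF BE])
    finally show "sets borel \<subseteq> sigma_sets UNIV \<E>" .
    show "sigma_sets UNIV \<E> \<subseteq> sets borel"
      using sets.sigma_sets_subset[OF Eb] by simp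
  qed
  have "\<mu> = \<eta>" if eq: "\<And>A. A \<in> \<E> \<Longrightarrow> sm_val \<mu> A = sm_val \<eta> A" for \<mu> \<eta> :: "'a signed_measure"
  proof -
    \<comment> \<open>The uniqueness theorem for measures is applied to the two Jordan parts of the
      difference.\<close>
    define \<sigma> where "\<sigma> = \<mu> - \<eta>"
    interpret p: finite_measure "pos_measure \<sigma>" by (rule finite_pos_measure)
    interpret n: finite_measure "neg_measure \<sigma>" by (rule finite_neg_measure)
    have "pos_measure \<sigma> = neg_measure \<sigma>"
    proof (rule measure_eqI_generator_eq_countable[OF IE, of UNIV _ _ "{UNIV}"])
      fix X assume X: "X \<in> \<E>"
      then have "sm_val \<sigma> X = 0" using eq by (simp add: \<sigma>_def)
      then have "measure (pos_measure \<sigma>) X = measure (neg_measure \<sigma>) X"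
        using sm_val_pos_neg[of X \<sigma>] X Eb by auto
      then show "emeasure (pos_measure \<sigma>) X = emeasure (neg_measure \<sigma>) X"
        by (simp add: p.emeasure_eq_measure n.emeasure_eq_measure)
    qed (use sE UE in auto)
    then have z: "sm_val \<sigma> A = 0" if "A \<in> sets borel" for A
      unfolding sm_val_pos_neg[OF that, of \<sigma>] by simp
    show "\<mu> = \<eta>"
    proof (rule sm_eqI)
      fix A :: "'a set" assume "A \<in> sets borel"
      from z[OF this] show "sm_val \<mu> A = sm_val \<eta> A" by (simp add: \<sigma>_def)
    qed
  qed
  then show ?thesis using cE Eb by (intro exI[of _ \<E>] conjI allI impI) simp_all
qed

section \<open>Existence, uniqueness and calculus of fibre versions\<close>

locale finite_borel_measure = finite_measure m for m :: "'m::polish_space measure" +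
  assumes sets_m [simp, measurable_cong]: "sets m = sets borel"
begin

lemma space_m [simp]: "space m = UNIV"
  using sets_eq_imp_space_eq[OF sets_m] by simp

lemma fibre_version_integrable:
  assumes "fibre_version m \<mu> r" and E: "E \<in> sets borel"
  shows "integrable m (\<lambda>\<gamma>. sm_val (r \<gamma>) (Pair \<gamma> -` E))"
proof -
  obtain D where "integrable m D" "\<And>\<gamma> A. \<bar>sm_val (r \<gamma>) A\<bar> \<le> D \<gamma>"
    using assms(1) by (auto simp: fibre_version_def)
  moreover have "(\<lambda>\<gamma>. sm_val (r \<gamma>) (Pair \<gamma> -` E)) \<in> borel_measurable m"
    using assms by (auto simp: fibre_version_def measurable_cong_sets[OF sets_m refl])
  ultimately show ?thesis
    by (elim Bochner_Integration.integrable_bound) (auto intro!: AE_I2 order_trans[OF _ abs_ge_self])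
qed

lemma fibre_version_eq: "fibre_version m \<mu> r \<Longrightarrow> E \<in> sets borel \<Longrightarrow>
    (LINT \<gamma>|m. sm_val (r \<gamma>) (Pair \<gamma> -` E)) = sm_val \<mu> E"
  by (simp add: fibre_version_def)

lemma fibre_version_integrable_Times:
  fixes \<mu> :: "('m \<times> 'k::polish_space) signed_measure"
  assumes "fibre_version m \<mu> r" "A \<in> sets borel"
  shows "integrable m (\<lambda>\<gamma>. sm_val (r \<gamma>) A)"
proof -
  have "Pair \<gamma> -` (UNIV \<times> A) = A" for \<gamma> :: 'm by auto
  then show ?thesis
    using fibre_version_integrable[OF assms(1) Times_borel[of UNIV A]] assms(2) by simp
qed

lemma fibre_version_Times:
  fixes \<mu> :: "('m \<times> 'k::polish_space) signed_measure"
  assumes r: "fibre_version m \<mu> r" and B: "B \<in> sets borel" and A: "A \<in> sets borel"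
  shows "(LINT \<gamma>:B|m. sm_val (r \<gamma>) A) = sm_val \<mu> (B \<times> A)"
proof -
  have "sm_val \<mu> (B \<times> A) = (LINT \<gamma>|m. sm_val (r \<gamma>) (Pair \<gamma> -` (B \<times> A)))"
    by (rule fibre_version_eq[OF r Times_borel[OF B A], symmetric])
  also have "\<dots> = (LINT \<gamma>:B|m. sm_val (r \<gamma>) A)"
    unfolding set_lebesgue_integral_def
    by (intro Bochner_Integration.integral_cong) (auto simp: indicator_def)
  finally show ?thesis by simp
qed

lemma fibre_version_add:
  assumes "fibre_version m \<mu> r" "fibre_version m \<eta> s"
  shows "fibre_version m (\<mu> + \<eta>) (\<lambda>\<gamma>. r \<gamma> + s \<gamma>)"
proof -
  obtain D D' where "integrable m D" "\<And>\<gamma> A. \<bar>sm_val (r \<gamma>) A\<bar> \<le> D \<gamma>" "integrable m D'" "\<And>\<gamma> A. \<bar>sm_val (s \<gamma>) A\<bar> \<le> D' \<gamma>"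
    using assms by (auto simp: fibre_version_def)
  then have "\<exists>D. integrable m D \<and> (\<forall>\<gamma> A. \<bar>sm_val (r \<gamma>) A + sm_val (s \<gamma>) A\<bar> \<le> D \<gamma>)"
    by (intro exI[of _ "\<lambda>\<gamma>. D \<gamma> + D' \<gamma>"]) (auto intro!: order_trans[OF abs_triangle_ineq] add_mono)
  then show ?thesis
    using assms fibre_version_integrable[OF assms(1)] fibre_version_integrable[OF assms(2)]
    by (simp add: fibre_version_def)
qed

lemma fibre_version_scaleR:
  assumes "fibre_version m \<mu> r"
  shows "fibre_version m (c *\<^sub>R \<mu>) (\<lambda>\<gamma>. c *\<^sub>R r \<gamma>)"
proof -
  obtain D where "integrable m D" "\<And>\<gamma> A. \<bar>sm_val (r \<gamma>) A\<bar> \<le> D \<gamma>"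
    using assms by (auto simp: fibre_version_def)
  then have "\<exists>D. integrable m D \<and> (\<forall>\<gamma> A. \<bar>c * sm_val (r \<gamma>) A\<bar> \<le> D \<gamma>)"
    by (intro exI[of _ "\<lambda>\<gamma>. \<bar>c\<bar> * D \<gamma>"]) (auto simp: abs_mult intro!: mult_left_mono)
  then show ?thesis
    using assms by (auto simp: fibre_version_def intro!: borel_measurable_times)
qed

lemma fibre_version_diff:
  assumes "fibre_version m \<mu> r" "fibre_version m \<eta> s"
  shows "fibre_version m (\<mu> - \<eta>) (\<lambda>\<gamma>. r \<gamma> - s \<gamma>)"
  using fibre_version_add[OF assms(1) fibre_version_scaleR[OF assms(2), of "-1"]] by simp

text \<open>For fixed A both sides are densities of the set function sending B to the value of \<mu>
  on B x A, hence agree a.e.; a countable determining class removes the dependence on A.\<close>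

lemma fibre_version_unique:
  fixes \<mu> :: "('m \<times> 'k::polish_space) signed_measure"
  assumes "fibre_version m \<mu> r" "fibre_version m \<mu> s"
  shows "AE \<gamma> in m. r \<gamma> = s \<gamma>"
proof -
  obtain \<E> :: "'k set set" where \<E>: "countable \<E>" "\<E> \<subseteq> sets borel"
    "\<And>\<mu> \<eta>. (\<forall>A\<in>\<E>. sm_val \<mu> A = sm_val \<eta> A) \<Longrightarrow> \<mu> = \<eta>"
    using ex_countable_determining_class by metis
  have "AE \<gamma> in m. sm_val (r \<gamma>) A = sm_val (s \<gamma>) A" if "A \<in> \<E>" for A
  proof (rule density_unique_real)
    have A: "A \<in> sets borel" using that \<E> by auto
    then show "integrable m (\<lambda>\<gamma>. sm_val (r \<gamma>) A)" "integrable m (\<lambda>\<gamma>. sm_val (s \<gamma>) A)"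
      using assms by (auto intro: fibre_version_integrable_Times)
    show "(LINT \<gamma>:B|m. sm_val (r \<gamma>) A) = (LINT \<gamma>:B|m. sm_val (s \<gamma>) A)" if "B \<in> sets m" for B
      using that A by (simp add: fibre_version_Times[OF assms(1)] fibre_version_Times[OF assms(2)])
  qed
  then have "AE \<gamma> in m. \<forall>A\<in>\<E>. sm_val (r \<gamma>) A = sm_val (s \<gamma>) A"
    by (simp add: AE_ball_countable[OF \<E>(1)])
  then show ?thesis by eventually_elim (rule \<E>(3))
qed

lemma fibre_version_determines:
  fixes \<mu> :: "('m \<times> 'k::polish_space) signed_measure"
  assumes "fibre_version m \<mu> r" "fibre_version m \<eta> s" "AE \<gamma> in m. r \<gamma> = s \<gamma>"
  shows "\<mu> = \<eta>"
proof (rule sm_eqI)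
  fix E :: "('m \<times> 'k) set" assume E: "E \<in> sets borel"
  have "(LINT \<gamma>|m. sm_val (r \<gamma>) (Pair \<gamma> -` E)) = (LINT \<gamma>|m. sm_val (s \<gamma>) (Pair \<gamma> -` E))"
    using assms(3) fibre_version_integrable[OF assms(1) E] fibre_version_integrable[OF assms(2) E]
    by (intro integral_cong_AE) auto
  then show "sm_val \<mu> E = sm_val \<eta> E"
    by (simp add: fibre_version_eq[OF assms(1) E] fibre_version_eq[OF assms(2) E])
qed

text \<open>Projecting to the second coordinate loses nothing, because \<kappa> \<gamma> is
  concentrated on its fibre. The required integrable bound is the density d, since the conditional
  measures are probabilities.\<close>

lemma disintegration_fibre_version:
  fixes p :: "('m \<times> 'k::polish_space) measure"
  assumes p: "finite_measure p" "sets p = sets borel" and d: "disintegration m p \<kappa> d"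
  shows "fibre_version m (signed_of p) (\<lambda>\<gamma>. d \<gamma> *\<^sub>R signed_of (distr (\<kappa> \<gamma>) borel snd))"
proof -
  interpret p: finite_measure p by fact
  have k: "\<kappa> \<in> measurable borel (prob_algebra borel)" "\<And>\<gamma>. emeasure (\<kappa> \<gamma>) ({\<gamma>} \<times> UNIV) = 1"
    and dm [measurable]: "d \<in> borel_measurable borel" and d0: "\<And>\<gamma>. 0 \<le> d \<gamma>"
    and pE: "\<And>E. E \<in> sets borel \<Longrightarrow> emeasure p E = (\<integral>\<^sup>+\<gamma>. ennreal (d \<gamma>) * emeasure (\<kappa> \<gamma>) E \<partial>m)"
    using d by (auto simp: disintegration_def)
  have pk: "prob_space (\<kappa> \<gamma>)" and sk: "sets (\<kappa> \<gamma>) = sets borel" for \<gamma>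
    using measurable_space[OF k(1), of \<gamma>] by (auto simp: space_prob_algebra)
  have spk: "space (\<kappa> \<gamma>) = UNIV" for \<gamma> using sets_eq_imp_space_eq[OF sk] by simp
  have snd: "snd \<in> measurable (\<kappa> \<gamma>) borel" for \<gamma>
    unfolding measurable_cong_sets[OF sk refl] borel_prod[symmetric] by measurable
  have pd: "prob_space (distr (\<kappa> \<gamma>) borel (snd :: _ \<Rightarrow> 'k))" for \<gamma>
    by (rule prob_space.prob_space_distr[OF pk snd])
  have val: "sm_val (signed_of (distr (\<kappa> \<gamma>) borel snd)) A = measure (distr (\<kappa> \<gamma>) borel snd) A" for \<gamma> and A :: "'k set"
    using pd by (intro sm_val_signed_of) (auto intro: prob_space.finite_measure)
  have valE: "sm_val (signed_of (distr (\<kappa> \<gamma>) borel snd)) (Pair \<gamma> -` E) = measure (\<kappa> \<gamma>) E" if E: "E \<in> sets borel" for \<gamma> E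
  proof -
    have g: "{\<gamma>} \<times> UNIV \<in> sets (\<kappa> \<gamma>)" using sk by (auto intro: Times_borel)
    interpret k: prob_space "\<kappa> \<gamma>" by (rule pk)
    \<comment> \<open>On the fibre over \<gamma>, membership in E and membership of the second
      coordinate in the slice of E coincide.\<close>
    have ae: "AE z in \<kappa> \<gamma>. z \<in> {\<gamma>} \<times> UNIV"
      using g k(2) by (subst k.AE_in_set_eq_1) (auto simp: measure_def)
    have "measure (distr (\<kappa> \<gamma>) borel snd) (Pair \<gamma> -` E) = measure (\<kappa> \<gamma>) (snd -` (Pair \<gamma> -` E))"
      using Pair_vimage_borel[OF E, of \<gamma>] by (simp add: measure_distr[OF snd] spk)
    also have "\<dots> = measure (\<kappa> \<gamma>) E"
    proof (rule k.finite_measure_eq_AE)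
      show "AE z in \<kappa> \<gamma>. z \<in> snd -` (Pair \<gamma> -` E) \<longleftrightarrow> z \<in> E"
        using ae by eventually_elim auto
      show "snd -` (Pair \<gamma> -` E) \<in> sets (\<kappa> \<gamma>)"
        using measurable_sets[OF snd Pair_vimage_borel[OF E]] by (simp add: spk)
    qed (use E sk in auto)
    finally show ?thesis by (simp add: val)
  qed
  have mk [measurable]: "(\<lambda>\<gamma>. measure (\<kappa> \<gamma>) E) \<in> borel_measurable borel" if "E \<in> sets borel" for E
    by (rule measurable_compose[OF measurable_prob_algebraD[OF k(1)] measurable_measure_subprob_algebra[OF that]])
  have nn: "(\<integral>\<^sup>+\<gamma>. ennreal (d \<gamma> * measure (\<kappa> \<gamma>) E) \<partial>m) = ennreal (measure p E)" if E: "E \<in> sets borel" for E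
  proof -
    have "emeasure (\<kappa> \<gamma>) E = ennreal (measure (\<kappa> \<gamma>) E)" for \<gamma>
      using prob_space.finite_measure[OF pk] by (simp add: finite_measure.emeasure_eq_measure)
    then show ?thesis
      using pE[OF E] d0 by (simp add: ennreal_mult' p.emeasure_eq_measure)
  qed
  have int: "integrable m (\<lambda>\<gamma>. d \<gamma> * measure (\<kappa> \<gamma>) E)" 
    "(LINT \<gamma>|m. d \<gamma> * measure (\<kappa> \<gamma>) E) = measure p E" if E: "E \<in> sets borel" for E
  proof -
    have [measurable]: "E \<in> sets borel" by fact
    show i: "integrable m (\<lambda>\<gamma>. d \<gamma> * measure (\<kappa> \<gamma>) E)"
      using nn[OF E] d0 by (intro integrableI_nonneg) auto
    show "(LINT \<gamma>|m. d \<gamma> * measure (\<kappa> \<gamma>) E) = measure p E"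
      using nn[OF E] d0 by (subst integral_eq_nn_integral) auto
  qed
  show ?thesis
    unfolding fibre_version_def
  proof (intro conjI exI allI ballI)
    have "measure (\<kappa> \<gamma>) UNIV = 1" for \<gamma> using prob_space.prob_space[OF pk, of \<gamma>] by (simp add: spk)
    then show "integrable m d" using int(1)[of UNIV] by simp
    show "\<bar>sm_val (d \<gamma> *\<^sub>R signed_of (distr (\<kappa> \<gamma>) borel snd)) A\<bar> \<le> d \<gamma>" for \<gamma> A
      using d0[of \<gamma>] prob_space.prob_le_1[OF pd, of \<gamma> A]
      by (simp add: val abs_mult mult_left_le)
  next
    fix E :: "('m \<times> 'k) set" assume E [measurable]: "E \<in> sets borel"
    show "(\<lambda>\<gamma>. sm_val (d \<gamma> *\<^sub>R signed_of (distr (\<kappa> \<gamma>) borel snd)) (Pair \<gamma> -` E)) \<in> borel_measurable borel"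
      by (simp add: valE[OF E]) 
    show "(LINT \<gamma>|m. sm_val (d \<gamma> *\<^sub>R signed_of (distr (\<kappa> \<gamma>) borel snd)) (Pair \<gamma> -` E)) = sm_val (signed_of p) E"
      using int(2)[OF E] by (simp add: valE[OF E] sm_val_signed_of[OF p])
  qed
qed

lemma pos_fibre_restriction_version:
  fixes p :: "('m \<times> 'k::polish_space) measure"
  assumes p: "finite_measure p" "sets p = sets borel" and r: "pos_fibre_restriction m p r"
  shows "\<exists>s. fibre_version m (signed_of p) s \<and> (AE \<gamma> in m. r \<gamma> = s \<gamma>)"
  using r disintegration_fibre_version[OF p] unfolding pos_fibre_restriction_def by blast

lemma signed_of_pos_neg: "\<mu> = signed_of (pos_measure \<mu>) - signed_of (neg_measure \<mu>)"
  by (intro sm_eqI) (simp add: sm_val_signed_of finite_pos_measure finite_neg_measure sm_val_pos_neg)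

lemma fibre_restriction_version:
  fixes \<mu> :: "('m \<times> 'k::polish_space) signed_measure"
  assumes "fibre_restriction m \<mu> r"
  shows "\<exists>s. fibre_version m \<mu> s \<and> (AE \<gamma> in m. r \<gamma> = s \<gamma>)"
proof -
  obtain rp rn where r: "pos_fibre_restriction m (pos_measure \<mu>) rp" "pos_fibre_restriction m (neg_measure \<mu>) rn"
    "AE \<gamma> in m. r \<gamma> = rp \<gamma> - rn \<gamma>"
    using assms by (auto simp: fibre_restriction_def)
  obtain sp where sp: "fibre_version m (signed_of (pos_measure \<mu>)) sp" "AE \<gamma> in m. rp \<gamma> = sp \<gamma>"
    using pos_fibre_restriction_version[OF finite_pos_measure sets_pos_measure r(1)] by blast
  obtain sn where sn: "fibre_version m (signed_of (neg_measure \<mu>)) sn" "AE \<gamma> in m. rn \<gamma> = sn \<gamma>"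
    using pos_fibre_restriction_version[OF finite_neg_measure sets_neg_measure r(2)] by blast
  have "fibre_version m \<mu> (\<lambda>\<gamma>. sp \<gamma> - sn \<gamma>)"
    using fibre_version_diff[OF sp(1) sn(1)] signed_of_pos_neg[of \<mu>] by simp
  moreover have "AE \<gamma> in m. r \<gamma> = sp \<gamma> - sn \<gamma>"
    using r(3) sp(2) sn(2) by eventually_elim simp
  ultimately show ?thesis by blast
qed

lemma AB_ex_fibre_restriction:
  fixes \<mu> :: "('m \<times> 'k::polish_space) signed_measure"
  assumes "\<mu> \<in> AB m"
  shows "\<exists>r. fibre_restriction m \<mu> r"
proof -
  have pos: "\<exists>r. pos_fibre_restriction m p r" if ex: "\<exists>\<kappa> d. disintegration m p \<kappa> d" for p :: "('m \<times> 'k) measure"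
  proof -
    obtain \<kappa> d where "disintegration m p \<kappa> d" using ex by blast
    then have "pos_fibre_restriction m p (\<lambda>\<gamma>. d \<gamma> *\<^sub>R signed_of (distr (\<kappa> \<gamma>) borel snd))"
      unfolding pos_fibre_restriction_def by (intro exI[of _ \<kappa>] exI[of _ d]) simp
    then show ?thesis by blast
  qed
  have "\<exists>\<kappa> d. disintegration m (pos_measure \<mu>) \<kappa> d"
    by (rule ex_disintegration[OF finite_pos_measure sets_pos_measure sigma_finite_measure_axioms sets_m])
       (use assms in \<open>simp add: AB_def\<close>)
  moreover have "\<exists>\<kappa> d. disintegration m (neg_measure \<mu>) \<kappa> d"
    by (rule ex_disintegration[OF finite_neg_measure sets_neg_measure sigma_finite_measure_axioms sets_m])
       (use assms in \<open>simp add: AB_def\<close>)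
  ultimately obtain rp rn where "pos_fibre_restriction m (pos_measure \<mu>) rp" "pos_fibre_restriction m (neg_measure \<mu>) rn"
    using pos by metis
  then show ?thesis
    unfolding fibre_restriction_def by (intro exI[of _ "\<lambda>\<gamma>. rp \<gamma> - rn \<gamma>"] exI conjI) auto
qed

lemma AB_ex_fibre_version: 
  fixes \<mu> :: "('m \<times> 'k::polish_space) signed_measure"
  shows "\<mu> \<in> AB m \<Longrightarrow> \<exists>r. fibre_version m \<mu> r"
  using AB_ex_fibre_restriction fibre_restriction_version by blast

text \<open>If B is null for m, almost every slice of a subset of B x UNIV is empty, so \<mu>
  vanishes on all such sets. Cutting with a Hahn set carries this to both Jordan parts.\<close>

lemma fibre_version_AB:
  fixes \<mu> :: "('m \<times> 'k::polish_space) signed_measure"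
  assumes r: "fibre_version m \<mu> r"
  shows "\<mu> \<in> AB m"
proof -
  obtain H where H: "H \<in> sets borel" "\<And>A. A \<in> sets borel \<Longrightarrow> measure (pos_measure \<mu>) A = sm_val \<mu> (A \<inter> H)"
    "\<And>A. A \<in> sets borel \<Longrightarrow> measure (neg_measure \<mu>) A = - sm_val \<mu> (A - H)"
    using ex_hahn_set[of \<mu>] by blast
  interpret p: finite_measure "pos_measure \<mu>" by (rule finite_pos_measure)
  interpret n: finite_measure "neg_measure \<mu>" by (rule finite_neg_measure)
  have fst: "fst \<in> borel_measurable (borel :: ('m \<times> 'k) measure)"
    unfolding borel_prod[symmetric] by measurable
  have z: "sm_val \<mu> E = 0" if B: "B \<in> null_sets m" and E: "E \<in> sets borel" "E \<subseteq> B \<times> UNIV" for B E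
  proof -
    have "(LINT \<gamma>|m. sm_val (r \<gamma>) (Pair \<gamma> -` E)) = (LINT \<gamma>|m. 0)"
    proof (rule integral_cong_AE)
      show "AE \<gamma> in m. sm_val (r \<gamma>) (Pair \<gamma> -` E) = 0"
        using AE_not_in[OF B]
      proof eventually_elim
        case (elim \<gamma>)
        then have "Pair \<gamma> -` E = {}" using E by auto
        then show ?case by simp
      qed
    qed (use fibre_version_integrable[OF r E(1)] in auto)
    then show ?thesis using fibre_version_eq[OF r E(1)] by simp
  qed
  show ?thesis
    unfolding AB_def absolutely_continuous_def
  proof (safe)
    fix B assume B: "B \<in> null_sets m"
    then have Bb: "B \<in> sets borel" by auto
    then have BU: "B \<times> UNIV \<in> sets (borel :: ('m \<times> 'k) measure)" by (rule Times_borel) simp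
    have fB: "fst -` B = B \<times> (UNIV :: 'k set)" by auto
    have "measure (pos_measure \<mu>) (B \<times> UNIV) = 0" "measure (neg_measure \<mu>) (B \<times> UNIV) = 0"
      using z[OF B] BU H(1) by (simp_all add: H(2,3))
    then show "B \<in> null_sets (distr (pos_measure \<mu>) borel fst)" "B \<in> null_sets (distr (neg_measure \<mu>) borel fst)"
      using Bb fst sets_eq_imp_space_eq[OF sets_pos_measure[of \<mu>]] sets_eq_imp_space_eq[OF sets_neg_measure[of \<mu>]]
      by (auto simp: null_sets_def emeasure_distr measurable_cong_sets[OF sets_pos_measure refl]
          measurable_cong_sets[OF sets_neg_measure refl] fB p.emeasure_eq_measure n.emeasure_eq_measure)
  qed
qed

text \<open>The bridge from the Jordan-based definition to versions, which avoids decomposing sums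
  and images later. The backward direction needs the existence of some restriction, that is, the
  disintegration.\<close>

lemma fibre_restriction_iff:
  fixes \<mu> :: "('m \<times> 'k::polish_space) signed_measure"
  assumes s: "fibre_version m \<mu> s"
  shows "fibre_restriction m \<mu> r \<longleftrightarrow> (AE \<gamma> in m. r \<gamma> = s \<gamma>)"
proof
  assume "fibre_restriction m \<mu> r"
  then obtain s' where s': "fibre_version m \<mu> s'" "AE \<gamma> in m. r \<gamma> = s' \<gamma>"
    using fibre_restriction_version by blast
  show "AE \<gamma> in m. r \<gamma> = s \<gamma>"
    using s'(2) fibre_version_unique[OF s s'(1)] by eventually_elim simp
next
  assume rs: "AE \<gamma> in m. r \<gamma> = s \<gamma>"
  obtain r' where r': "fibre_restriction m \<mu> r'"
    using AB_ex_fibre_restriction[OF fibre_version_AB[OF s]] by blast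
  then obtain s' where s': "fibre_version m \<mu> s'" "AE \<gamma> in m. r' \<gamma> = s' \<gamma>"
    using fibre_restriction_version by blast
  obtain rp rn where p: "pos_fibre_restriction m (pos_measure \<mu>) rp" "pos_fibre_restriction m (neg_measure \<mu>) rn"
    "AE \<gamma> in m. r' \<gamma> = rp \<gamma> - rn \<gamma>"
    using r' by (auto simp: fibre_restriction_def)
  have "AE \<gamma> in m. r \<gamma> = rp \<gamma> - rn \<gamma>"
    using rs s'(2) fibre_version_unique[OF s s'(1)] p(3) by eventually_elim simp
  then show "fibre_restriction m \<mu> r" using p by (auto simp: fibre_restriction_def)
qed

lemma marginal_density_measurable [measurable]: 
  "marginal_density m \<mu> \<in> borel_measurable borel"
proof -
  have [measurable]: "RN_deriv m q \<in> borel_measurable borel" for q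
    using borel_measurable_RN_deriv[of m q] by (simp add: measurable_cong_sets[OF sets_m refl])
  show ?thesis unfolding marginal_density_def[abs_def] by measurable
qed

text \<open>Both functions are densities of the set function sending B to the value of \<mu> on B x
  UNIV.\<close>

lemma marginal_density_version:
  fixes \<mu> :: "('m \<times> 'k::polish_space) signed_measure"
  assumes r: "fibre_version m \<mu> r"
  shows "AE \<gamma> in m. marginal_density m \<mu> \<gamma> = sm_val (r \<gamma>) UNIV"
proof -
  have fst: "fst \<in> borel_measurable (borel :: ('m \<times> 'k) measure)"
    unfolding borel_prod[symmetric] by measurable
  have R: "integrable m (\<lambda>\<gamma>. enn2real (RN_deriv m (distr q borel fst) \<gamma>))"
     "\<And>B. B \<in> sets borel \<Longrightarrow> (LINT \<gamma>:B|m. enn2real (RN_deriv m (distr q borel fst) \<gamma>)) = measure q (B \<times> UNIV)"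
    if q: "finite_measure q" "sets q = sets borel" "absolutely_continuous m (distr q borel fst)" for q :: "('m \<times> 'k) measure"
  proof -
    interpret q: finite_measure q by fact
    have fstq: "fst \<in> measurable q borel" using fst by (simp add: measurable_cong_sets[OF q(2) refl])
    define q1 where "q1 = distr q borel fst"
    interpret q1: finite_measure q1 unfolding q1_def by (rule q.finite_measure_distr[OF fstq])
    have [measurable]: "RN_deriv m q1 \<in> borel_measurable borel"
      using borel_measurable_RN_deriv[of m q1] by (simp add: measurable_cong_sets[OF sets_m refl])
    have dens: "density m (RN_deriv m q1) = q1"
      using q(3) by (intro density_RN_deriv) (auto simp: q1_def)
    have e: "(\<integral>\<^sup>+\<gamma>\<in>B. RN_deriv m q1 \<gamma> \<partial>m) = ennreal (measure q (B \<times> UNIV))" if "B \<in> sets borel" for B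
    proof -
      have "(\<integral>\<^sup>+\<gamma>\<in>B. RN_deriv m q1 \<gamma> \<partial>m) = emeasure q1 B"
        by (subst dens[symmetric]) (use that in \<open>simp add: emeasure_density\<close>)
      also have "\<dots> = emeasure q (fst -` B)"
        unfolding q1_def using that sets_eq_imp_space_eq[OF q(2)] by (simp add: emeasure_distr[OF fstq])
      also have "fst -` B = B \<times> (UNIV :: 'k set)" by auto
      finally show ?thesis by (simp add: q.emeasure_eq_measure)
    qed
    have fin: "AE \<gamma> in m. RN_deriv m q1 \<gamma> \<noteq> \<infinity>"
      using e[of UNIV] by (intro nn_integral_PInf_AE) auto
    have nn: "(\<integral>\<^sup>+\<gamma>. ennreal (indicator B \<gamma> * enn2real (RN_deriv m q1 \<gamma>)) \<partial>m) = ennreal (measure q (B \<times> UNIV))" if "B \<in> sets borel" for B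
      unfolding e[OF that, symmetric] using fin
      by (intro nn_integral_cong_AE) (auto simp: indicator_def ennreal_enn2real_if elim!: eventually_mono)
    show "integrable m (\<lambda>\<gamma>. enn2real (RN_deriv m (distr q borel fst) \<gamma>))"
      using nn[of UNIV] unfolding q1_def[symmetric]
      by (intro integrableI_nonneg) auto
    show "(LINT \<gamma>:B|m. enn2real (RN_deriv m (distr q borel fst) \<gamma>)) = measure q (B \<times> UNIV)" if "B \<in> sets borel" for B
      using nn[OF that] that unfolding q1_def[symmetric] set_lebesgue_integral_def
      by (subst integral_eq_nn_integral) auto
  qed
  have ab: "absolutely_continuous m (distr (pos_measure \<mu>) borel fst)" "absolutely_continuous m (distr (neg_measure \<mu>) borel fst)"
    using fibre_version_AB[OF r] by (auto simp: AB_def)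
  note Rp = R[OF finite_pos_measure sets_pos_measure ab(1)] and Rn = R[OF finite_neg_measure sets_neg_measure ab(2)]
  show ?thesis
  proof (rule density_unique_real)
    show "integrable m (marginal_density m \<mu>)"
      unfolding marginal_density_def[abs_def] using Rp(1) Rn(1) by simp
    show "integrable m (\<lambda>\<gamma>. sm_val (r \<gamma>) UNIV)"
      by (rule fibre_version_integrable_Times[OF r]) simp
    show "(LINT \<gamma>:B|m. marginal_density m \<mu> \<gamma>) = (LINT \<gamma>:B|m. sm_val (r \<gamma>) UNIV)" if "B \<in> sets m" for B
    proof -
      have B: "B \<in> sets borel" using that by simp
      have "(LINT \<gamma>:B|m. marginal_density m \<mu> \<gamma>) = measure (pos_measure \<mu>) (B \<times> UNIV) - measure (neg_measure \<mu>) (B \<times> UNIV)"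
        unfolding marginal_density_def
        using integrable_mult_indicator[OF that Rp(1)] integrable_mult_indicator[OF that Rn(1)]
        by (subst set_integral_diff) (auto simp: set_integrable_def Rp(2)[OF B] Rn(2)[OF B])
      also have "\<dots> = sm_val \<mu> (B \<times> UNIV)"
        using B by (simp add: sm_val_pos_neg Times_borel)
      finally show ?thesis using B by (simp add: fibre_version_Times[OF r])
    qed
  qed
qed

text \<open>The infimum in the definition runs over a single value, since all restrictions agree
  a.e. and \<open>ess_sup\<close> sees only a.e. classes.\<close>

lemma fibre_sup_norm_version:
  fixes \<mu> :: "('m \<times> 'k::polish_space) signed_measure"
  assumes r: "fibre_version m \<mu> r"
  shows "fibre_sup_norm No m \<mu> = ess_sup m (\<lambda>\<gamma>. No (r \<gamma>))"
proof -
  have *: "ess_sup m (\<lambda>\<gamma>. No (s \<gamma>)) = ess_sup m (\<lambda>\<gamma>. No (r \<gamma>))" if "AE \<gamma> in m. s \<gamma> = r \<gamma>" for s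
    unfolding ess_sup_def
  proof (intro arg_cong[of _ _ Inf] Collect_cong)
    fix C show "(AE \<gamma> in m. ereal (No (s \<gamma>)) \<le> C) \<longleftrightarrow> (AE \<gamma> in m. ereal (No (r \<gamma>)) \<le> C)"
      by (intro eventually_subst eventually_mono[OF that]) simp
  qed
  show ?thesis
    unfolding fibre_sup_norm_def fibre_restriction_iff[OF r]
  proof (rule antisym)
    show "(INF s\<in>{s. AE \<gamma> in m. s \<gamma> = r \<gamma>}. ess_sup m (\<lambda>\<gamma>. No (s \<gamma>))) \<le> ess_sup m (\<lambda>\<gamma>. No (r \<gamma>))"
      by (rule INF_lower) simp
    show "ess_sup m (\<lambda>\<gamma>. No (r \<gamma>)) \<le> (INF s\<in>{s. AE \<gamma> in m. s \<gamma> = r \<gamma>}. ess_sup m (\<lambda>\<gamma>. No (s \<gamma>)))"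
      by (rule INF_greatest) (metis * mem_Collect_eq order_refl)
  qed
qed

end

text \<open>The infimum is reached along a sequence of essential bounds, so one null set suffices
  and u need not be measurable.\<close>

lemma AE_le_ess_sup: "AE x in M. ereal (u x) \<le> ess_sup M u"
proof (cases "ess_sup M u = \<infinity>")
  case False
  define C where "C = {C. AE x in M. ereal (u x) \<le> C}"
  have ne: "C \<noteq> {}" by (auto simp: C_def intro!: exI[of _ \<infinity>])
  obtain c where c: "range c \<subseteq> C" "Inf C = (INF n::nat. c n)"
    using Inf_countable_INF[OF ne] by (metis image_comp)
  have "AE x in M. \<forall>n. ereal (u x) \<le> c n"
    using c(1) by (subst AE_all_countable) (auto simp: C_def)
  then show ?thesis
    unfolding ess_sup_def C_def[symmetric] c(2)
    by eventually_elim (auto intro: INF_greatest)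
qed simp

lemma ess_sup_le: "AE x in M. ereal (u x) \<le> C \<Longrightarrow> ess_sup M u \<le> C"
  unfolding ess_sup_def by (rule Inf_lower) simp

section \<open>Inverse branches and the transfer operators\<close>

locale conformal_branches =
  fixes f :: "'m::polish_space \<Rightarrow> 'm" and \<phi> h :: "'m \<Rightarrow> real" and m \<nu> :: "'m measure"
    and lam :: real and d :: nat and Q :: "nat \<Rightarrow> 'm set"
  assumes f_measurable [measurable]: "f \<in> borel_measurable borel"
    and phi_measurable [measurable]: "\<phi> \<in> borel_measurable borel"
    and equilibrium: "conformal_equilibrium f \<phi> m h \<nu> lam"
    and branches: "full_branches f \<nu> d Q"
begin

lemma sets_nu [simp, measurable_cong]: "sets \<nu> = sets borel"
  and h_measurable [measurable]: "h \<in> borel_measurable borel"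
  and m_eq: "m = density \<nu> (\<lambda>x. ennreal (h x))"
  and lam_pos: "0 < lam"
  and transfer_h: "AE x in \<nu>. transfer f \<phi> h x = lam * h x"
  and conformal_nu: "conformal f \<phi> lam \<nu>"
  and prob_m: "prob_space m"
  using equilibrium unfolding conformal_equilibrium_def equilibrium_state_def invariant_prob_def
  by blast+

lemma space_nu [simp]: "space \<nu> = UNIV"
  using sets_eq_imp_space_eq[OF sets_nu] by simp

lemma h_bounds: "\<exists>a b. 0 < a \<and> (\<forall>x. a \<le> h x \<and> h x \<le> b)"
  using equilibrium by (simp add: conformal_equilibrium_def)

lemma h_pos [simp]: "0 < h x"
  using h_bounds by (meson less_le_trans)

lemma h_nonneg [simp]: "0 \<le> h x" and h_neq_0 [simp]: "h x \<noteq> 0"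
  using h_pos[of x] by linarith+

sublocale finite_borel_measure m
proof -
  interpret prob_space m by (rule prob_m)
  show "finite_borel_measure m"
    by unfold_locales (simp add: m_eq)
qed

sublocale m: prob_space m by (rule prob_m)

lemma AE_m_iff: "(AE x in m. P x) \<longleftrightarrow> (AE x in \<nu>. P x)"
  unfolding m_eq by (subst AE_density) auto

lemma integrable_m_iff:
  "g \<in> borel_measurable borel \<Longrightarrow> integrable m g \<longleftrightarrow> integrable \<nu> (\<lambda>x. h x * g x :: real)"
  unfolding m_eq by (subst integrable_density) auto

lemma integral_m:
  "g \<in> borel_measurable borel \<Longrightarrow> integral\<^sup>L m g = (LINT x|\<nu>. h x * g x :: real)"
  unfolding m_eq by (subst integral_density) auto

lemma integrable_h: "integrable \<nu> h"
  using integrable_m_iff[of "\<lambda>_. 1"] by simp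

text \<open>The density h has integral 1 against \<nu> and is bounded below by a positive
  constant.\<close>

lemma finite_nu: "finite_measure \<nu>"
proof
  obtain a b where a: "0 < a" "\<And>x. a \<le> h x" using h_bounds by auto
  have "integrable \<nu> (\<lambda>x. a)"
    by (rule Bochner_Integration.integrable_bound[OF integrable_h]) (use a in auto)
  then have "emeasure \<nu> (space \<nu>) < \<infinity>"
    using a by (auto simp: integrable_iff_bounded ennreal_mult_less_top)
  then show "emeasure \<nu> (space \<nu>) \<noteq> \<infinity>" by simp
qed

sublocale nu: finite_measure \<nu> by (rule finite_nu)

lemma nu_UNIV: "emeasure \<nu> UNIV \<noteq> 0"
proof
  assume "emeasure \<nu> UNIV = 0"
  then have "UNIV \<in> null_sets \<nu>" by (simp add: null_sets_def)
  then have "emeasure m UNIV = 0"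
    unfolding m_eq by (subst emeasure_density) (use nn_integral_null_set[of UNIV \<nu>] in auto)
  then show False using m.emeasure_space_1 by simp
qed

abbreviation s :: "nat \<Rightarrow> 'm \<Rightarrow> 'm" where "s i \<equiv> inv_into (Q i) f"

lemma Q_borel [measurable]: "i < d \<Longrightarrow> Q i \<in> sets borel"
  and bij_Q: "i < d \<Longrightarrow> bij_betw f (Q i) UNIV"
  and disjoint_Q: "disjoint_family_on Q {..<d}"
  and nu_Q: "emeasure \<nu> (\<Union>i<d. Q i) = emeasure \<nu> UNIV"
  using branches by (simp_all add: full_branches_def)

lemma s_in_Q: "i < d \<Longrightarrow> s i \<gamma> \<in> Q i"
  and f_s [simp]: "i < d \<Longrightarrow> f (s i \<gamma>) = \<gamma>"
  and s_f: "i < d \<Longrightarrow> x \<in> Q i \<Longrightarrow> s i (f x) = x"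
  using bij_Q[of i] by (auto simp: bij_betw_def inv_into_into f_inv_into_f)

lemma emeasure_image:
  assumes "i < d" "A \<in> sets borel" "A \<subseteq> Q i"
  shows "emeasure \<nu> (f ` A) = (\<integral>\<^sup>+x\<in>A. ennreal (lam * exp (- \<phi> x)) \<partial>\<nu>)"
  using conformal_nu assms bij_Q[of i] inj_on_subset unfolding conformal_def bij_betw_def by blast

text \<open>Conformality makes the images Borel: a set that is not Borel has measure \<open>0\<close> by convention,
  whereas the image of a non-null set has positive measure; a null set is treated through its complement in
  the branch.\<close>

lemma image_borel:
  assumes i: "i < d" and A: "A \<in> sets borel" "A \<subseteq> Q i"
  shows "f ` A \<in> sets borel"
proof -
  have pos: "f ` B \<in> sets borel" if B: "B \<in> sets borel" "B \<subseteq> Q i" and n0: "emeasure \<nu> B \<noteq> 0" for B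
  proof (rule ccontr)
    assume "f ` B \<notin> sets borel"
    then have "emeasure \<nu> (f ` B) = 0" by (intro emeasure_notin_sets) simp
    then have "(\<integral>\<^sup>+x\<in>B. ennreal (lam * exp (- \<phi> x)) \<partial>\<nu>) = 0" using emeasure_image[OF i B] by simp
    then have "AE x in \<nu>. ennreal (lam * exp (- \<phi> x)) * indicator B x = 0"
      using B by (subst (asm) nn_integral_0_iff_AE) auto
    then have "AE x in \<nu>. x \<notin> B"
      by eventually_elim (use lam_pos in \<open>auto simp: indicator_def split: if_splits\<close>)
    then show False using n0 B AE_iff_null_sets[of B \<nu>] by (auto simp: null_sets_def)
  qed
  have fQ: "f ` Q i = UNIV" using bij_Q[OF i] by (simp add: bij_betw_def)
  \<comment> \<open>The branch maps onto the whole space, which has positive measure, so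
    conformality forbids that it be null.\<close>
  have Qn: "emeasure \<nu> (Q i) \<noteq> 0"
  proof
    assume "emeasure \<nu> (Q i) = 0"
    then have "(\<integral>\<^sup>+x\<in>Q i. ennreal (lam * exp (- \<phi> x)) \<partial>\<nu>) = 0"
      using Q_borel[OF i] by (intro nn_integral_null_set) (simp add: null_sets_def)
    then show False using emeasure_image[OF i Q_borel[OF i]] nu_UNIV fQ by simp
  qed
  show ?thesis
  proof (cases "emeasure \<nu> A = 0")
    case True
    have "emeasure \<nu> (Q i) = emeasure \<nu> A + emeasure \<nu> (Q i - A)"
      using A Q_borel[OF i] by (subst plus_emeasure) (auto intro!: arg_cong[of _ _ "emeasure \<nu>"])
    then have "f ` (Q i - A) \<in> sets borel"
      using True Qn A Q_borel[OF i] by (intro pos) auto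
    moreover have "f ` (Q i - A) = UNIV - f ` A"
      unfolding fQ[symmetric] using bij_Q[OF i] A(2)
      by (intro inj_on_image_set_diff[of f "Q i"]) (simp_all add: bij_betw_def)
    then have "f ` A = - (f ` (Q i - A))" by blast
    ultimately show ?thesis by (simp add: borel_comp)
  qed (use pos A in auto)
qed

lemma s_vimage:
  assumes i: "i < d"
  shows "s i -` A = f ` (A \<inter> Q i)"
proof (intro set_eqI iffI)
  fix \<gamma> assume "\<gamma> \<in> s i -` A"
  then show "\<gamma> \<in> f ` (A \<inter> Q i)"
    using s_in_Q[OF i] f_s[OF i] by (intro image_eqI[of _ _ "s i \<gamma>"]) simp_all
next
  fix \<gamma> assume "\<gamma> \<in> f ` (A \<inter> Q i)"
  then show "\<gamma> \<in> s i -` A" using s_f[OF i] by auto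
qed

lemma s_measurable [measurable]: "i < d \<Longrightarrow> s i \<in> borel_measurable borel"
  by (rule measurableI) (auto simp: s_vimage intro!: image_borel Q_borel)

text \<open>Conformality as a change of variables: a preimage under the inverse branch is a forward
  image of a part of the branch, and its measure is given by the Jacobian.\<close>

lemma distr_s:
  assumes i: "i < d"
  shows "distr \<nu> borel (s i) = density \<nu> (\<lambda>x. ennreal (indicator (Q i) x * (lam * exp (- \<phi> x))))"
proof (rule measure_eqI)
  fix A assume "A \<in> sets (distr \<nu> borel (s i))"
  then have A: "A \<in> sets borel" by simp
  have [measurable]: "Q i \<in> sets borel" "A \<in> sets borel" "s i \<in> borel_measurable borel" using A i by auto
  have "emeasure (distr \<nu> borel (s i)) A = emeasure \<nu> (f ` (A \<inter> Q i))"
    using A by (subst emeasure_distr) (auto simp: s_vimage[OF i])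
  also have "\<dots> = (\<integral>\<^sup>+x\<in>A \<inter> Q i. ennreal (lam * exp (- \<phi> x)) \<partial>\<nu>)"
    by (rule emeasure_image[OF i]) auto
  also have "\<dots> = (\<integral>\<^sup>+x\<in>A. ennreal (indicator (Q i) x * (lam * exp (- \<phi> x))) \<partial>\<nu>)"
    by (intro nn_integral_cong) (auto simp: indicator_def)
  also have "\<dots> = emeasure (density \<nu> (\<lambda>x. ennreal (indicator (Q i) x * (lam * exp (- \<phi> x))))) A"
    by (subst emeasure_density) auto
  finally show "emeasure (distr \<nu> borel (s i)) A = \<dots>" .
qed simp

text \<open>Versions are known only a.e. but are evaluated at \<gamma>_i; this transports null sets
  along the inverse branches.\<close>

lemma AE_s:
  assumes i: "i < d" and P: "AE x in \<nu>. P x"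
  shows "AE \<gamma> in \<nu>. P (s i \<gamma>)"
proof -
  have [measurable]: "Q i \<in> sets borel" using i by auto
  have "AE x in distr \<nu> borel (s i). P x"
    unfolding distr_s[OF i] using P by (subst AE_density) auto
  then show ?thesis using i by (intro AE_distrD[of "s i"]) auto
qed

text \<open>The weight e^\<phi> of the transfer operator cancels the Jacobian \<lambda> e^(-\<phi>)
  up to the factor \<lambda>.\<close>

lemma integral_s:
  fixes g :: "'m \<Rightarrow> real"
  assumes i: "i < d" and [measurable]: "g \<in> borel_measurable borel" and g: "integrable \<nu> g"
  shows "integrable \<nu> (\<lambda>\<gamma>. g (s i \<gamma>) * exp (\<phi> (s i \<gamma>)))"
    and "(LINT \<gamma>|\<nu>. g (s i \<gamma>) * exp (\<phi> (s i \<gamma>))) = lam * (LINT x|\<nu>. indicator (Q i) x * g x)"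
proof -
  have [measurable]: "Q i \<in> sets borel" "s i \<in> borel_measurable borel" using i by auto
  have e: "indicator (Q i) x * (lam * exp (- \<phi> x)) * (g x * exp (\<phi> x)) = lam * (indicator (Q i) x * g x)" for x
    by (simp add: exp_minus field_simps)
  have "integrable \<nu> (\<lambda>x. indicator (Q i) x * g x)"
    using integrable_mult_indicator[OF _ g, of "Q i"] by simp
  then have "integrable (distr \<nu> borel (s i)) (\<lambda>x. g x * exp (\<phi> x))"
    unfolding distr_s[OF i] using lam_pos by (subst integrable_density) (auto simp: e)
  then show "integrable \<nu> (\<lambda>\<gamma>. g (s i \<gamma>) * exp (\<phi> (s i \<gamma>)))"
    by (subst (asm) integrable_distr_eq) auto
  have "(LINT \<gamma>|\<nu>. g (s i \<gamma>) * exp (\<phi> (s i \<gamma>))) = integral\<^sup>L (distr \<nu> borel (s i)) (\<lambda>x. g x * exp (\<phi> x))"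
    by (subst integral_distr) auto
  also have "\<dots> = lam * (LINT x|\<nu>. indicator (Q i) x * g x)"
    unfolding distr_s[OF i] using lam_pos by (subst integral_density) (auto simp: e)
  finally show "(LINT \<gamma>|\<nu>. g (s i \<gamma>) * exp (\<phi> (s i \<gamma>))) = lam * (LINT x|\<nu>. indicator (Q i) x * g x)" .
qed

text \<open>The transfer operator summed over the branch preimages only: a finite, measurable
  expression at every point, later shown to agree a.e. with \<open>transfer\<close>.\<close>

definition branch_sum :: "('m \<Rightarrow> real) \<Rightarrow> 'm \<Rightarrow> real" where
  "branch_sum g \<gamma> = (\<Sum>i<d. g (s i \<gamma>) * exp (\<phi> (s i \<gamma>)))"

lemma branch_sum_measurable [measurable]:
  "g \<in> borel_measurable borel \<Longrightarrow> branch_sum g \<in> borel_measurable borel"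
  unfolding branch_sum_def[abs_def]
  by (intro borel_measurable_sum borel_measurable_times borel_measurable_exp[THEN measurable_compose[rotated]])
     (auto intro: measurable_compose[OF s_measurable])

lemma AE_in_Q: "AE x in \<nu>. x \<in> (\<Union>i<d. Q i)"
proof -
  have "(\<Union>i<d. Q i) \<in> sets \<nu>" by auto
  then have "emeasure \<nu> (UNIV - (\<Union>i<d. Q i)) = 0"
    using nu_Q by (subst emeasure_Diff) (auto simp: nu.emeasure_eq_measure)
  then show ?thesis by (intro AE_I[of _ _ "UNIV - (\<Union>i<d. Q i)"]) auto
qed

text \<open>The duality saying that \<nu> is an eigenmeasure with eigenvalue \<lambda>: the branches
  are disjoint and cover almost everything, so the integrals over them add up.\<close>

lemma integral_branch_sum:
  assumes gm: "g \<in> borel_measurable borel" and g: "integrable \<nu> g"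
  shows "integrable \<nu> (branch_sum g)" "(LINT \<gamma>|\<nu>. branch_sum g \<gamma>) = lam * (LINT x|\<nu>. g x)"
proof -
  show "integrable \<nu> (branch_sum g)"
    unfolding branch_sum_def[abs_def] using integral_s(1)[OF _ gm g] by auto
  have iQ: "integrable \<nu> (\<lambda>x. indicator (Q i) x * g x)" if "i < d" for i
    using integrable_mult_indicator[OF _ g, of "Q i"] that by simp
  have "(LINT \<gamma>|\<nu>. branch_sum g \<gamma>) = (\<Sum>i<d. lam * (LINT x|\<nu>. indicator (Q i) x * g x))"
    unfolding branch_sum_def[abs_def] using integral_s[OF _ gm g]
    by (subst Bochner_Integration.integral_sum) auto
  also have "\<dots> = lam * (LINT x|\<nu>. (\<Sum>i<d. indicator (Q i) x * g x))"
    using iQ by (subst Bochner_Integration.integral_sum) (auto simp: sum_distrib_left)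
  also have "(LINT x|\<nu>. (\<Sum>i<d. indicator (Q i) x * g x)) = (LINT x|\<nu>. g x)"
  proof (rule integral_cong_AE)
    show "AE x in \<nu>. (\<Sum>i<d. indicator (Q i) x * g x) = g x"
      using AE_in_Q
    proof eventually_elim
      case (elim x)
      have "(\<Sum>i<d. indicator (Q i) x * g x) = (\<Sum>i<d. indicator (Q i) x) * g x"
        by (simp add: sum_distrib_right)
      also have "(\<Sum>i<d. indicator (Q i) x) = (indicator (\<Union>i<d. Q i) x :: real)"
        using disjoint_Q by (intro indicator_UN_disjoint[symmetric]) auto
      finally show ?case using elim by simp
    qed
  qed (use iQ g in \<open>auto intro!: borel_measurable_sum borel_measurable_integrable\<close>)
  finally show "(LINT \<gamma>|\<nu>. branch_sum g \<gamma>) = lam * (LINT x|\<nu>. g x)" .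
qed

lemma s_inj: "inj_on (\<lambda>i. s i \<gamma>) {..<d}"
proof (rule inj_onI)
  fix i j assume ij: "i \<in> {..<d}" "j \<in> {..<d}" "s i \<gamma> = s j \<gamma>"
  then have "s i \<gamma> \<in> Q i \<inter> Q j" using s_in_Q[of i \<gamma>] s_in_Q[of j \<gamma>] by simp
  then show "i = j" using disjoint_Q ij by (auto simp: disjoint_family_on_def)
qed

text \<open>There are almost surely no further preimages: the branches already account for the whole
  integral of \<open>\<L>h = \<lambda>h\<close>.\<close>

lemma AE_preimages: "AE \<gamma> in \<nu>. f -` {\<gamma>} = (\<lambda>i. s i \<gamma>) ` {..<d}"
  and AE_branch_sum_h: "AE \<gamma> in \<nu>. branch_sum h \<gamma> = lam * h \<gamma>"
proof -
  let ?w = "\<lambda>y. h y * exp (\<phi> y)"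
  have sub: "(\<lambda>i. s i \<gamma>) ` {..<d} \<subseteq> f -` {\<gamma>}" for \<gamma> by auto
  have bs: "branch_sum h \<gamma> = sum ?w ((\<lambda>i. s i \<gamma>) ` {..<d})" for \<gamma>
    unfolding branch_sum_def by (simp add: sum.reindex[OF s_inj])
  \<comment> \<open>\<open>infsum\<close> of a family that is not summable is 0, whereas the
    eigenvalue equation gives a positive value; summability follows.\<close>
  have summ: "?w summable_on (f -` {\<gamma>})" if "transfer f \<phi> h \<gamma> = lam * h \<gamma>" for \<gamma>
  proof (rule ccontr)
    assume "\<not> ?thesis"
    then have "transfer f \<phi> h \<gamma> = 0" unfolding transfer_def by (rule infsum_not_exists)
    then show False using that lam_pos h_pos[of \<gamma>] by simp
  qed
  have ge: "AE \<gamma> in \<nu>. 0 \<le> lam * h \<gamma> - branch_sum h \<gamma>"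
    using transfer_h
  proof eventually_elim
    case (elim \<gamma>)
    have "sum ?w ((\<lambda>i. s i \<gamma>) ` {..<d}) \<le> infsum ?w (f -` {\<gamma>})"
      using summ[OF elim] sub by (intro finite_sum_le_infsum) (auto intro!: mult_nonneg_nonneg)
    then show ?case using elim by (simp add: bs transfer_def)
  qed
  have int: "integrable \<nu> (\<lambda>\<gamma>. lam * h \<gamma> - branch_sum h \<gamma>)"
    using integral_branch_sum(1)[OF h_measurable integrable_h] integrable_h by auto
  \<comment> \<open>A nonnegative function with integral 0 vanishes a.e.; duality supplies the
    integral.\<close>
  have "(LINT \<gamma>|\<nu>. lam * h \<gamma> - branch_sum h \<gamma>) = 0"
    using integral_branch_sum[OF h_measurable integrable_h] integrable_h by simp
  then have "AE \<gamma> in \<nu>. lam * h \<gamma> - branch_sum h \<gamma> = 0"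
    using integral_nonneg_eq_0_iff_AE[OF int ge] by simp
  then show hs: "AE \<gamma> in \<nu>. branch_sum h \<gamma> = lam * h \<gamma>"
    by eventually_elim simp
  show "AE \<gamma> in \<nu>. f -` {\<gamma>} = (\<lambda>i. s i \<gamma>) ` {..<d}"
    using hs transfer_h
  proof eventually_elim
    case (elim \<gamma>)
    \<comment> \<open>A further preimage would add a strictly positive weight to a sum that is
      already exhausted.\<close>
    have False if y: "y \<in> f -` {\<gamma>}" "y \<notin> (\<lambda>i. s i \<gamma>) ` {..<d}" for y
    proof -
      have "sum ?w (insert y ((\<lambda>i. s i \<gamma>) ` {..<d})) \<le> infsum ?w (f -` {\<gamma>})"
        using summ[OF elim(2)] sub y by (intro finite_sum_le_infsum) (auto intro!: mult_nonneg_nonneg)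
      then have "?w y + branch_sum h \<gamma> \<le> transfer f \<phi> h \<gamma>"
        using y by (simp add: bs transfer_def)
      moreover have "0 < ?w y" by simp
      ultimately show False using elim by linarith
    qed
    then show ?case using sub by blast
  qed
qed

text \<open>The exceptional set comes from the preimages alone, so it serves all g at once.\<close>

lemma AE_transfer: "AE \<gamma> in \<nu>. \<forall>g. transfer f \<phi> g \<gamma> = branch_sum g \<gamma>"
  using AE_preimages
  by eventually_elim (simp add: transfer_def branch_sum_def sum.reindex[OF s_inj])

end

section \<open>The transfer operator of the skew product as a push-forward\<close>

locale skew_branches = conformal_branches f \<phi> h m \<nu> lam d Q
  for f :: "'m::polish_space \<Rightarrow> 'm" and \<phi> h m \<nu> lam d Q +
  fixes G :: "'m \<times> 'k::polish_space \<Rightarrow> 'k"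
  assumes G_measurable [measurable]: "G \<in> borel_measurable borel"
begin

abbreviation F :: "'m \<times> 'k \<Rightarrow> 'm \<times> 'k" where "F \<equiv> skew_product f G"

lemma F_measurable [measurable]: "F \<in> borel_measurable borel"
proof -
  have [measurable]: "G \<in> borel_measurable (borel \<Otimes>\<^sub>M borel)" using G_measurable by (simp add: borel_prod)
  have "(\<lambda>z. (f (fst z), G z)) \<in> measurable (borel \<Otimes>\<^sub>M borel) (borel \<Otimes>\<^sub>M borel)" by measurable
  then show ?thesis by (simp add: borel_prod skew_product_def[abs_def])
qed

lemma G_section [measurable]: "(\<lambda>y. G (\<gamma>, y)) \<in> borel_measurable borel"
proof -
  have [measurable]: "G \<in> borel_measurable (borel \<Otimes>\<^sub>M borel)" using G_measurable by (simp add: borel_prod)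
  show ?thesis by measurable
qed

text \<open>The right-hand side of the defining property in \<open>skew_transfer\<close>, without
  the normalisation by \<lambda>.\<close>

definition pull :: "('m \<Rightarrow> 'k signed_measure) \<Rightarrow> 'm \<Rightarrow> 'k signed_measure" where
  "pull r \<gamma> = (1 / h \<gamma>) *\<^sub>R (\<Sum>i<d. (h (s i \<gamma>) * exp (\<phi> (s i \<gamma>))) *\<^sub>R
     push_signed (\<lambda>y. G (s i \<gamma>, y)) (r (s i \<gamma>)))"

lemma sm_val_sum: "sm_val (\<Sum>i\<in>I. \<mu> i) A = (\<Sum>i\<in>I. sm_val (\<mu> i) A)"
  by (induction I rule: infinite_finite_induct) auto

lemma sm_val_pull:
  "A \<in> sets borel \<Longrightarrow> sm_val (pull r \<gamma>) A =
    branch_sum (\<lambda>x. h x * sm_val (r x) ((\<lambda>y. G (x, y)) -` A)) \<gamma> / h \<gamma>"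
  by (simp add: pull_def sm_val_sum sm_val_push branch_sum_def mult_ac sum_divide_distrib)

text \<open>Integrating a slice of E against \<open>pull r\<close> gives a branch sum, which duality
  evaluates as \<lambda> times the integral of r over the slices of the preimage of E under
  F.\<close>

lemma fibre_version_push:
  fixes \<mu> :: "('m \<times> 'k) signed_measure"
  assumes r: "fibre_version m \<mu> r"
  shows "fibre_version m (lam *\<^sub>R push_signed F \<mu>) (pull r)"
proof -
  obtain D where D: "integrable m D" "\<And>\<gamma> A. \<bar>sm_val (r \<gamma>) A\<bar> \<le> D \<gamma>"
    using r by (auto simp: fibre_version_def)
  have Dm [measurable]: "D \<in> borel_measurable borel"
    using borel_measurable_integrable[OF D(1)] by (simp add: measurable_cong_sets[OF sets_m refl])
  have D0: "0 \<le> D \<gamma>" for \<gamma> using D(2)[of \<gamma> "{}"] by simp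
  \<comment> \<open>The integrable bound is transported by the operator itself, and duality keeps it
    integrable.\<close>
  define D' where "D' \<gamma> = branch_sum (\<lambda>x. h x * D x) \<gamma> / h \<gamma>" for \<gamma>
  have [measurable]: "D' \<in> borel_measurable borel" unfolding D'_def[abs_def] by measurable
  have "integrable m D'"
  proof (subst integrable_m_iff)
    show "integrable \<nu> (\<lambda>x. h x * D' x)"
      using integral_branch_sum(1)[of "\<lambda>x. h x * D x"] D(1)
      by (simp add: D'_def integrable_m_iff cong: integrable_cong)
  qed measurable
  moreover have "\<bar>sm_val (pull r \<gamma>) A\<bar> \<le> D' \<gamma>" for \<gamma> A
  proof (cases "A \<in> sets borel")
    case True
    have "\<bar>branch_sum (\<lambda>x. h x * sm_val (r x) ((\<lambda>y. G (x, y)) -` A)) \<gamma>\<bar> \<le> branch_sum (\<lambda>x. h x * D x) \<gamma>"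
      unfolding branch_sum_def
      by (intro order_trans[OF sum_abs] sum_mono) (auto simp: abs_mult intro!: mult_mono D)
    then show ?thesis
      using h_pos[of \<gamma>] by (simp add: sm_val_pull[OF True] D'_def divide_right_mono)
  next
    case False
    then show ?thesis using D0 by (auto simp: sm_val_notin D'_def branch_sum_def intro!: divide_nonneg_nonneg sum_nonneg mult_nonneg_nonneg)
  qed
  moreover have "(\<lambda>\<gamma>. sm_val (pull r \<gamma>) (Pair \<gamma> -` E)) \<in> borel_measurable borel \<and>
      (LINT \<gamma>|m. sm_val (pull r \<gamma>) (Pair \<gamma> -` E)) = lam * sm_val \<mu> (F -` E)" if E: "E \<in> sets borel" for E
  proof -
    have FE: "F -` E \<in> sets borel" by (rule vimage_borel[OF F_measurable E])
    define H where "H x = sm_val (r x) (Pair x -` (F -` E))" for x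
    have [measurable]: "H \<in> borel_measurable borel"
      using r FE unfolding fibre_version_def H_def[abs_def] by blast
    have Hi: "integrable \<nu> (\<lambda>x. h x * H x)"
      using fibre_version_integrable[OF r FE] by (simp add: integrable_m_iff flip: H_def)
    have eq: "sm_val (pull r \<gamma>) (Pair \<gamma> -` E) = branch_sum (\<lambda>x. h x * H x) \<gamma> / h \<gamma>" for \<gamma>
    proof -
      \<comment> \<open>Since f maps \<gamma>_i to \<gamma>, the fibre map over \<gamma>_i pulls the
        slice of E at \<gamma> back to the slice at \<gamma>_i of its preimage under F.\<close>
      have "(\<lambda>y. G (s i \<gamma>, y)) -` (Pair \<gamma> -` E) = Pair (s i \<gamma>) -` (F -` E)" if "i < d" for i
        using that by (auto simp: skew_product_def)
      then show ?thesis
        unfolding sm_val_pull[OF Pair_vimage_borel[OF E]] branch_sum_def H_def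
        by (intro arg_cong2[of _ _ _ _ "(/)"] sum.cong refl) simp
    qed
    have "(LINT \<gamma>|m. sm_val (pull r \<gamma>) (Pair \<gamma> -` E)) = (LINT \<gamma>|\<nu>. branch_sum (\<lambda>x. h x * H x) \<gamma>)"
      unfolding eq by (subst integral_m) simp_all
    also have "\<dots> = lam * (LINT x|\<nu>. h x * H x)"
      by (rule integral_branch_sum(2)[OF _ Hi]) measurable
    also have "(LINT x|\<nu>. h x * H x) = (LINT x|m. H x)"
      by (subst integral_m) simp_all
    also have "\<dots> = sm_val \<mu> (F -` E)"
      unfolding H_def by (rule fibre_version_eq[OF r FE])
    finally have "(LINT \<gamma>|m. sm_val (pull r \<gamma>) (Pair \<gamma> -` E)) = lam * sm_val \<mu> (F -` E)" .
    moreover have "(\<lambda>\<gamma>. sm_val (pull r \<gamma>) (Pair \<gamma> -` E)) \<in> borel_measurable borel"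
      unfolding eq by measurable
    ultimately show ?thesis by blast
  qed
  ultimately show ?thesis
    unfolding fibre_version_def by (auto simp: sm_val_push[OF F_measurable])
qed

lemma AE_pull_cong:
  assumes "AE \<gamma> in m. r \<gamma> = r' \<gamma>"
  shows "AE \<gamma> in m. pull r \<gamma> = pull r' \<gamma>"
proof -
  have "AE \<gamma> in m. \<forall>i\<in>{..<d}. r (s i \<gamma>) = r' (s i \<gamma>)"
    using assms AE_s[where P = "\<lambda>x. r x = r' x"] by (subst AE_finite_all) (simp_all add: AE_m_iff)
  then show ?thesis by eventually_elim (simp add: pull_def)
qed

text \<open>The description is justified in two parts: the push-forward has the required restriction
  for every version of \<mu>, and a signed measure is determined by any one of its versions.\<close>

lemma skew_transfer_eq:
  fixes \<mu> :: "('m \<times> 'k) signed_measure"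
  assumes "\<mu> \<in> AB m"
  shows "skew_transfer f G \<phi> h m d Q \<mu> = lam *\<^sub>R push_signed F \<mu>"
proof -
  obtain r0 where r0: "fibre_version m \<mu> r0" using AB_ex_fibre_version[OF assms] by blast
  note p0 = fibre_version_push[OF r0]
  show ?thesis
    unfolding skew_transfer_def Let_def pull_def[symmetric]
  proof (rule the_equality, intro conjI allI impI)
    show "lam *\<^sub>R push_signed F \<mu> \<in> AB m" by (rule fibre_version_AB[OF p0])
    fix r assume "fibre_restriction m \<mu> r"
    then have "AE \<gamma> in m. r \<gamma> = r0 \<gamma>" by (simp add: fibre_restriction_iff[OF r0])
    then show "fibre_restriction m (lam *\<^sub>R push_signed F \<mu>) (pull r)"
      unfolding fibre_restriction_iff[OF p0] by (rule AE_pull_cong)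
  next
    fix \<eta> assume \<eta>: "\<eta> \<in> AB m \<and> (\<forall>r. fibre_restriction m \<mu> r \<longrightarrow> fibre_restriction m \<eta> (pull r))"
    have "fibre_restriction m \<mu> r0" by (simp add: fibre_restriction_iff[OF r0])
    with \<eta> have "fibre_restriction m \<eta> (pull r0)" by blast
    then obtain t where t: "fibre_version m \<eta> t" "AE \<gamma> in m. pull r0 \<gamma> = t \<gamma>"
      using fibre_restriction_version by blast
    then show "\<eta> = lam *\<^sub>R push_signed F \<mu>"
      by (intro fibre_version_determines[OF t(1) p0]) (auto elim!: eventually_mono)
  qed
qed

end

section \<open>Spectral gap and decay of correlations\<close>

locale skew_setting = skew_branches f \<phi> h m \<nu> lam d Q G
  for f :: "'m::polish_space \<Rightarrow> 'm" and \<phi> h m \<nu> lam d Q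
    and G :: "'m \<times> 'k::polish_space \<Rightarrow> 'k" +
  fixes Bs Bw :: "('m \<Rightarrow> real) set" and Ns Nw :: "('m \<Rightarrow> real) \<Rightarrow> real"
    and \<mu>\<^sub>0 :: "('m \<times> 'k) measure" and No :: "'k signed_measure \<Rightarrow> real"
  assumes base_gap: "base_spectral_gap f \<phi> h \<nu> lam Bs Ns Bw Nw"
    and inv: "invariant_prob F \<mu>\<^sub>0" and marg_\<mu>\<^sub>0: "distr \<mu>\<^sub>0 borel fst = m"
    and norm_o: "is_norm No"
    and contraction: "fibre_contraction G \<nu> No"
    and weak_norm: "weak_norm_bounds No m \<nu> Bw Nw"
    and normalized: "normalized_on_probs No"
begin

abbreviation "S \<equiv> S_inf No m Bs"
abbreviation "nS \<equiv> S_inf_norm No m Ns"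
abbreviation dens :: "('m \<times> 'k) signed_measure \<Rightarrow> 'm \<Rightarrow> real" where "dens \<equiv> marginal_density m"
abbreviation T :: "('m \<times> 'k) signed_measure \<Rightarrow> ('m \<times> 'k) signed_measure" where "T \<equiv> push_signed F"

definition fsup :: "('m \<times> 'k) signed_measure \<Rightarrow> real" where
  "fsup \<mu> = real_of_ereal (fibre_sup_norm No m \<mu>)"

lemma nS_eq: "nS \<mu> = Ns (dens \<mu>) + fsup \<mu>"
  by (simp add: S_inf_norm_def fsup_def)

section \<open>The strong space of functions on the base\<close>

lemma Bs_space: "normed_function_space \<nu> Bs Ns"
  using base_gap unfolding base_spectral_gap_def by blast

lemma Bs_cong: "g \<in> Bs \<Longrightarrow> AE x in \<nu>. g x = k x \<Longrightarrow> k \<in> Bs"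
  and Bs_add: "g \<in> Bs \<Longrightarrow> k \<in> Bs \<Longrightarrow> (\<lambda>x. g x + k x) \<in> Bs"
  and Ns_add: "g \<in> Bs \<Longrightarrow> k \<in> Bs \<Longrightarrow> Ns (\<lambda>x. g x + k x) \<le> Ns g + Ns k"
  and Bs_scale: "g \<in> Bs \<Longrightarrow> (\<lambda>x. c * g x) \<in> Bs"
  and Ns_scale: "g \<in> Bs \<Longrightarrow> Ns (\<lambda>x. c * g x) = \<bar>c\<bar> * Ns g"
  and Ns_nonneg: "g \<in> Bs \<Longrightarrow> 0 \<le> Ns g"
  and Ns_eq_0: "g \<in> Bs \<Longrightarrow> Ns g = 0 \<longleftrightarrow> (AE x in \<nu>. g x = 0)"
  and Bs_mult: "g \<in> Bs \<Longrightarrow> \<exists>C. \<forall>k\<in>Bs. (\<lambda>x. g x * k x) \<in> Bs \<and> Ns (\<lambda>x. g x * k x) \<le> C * Ns k"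
  using Bs_space unfolding normed_function_space_def by blast+

text \<open>\<open>Ns\<close> acts on representatives, and its invariance under a.e. equality is not
  part of the axioms: it follows from the triangle inequality, as the difference has norm 0.\<close>

lemma Ns_cong_le:
  assumes g: "g \<in> Bs" and ae: "AE x in \<nu>. g x = k x"
  shows "Ns k \<le> Ns g"
proof -
  have k: "k \<in> Bs" by (rule Bs_cong[OF g ae])
  have e: "(\<lambda>x. k x + (-1) * g x) \<in> Bs" by (intro Bs_add k Bs_scale g)
  have "Ns (\<lambda>x. k x + (-1) * g x) = 0"
    unfolding Ns_eq_0[OF e] using ae by eventually_elim simp
  then show ?thesis using Ns_add[OF g e] by simp
qed

lemma Ns_cong: "g \<in> Bs \<Longrightarrow> AE x in \<nu>. g x = k x \<Longrightarrow> Ns g = Ns k"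
  by (rule antisym) (auto intro!: Ns_cong_le intro: Bs_cong elim: eventually_mono)

lemma h_Bs: "h \<in> Bs" and inv_h_Bs: "(\<lambda>x. 1 / h x) \<in> Bs"
  using base_gap unfolding base_spectral_gap_def by blast+

lemma h_mult_bound: "\<exists>C\<ge>0. \<forall>k\<in>Bs. (\<lambda>x. h x * k x) \<in> Bs \<and> Ns (\<lambda>x. h x * k x) \<le> C * Ns k"
  and inv_h_mult_bound: "\<exists>C\<ge>0. \<forall>k\<in>Bs. (\<lambda>x. k x / h x) \<in> Bs \<and> Ns (\<lambda>x. k x / h x) \<le> C * Ns k"
proof -
  have *: "\<exists>C\<ge>0. \<forall>k\<in>Bs. (\<lambda>x. g x * k x) \<in> Bs \<and> Ns (\<lambda>x. g x * k x) \<le> C * Ns k" if g: "g \<in> Bs" for g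
  proof -
    obtain C where C: "\<forall>k\<in>Bs. (\<lambda>x. g x * k x) \<in> Bs \<and> Ns (\<lambda>x. g x * k x) \<le> C * Ns k"
      using Bs_mult[OF g] by blast
    have "C * Ns k \<le> max 0 C * Ns k" if "k \<in> Bs" for k
      using Ns_nonneg[OF that] by (intro mult_right_mono) auto
    with C show ?thesis by (intro exI[of _ "max 0 C"]) (auto intro: order_trans)
  qed
  show "\<exists>C\<ge>0. \<forall>k\<in>Bs. (\<lambda>x. h x * k x) \<in> Bs \<and> Ns (\<lambda>x. h x * k x) \<le> C * Ns k"
    by (rule *[OF h_Bs])
  show "\<exists>C\<ge>0. \<forall>k\<in>Bs. (\<lambda>x. k x / h x) \<in> Bs \<and> Ns (\<lambda>x. k x / h x) \<le> C * Ns k"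
    using *[OF inv_h_Bs] by simp
qed

lemma one_Bs: "(\<lambda>x. 1) \<in> Bs"
proof -
  obtain C where "\<forall>k\<in>Bs. (\<lambda>x. k x / h x) \<in> Bs \<and> Ns (\<lambda>x. k x / h x) \<le> C * Ns k"
    using inv_h_mult_bound by blast
  then have "(\<lambda>x. h x / h x) \<in> Bs" using h_Bs by blast
  then show ?thesis by simp
qed

lemma No_nonneg: "0 \<le> No \<mu>" and No_eq_0: "No \<mu> = 0 \<longleftrightarrow> \<mu> = 0"
  and No_add: "No (\<mu> + \<eta>) \<le> No \<mu> + No \<eta>" and No_scale: "No (c *\<^sub>R \<mu>) = \<bar>c\<bar> * No \<mu>"
  using norm_o unfolding is_norm_def by blast+

lemma No_sum: "No (\<Sum>i\<in>I. \<mu> i) \<le> (\<Sum>i\<in>I. No (\<mu> i))"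
proof (induction I rule: infinite_finite_induct)
  case (insert x I)
  then show ?case using No_add[of "\<mu> x" "sum \<mu> I"] by simp
qed (use No_eq_0[of 0] in simp_all)

lemma L_infI:
  assumes r: "fibre_version m \<mu> r" and C: "AE \<gamma> in m. No (r \<gamma>) \<le> C"
  shows "\<mu> \<in> L_inf No m" "fsup \<mu> \<le> C"
proof -
  have le: "fibre_sup_norm No m \<mu> \<le> ereal C"
    unfolding fibre_sup_norm_version[OF r] using C by (intro ess_sup_le) simp
  then show "\<mu> \<in> L_inf No m"
    unfolding L_inf_def using fibre_version_AB[OF r] by (auto simp: less_top[symmetric])
  \<comment> \<open>If the essential supremum were minus infinity, \<open>real_of_ereal\<close>
    would return 0, so C has to be nonnegative.\<close>
  have "AE \<gamma> in m. 0 \<le> C"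
    using C by eventually_elim (use No_nonneg in \<open>auto intro: order_trans\<close>)
  then have "0 \<le> C" by (simp add: m.AE_const)
  then show "fsup \<mu> \<le> C" unfolding fsup_def using le
    by (cases "fibre_sup_norm No m \<mu>") auto
qed

text \<open>The essential supremum of a nonnegative function for a probability is not minus
  infinity, so \<open>real_of_ereal\<close> loses nothing on this space.\<close>

lemma fibre_sup_norm_fsup:
  assumes \<mu>: "\<mu> \<in> L_inf No m"
  shows "fibre_sup_norm No m \<mu> = ereal (fsup \<mu>)" "0 \<le> fsup \<mu>"
proof -
  obtain r where r: "fibre_version m \<mu> r"
    using AB_ex_fibre_version[of \<mu>] \<mu> by (auto simp: L_inf_def)
  have "AE \<gamma> in m. 0 \<le> ess_sup m (\<lambda>\<gamma>. No (r \<gamma>))"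
    using AE_le_ess_sup[of "\<lambda>\<gamma>. No (r \<gamma>)" m]
  proof eventually_elim
    case (elim \<gamma>)
    have "0 \<le> ereal (No (r \<gamma>))" by (simp add: No_nonneg)
    from order_trans[OF this elim] show ?case .
  qed
  then have "0 \<le> fibre_sup_norm No m \<mu>"
    by (simp add: m.AE_const fibre_sup_norm_version[OF r])
  moreover have "fibre_sup_norm No m \<mu> < \<infinity>" using \<mu> by (simp add: L_inf_def)
  ultimately show "fibre_sup_norm No m \<mu> = ereal (fsup \<mu>)" "0 \<le> fsup \<mu>"
    unfolding fsup_def by (cases "fibre_sup_norm No m \<mu>"; simp)+
qed

lemma AE_le_fsup:
  assumes \<mu>: "\<mu> \<in> L_inf No m" and r: "fibre_version m \<mu> r"
  shows "AE \<gamma> in m. No (r \<gamma>) \<le> fsup \<mu>"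
  using AE_le_ess_sup[of "\<lambda>\<gamma>. No (r \<gamma>)" m] fibre_sup_norm_fsup(1)[OF \<mu>]
  by (simp add: fibre_sup_norm_version[OF r])

section \<open>The space \<open>S\<close> as a normed space\<close>

lemma S_iff: "\<mu> \<in> S \<longleftrightarrow> \<mu> \<in> L_inf No m \<and> dens \<mu> \<in> Bs"
  by (simp add: S_inf_def)

lemma S_AB: "\<mu> \<in> S \<Longrightarrow> \<mu> \<in> AB m"
  by (simp add: S_iff L_inf_def)

lemma S_version:
  assumes "\<mu> \<in> S"
  obtains r where "fibre_version m \<mu> r" "AE \<gamma> in m. No (r \<gamma>) \<le> fsup \<mu>"
    "AE \<gamma> in m. dens \<mu> \<gamma> = sm_val (r \<gamma>) UNIV"
proof -
  obtain r where r: "fibre_version m \<mu> r"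
    using AB_ex_fibre_version[OF S_AB[OF assms]] by blast
  show ?thesis
    by (rule that[OF r]) (use assms r AE_le_fsup marginal_density_version in \<open>auto simp: S_iff\<close>)
qed

lemma dens_eqI:
  assumes "fibre_version m \<mu> r" "AE \<gamma> in m. sm_val (r \<gamma>) UNIV = g \<gamma>"
  shows "AE \<gamma> in \<nu>. dens \<mu> \<gamma> = g \<gamma>"
  unfolding AE_m_iff[symmetric]
  using marginal_density_version[OF assms(1)] assms(2) by eventually_elim simp

text \<open>Membership, both parts of the norm and the density are all obtained from one version;
  sums, multiples and images are treated through this rule.\<close>

lemma S_I:
  assumes r: "fibre_version m \<mu> r" and C: "AE \<gamma> in m. No (r \<gamma>) \<le> C"
    and g: "g \<in> Bs" "AE \<gamma> in m. sm_val (r \<gamma>) UNIV = g \<gamma>"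
  shows "\<mu> \<in> S" "fsup \<mu> \<le> C" "AE \<gamma> in \<nu>. dens \<mu> \<gamma> = g \<gamma>" "Ns (dens \<mu>) = Ns g"
proof -
  show e: "AE \<gamma> in \<nu>. dens \<mu> \<gamma> = g \<gamma>" by (rule dens_eqI[OF r g(2)])
  then have e': "AE \<gamma> in \<nu>. g \<gamma> = dens \<mu> \<gamma>" by eventually_elim simp
  show "\<mu> \<in> S" using L_infI(1)[OF r C] Bs_cong[OF g(1) e'] by (simp add: S_iff)
  show "Ns (dens \<mu>) = Ns g" by (rule Ns_cong[OF g(1) e', symmetric])
  show "fsup \<mu> \<le> C" by (rule L_infI(2)[OF r C])
qed

lemma S_add:
  assumes "\<mu> \<in> S" "\<eta> \<in> S"
  shows "\<mu> + \<eta> \<in> S" "fsup (\<mu> + \<eta>) \<le> fsup \<mu> + fsup \<eta>" 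
    "AE \<gamma> in \<nu>. dens (\<mu> + \<eta>) \<gamma> = dens \<mu> \<gamma> + dens \<eta> \<gamma>"
    "nS (\<mu> + \<eta>) \<le> nS \<mu> + nS \<eta>"
proof -
  obtain r where r: "fibre_version m \<mu> r" "AE \<gamma> in m. No (r \<gamma>) \<le> fsup \<mu>"
    "AE \<gamma> in m. dens \<mu> \<gamma> = sm_val (r \<gamma>) UNIV" using S_version[OF assms(1)] by blast
  obtain t where t: "fibre_version m \<eta> t" "AE \<gamma> in m. No (t \<gamma>) \<le> fsup \<eta>"
    "AE \<gamma> in m. dens \<eta> \<gamma> = sm_val (t \<gamma>) UNIV" using S_version[OF assms(2)] by blast
  have B: "dens \<mu> \<in> Bs" "dens \<eta> \<in> Bs" using assms by (auto simp: S_iff)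
  have 1: "AE \<gamma> in m. No (r \<gamma> + t \<gamma>) \<le> fsup \<mu> + fsup \<eta>"
    using r(2) t(2) by eventually_elim (auto intro: order_trans[OF No_add] add_mono)
  have 2: "AE \<gamma> in m. sm_val (r \<gamma> + t \<gamma>) UNIV = dens \<mu> \<gamma> + dens \<eta> \<gamma>"
    using r(3) t(3) by eventually_elim simp
  note * = S_I[OF fibre_version_add[OF r(1) t(1)] 1 Bs_add[OF B] 2]
  show "\<mu> + \<eta> \<in> S" "fsup (\<mu> + \<eta>) \<le> fsup \<mu> + fsup \<eta>" 
    "AE \<gamma> in \<nu>. dens (\<mu> + \<eta>) \<gamma> = dens \<mu> \<gamma> + dens \<eta> \<gamma>" by fact+
  show "nS (\<mu> + \<eta>) \<le> nS \<mu> + nS \<eta>"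
    using *(2,4) Ns_add[OF B] by (simp add: nS_eq)
qed

lemma S_scale:
  assumes "\<mu> \<in> S"
  shows "c *\<^sub>R \<mu> \<in> S" "AE \<gamma> in \<nu>. dens (c *\<^sub>R \<mu>) \<gamma> = c * dens \<mu> \<gamma>"
    "nS (c *\<^sub>R \<mu>) \<le> \<bar>c\<bar> * nS \<mu>"
proof -
  obtain r where r: "fibre_version m \<mu> r" "AE \<gamma> in m. No (r \<gamma>) \<le> fsup \<mu>"
    "AE \<gamma> in m. dens \<mu> \<gamma> = sm_val (r \<gamma>) UNIV" using S_version[OF assms(1)] by blast
  have B: "dens \<mu> \<in> Bs" using assms by (auto simp: S_iff)
  have 1: "AE \<gamma> in m. No (c *\<^sub>R r \<gamma>) \<le> \<bar>c\<bar> * fsup \<mu>"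
    using r(2) by eventually_elim (auto simp: No_scale intro: mult_left_mono)
  have 2: "AE \<gamma> in m. sm_val (c *\<^sub>R r \<gamma>) UNIV = c * dens \<mu> \<gamma>"
    using r(3) by eventually_elim simp
  note * = S_I[OF fibre_version_scaleR[OF r(1)] 1 Bs_scale[OF B] 2]
  show "c *\<^sub>R \<mu> \<in> S" "AE \<gamma> in \<nu>. dens (c *\<^sub>R \<mu>) \<gamma> = c * dens \<mu> \<gamma>" by fact+
  show "nS (c *\<^sub>R \<mu>) \<le> \<bar>c\<bar> * nS \<mu>"
    using *(2,4) Ns_scale[OF B, of c] by (simp add: nS_eq distrib_left)
qed

lemma S_diff_scale:
  assumes "\<mu> \<in> S" "\<eta> \<in> S"
  shows "\<mu> - c *\<^sub>R \<eta> \<in> S" "AE \<gamma> in \<nu>. dens (\<mu> - c *\<^sub>R \<eta>) \<gamma> = dens \<mu> \<gamma> - c * dens \<eta> \<gamma>"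
    "nS (\<mu> - c *\<^sub>R \<eta>) \<le> nS \<mu> + \<bar>c\<bar> * nS \<eta>"
proof -
  have e: "\<mu> - c *\<^sub>R \<eta> = \<mu> + (- c) *\<^sub>R \<eta>" by simp
  note a = S_add[OF assms(1) S_scale(1)[OF assms(2), of "- c"]] and b = S_scale[OF assms(2), of "- c"]
  show "\<mu> - c *\<^sub>R \<eta> \<in> S" unfolding e by fact
  show "AE \<gamma> in \<nu>. dens (\<mu> - c *\<^sub>R \<eta>) \<gamma> = dens \<mu> \<gamma> - c * dens \<eta> \<gamma>"
    unfolding e using a(3) b(2) by eventually_elim simp
  show "nS (\<mu> - c *\<^sub>R \<eta>) \<le> nS \<mu> + \<bar>c\<bar> * nS \<eta>"
    unfolding e using a(4) b(3) by simp
qed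

lemma S_nonneg:
  assumes "\<mu> \<in> S" shows "0 \<le> Ns (dens \<mu>)" "0 \<le> fsup \<mu>" "0 \<le> nS \<mu>"
proof -
  show "0 \<le> Ns (dens \<mu>)" "0 \<le> fsup \<mu>"
    using assms Ns_nonneg fibre_sup_norm_fsup(2) by (auto simp: S_iff)
  then show "0 \<le> nS \<mu>" by (simp add: nS_eq)
qed

text \<open>The chain sup norm <= weak norm <= strong norm. It turns the mass term of the fibre
  contraction into a quantity controlled on the base.\<close>

lemma AE_dens_le:
  assumes \<mu>: "\<mu> \<in> S"
  shows "AE \<gamma> in \<nu>. \<bar>dens \<mu> \<gamma>\<bar> \<le> Ns (dens \<mu>)"
proof -
  have "Nw (dens \<mu>) \<le> Ns (dens \<mu>)"
    using base_gap \<mu> by (auto simp: base_spectral_gap_def S_iff)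
  moreover have "ess_sup \<nu> (\<lambda>x. \<bar>dens \<mu> x\<bar>) \<le> ereal (Nw (dens \<mu>))"
    using weak_norm \<mu> by (auto simp: weak_norm_bounds_def S_iff)
  ultimately have le: "ess_sup \<nu> (\<lambda>x. \<bar>dens \<mu> x\<bar>) \<le> ereal (Ns (dens \<mu>))"
    by (meson ereal_less_eq(3) order_trans)
  show ?thesis
    using AE_le_ess_sup[of "\<lambda>x. \<bar>dens \<mu> x\<bar>" \<nu>]
  proof eventually_elim
    case (elim x)
    from order_trans[OF elim le] show ?case by simp
  qed
qed

text \<open>The mass is the integral of the density against the probability m. Its continuity in the
  strong norm later identifies the coefficient of the projection.\<close>

lemma mass_le:
  assumes \<mu>: "\<mu> \<in> S"
  shows "\<bar>sm_val \<mu> UNIV\<bar> \<le> Ns (dens \<mu>)"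
proof -
  obtain r where r: "fibre_version m \<mu> r" "AE \<gamma> in m. dens \<mu> \<gamma> = sm_val (r \<gamma>) UNIV"
    using S_version[OF \<mu>] by blast
  have i: "integrable m (\<lambda>\<gamma>. sm_val (r \<gamma>) UNIV)" by (rule fibre_version_integrable_Times[OF r(1)]) simp
  have "AE \<gamma> in m. \<bar>sm_val (r \<gamma>) UNIV\<bar> \<le> Ns (dens \<mu>)"
    using r(2) AE_dens_le[OF \<mu>, folded AE_m_iff] by eventually_elim simp
  then have "(LINT \<gamma>|m. \<bar>sm_val (r \<gamma>) UNIV\<bar>) \<le> (LINT \<gamma>|m. Ns (dens \<mu>))"
    using i by (intro integral_mono_AE) auto
  then have "(LINT \<gamma>|m. \<bar>sm_val (r \<gamma>) UNIV\<bar>) \<le> Ns (dens \<mu>)"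
    by (simp add: m.prob_space[unfolded space_m])
  moreover have "sm_val \<mu> UNIV = (LINT \<gamma>|m. sm_val (r \<gamma>) UNIV)"
    using fibre_version_eq[OF r(1), of UNIV] by simp
  ultimately show ?thesis
    using integral_abs_bound[of m "\<lambda>\<gamma>. sm_val (r \<gamma>) UNIV"] by linarith
qed

lemma mass_le_nS: "\<mu> \<in> S \<Longrightarrow> \<bar>sm_val \<mu> UNIV\<bar> \<le> nS \<mu>"
  using mass_le[of \<mu>] S_nonneg[of \<mu>] by (simp add: nS_eq)

section \<open>The push-forward on \<open>S\<close>\<close>

lemma fibre_version_T:
  assumes r: "fibre_version m \<mu> r"
  shows "fibre_version m (T \<mu>) (\<lambda>\<gamma>. (1 / lam) *\<^sub>R pull r \<gamma>)"
  using fibre_version_scaleR[OF fibre_version_push[OF r], of "1 / lam"] lam_pos by simp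

lemma transfer_Bs: "g \<in> Bs \<Longrightarrow> transfer f \<phi> g \<in> Bs"
  using base_gap unfolding base_spectral_gap_def by blast

text \<open>On fibres the normalised operator is a.e. a convex combination of fibre images, so the
  contraction passes to the supremum norm. On marginal densities it is the base operator conjugated
  by h.\<close>

lemma S_T:
  assumes \<alpha>: "0 \<le> \<alpha>" "AE \<gamma> in \<nu>. \<forall>\<mu>. No (push_signed (\<lambda>y. G (\<gamma>, y)) \<mu>) \<le> \<alpha> * No \<mu> + \<bar>sm_val \<mu> UNIV\<bar>"
    and \<mu>: "\<mu> \<in> S"
  shows "T \<mu> \<in> S" "fsup (T \<mu>) \<le> \<alpha> * fsup \<mu> + Ns (dens \<mu>)"
    "AE \<gamma> in \<nu>. h \<gamma> * dens (T \<mu>) \<gamma> = transfer f \<phi> (\<lambda>x. h x * dens \<mu> x) \<gamma> / lam"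
proof -
  obtain r where r: "fibre_version m \<mu> r" "AE \<gamma> in m. No (r \<gamma>) \<le> fsup \<mu>"
    "AE \<gamma> in m. dens \<mu> \<gamma> = sm_val (r \<gamma>) UNIV" using S_version[OF \<mu>] by blast
  \<comment> \<open>Common bound for all fibre images: the mass of the restriction is the density,
    which the strong norm bounds.\<close>
  define K where "K = \<alpha> * fsup \<mu> + Ns (dens \<mu>)"
  have "AE x in \<nu>. No (push_signed (\<lambda>y. G (x, y)) (r x)) \<le> K"
    using \<alpha>(2) r(2,3)[unfolded AE_m_iff] AE_dens_le[OF \<mu>]
  proof eventually_elim
    case (elim x)
    have "No (push_signed (\<lambda>y. G (x, y)) (r x)) \<le> \<alpha> * No (r x) + \<bar>sm_val (r x) UNIV\<bar>"
      using elim(1) by blast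
    also have "\<dots> \<le> K"
      unfolding K_def using elim(2,3,4) \<alpha>(1) by (intro add_mono mult_left_mono) auto
    finally show ?case .
  qed
  then have "AE \<gamma> in \<nu>. \<forall>i\<in>{..<d}. No (push_signed (\<lambda>y. G (s i \<gamma>, y)) (r (s i \<gamma>))) \<le> K"
    using AE_s[where P = "\<lambda>x. No (push_signed (\<lambda>y. G (x, y)) (r x)) \<le> K"]
    by (subst AE_finite_all) simp_all
  then have 1: "AE \<gamma> in m. No ((1 / lam) *\<^sub>R pull r \<gamma>) \<le> K"
    unfolding AE_m_iff using AE_branch_sum_h
  proof eventually_elim
    case (elim \<gamma>)
    let ?w = "\<lambda>i. h (s i \<gamma>) * exp (\<phi> (s i \<gamma>))"
    let ?p = "\<lambda>i. push_signed (\<lambda>y. G (s i \<gamma>, y)) (r (s i \<gamma>))"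
    have "No (\<Sum>i<d. ?w i *\<^sub>R ?p i) \<le> (\<Sum>i<d. ?w i * No (?p i))"
      by (rule order_trans[OF No_sum]) (simp add: No_scale abs_mult)
    also have "\<dots> \<le> (\<Sum>i<d. ?w i * K)"
      using elim(1) by (intro sum_mono mult_left_mono) auto
    \<comment> \<open>The eigenvalue equation for h says that the weights, divided by \<lambda> h,
      sum to 1.\<close>
    also have "\<dots> = lam * h \<gamma> * K"
      using elim(2) by (simp add: branch_sum_def flip: sum_distrib_right)
    finally have *: "No (\<Sum>i<d. ?w i *\<^sub>R ?p i) \<le> lam * h \<gamma> * K" .
    have "No ((1 / lam) *\<^sub>R pull r \<gamma>) = (1 / (lam * h \<gamma>)) * No (\<Sum>i<d. ?w i *\<^sub>R ?p i)"
      using lam_pos h_pos[of \<gamma>] by (simp add: pull_def No_scale)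
    also have "\<dots> \<le> (1 / (lam * h \<gamma>)) * (lam * h \<gamma> * K)"
      using lam_pos h_pos[of \<gamma>] by (intro mult_left_mono *) auto
    also have "\<dots> = K" using lam_pos h_pos[of \<gamma>] by simp
    finally show ?case .
  qed
  have r3: "AE x in \<nu>. dens \<mu> x = sm_val (r x) UNIV"
    using r(3) by (simp add: AE_m_iff)
  then have "AE \<gamma> in \<nu>. \<forall>i\<in>{..<d}. dens \<mu> (s i \<gamma>) = sm_val (r (s i \<gamma>)) UNIV"
    using AE_s[where P = "\<lambda>x. dens \<mu> x = sm_val (r x) UNIV"]
    by (subst AE_finite_all) simp_all
  then have 2: "AE \<gamma> in m. sm_val ((1 / lam) *\<^sub>R pull r \<gamma>) UNIV =
      transfer f \<phi> (\<lambda>x. h x * dens \<mu> x) \<gamma> / lam / h \<gamma>"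
    unfolding AE_m_iff using AE_transfer
    by eventually_elim (simp add: sm_val_pull branch_sum_def)
  have hB: "(\<lambda>x. h x * dens \<mu> x) \<in> Bs"
    using h_mult_bound \<mu> by (auto simp: S_iff)
  have "(\<lambda>\<gamma>. transfer f \<phi> (\<lambda>x. h x * dens \<mu> x) \<gamma> / lam) \<in> Bs"
    using Bs_scale[OF transfer_Bs[OF hB], of "1 / lam"] by simp
  then have 3: "(\<lambda>\<gamma>. transfer f \<phi> (\<lambda>x. h x * dens \<mu> x) \<gamma> / lam / h \<gamma>) \<in> Bs"
    using inv_h_mult_bound by auto
  note * = S_I[OF fibre_version_T[OF r(1)] 1 3 2]
  show "T \<mu> \<in> S" "fsup (T \<mu>) \<le> \<alpha> * fsup \<mu> + Ns (dens \<mu>)" using * by (auto simp: K_def)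
  show "AE \<gamma> in \<nu>. h \<gamma> * dens (T \<mu>) \<gamma> = transfer f \<phi> (\<lambda>x. h x * dens \<mu> x) \<gamma> / lam"
    using *(3) by eventually_elim simp
qed

lemma ex_contraction: "\<exists>\<alpha>. 0 \<le> \<alpha> \<and> \<alpha> < 1 \<and>
    (AE \<gamma> in \<nu>. \<forall>\<mu>. No (push_signed (\<lambda>y. G (\<gamma>, y)) \<mu>) \<le> \<alpha> * No \<mu> + \<bar>sm_val \<mu> UNIV\<bar>)"
  using contraction unfolding fibre_contraction_def by blast

lemma T_S: "\<mu> \<in> S \<Longrightarrow> T \<mu> \<in> S"
  and dens_T: "\<mu> \<in> S \<Longrightarrow> AE \<gamma> in \<nu>. h \<gamma> * dens (T \<mu>) \<gamma> = transfer f \<phi> (\<lambda>x. h x * dens \<mu> x) \<gamma> / lam"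
  using ex_contraction S_T(1,3) by blast+

lemma Tn_S: "\<mu> \<in> S \<Longrightarrow> (T ^^ n) \<mu> \<in> S"
  by (induction n) (auto intro: T_S)

section \<open>The invariant measure as a fixed point in \<open>S\<close>\<close>

lemma prob_\<mu>\<^sub>0: "prob_space \<mu>\<^sub>0" and sets_\<mu>\<^sub>0 [simp, measurable_cong]: "sets \<mu>\<^sub>0 = sets borel"
  and distr_\<mu>\<^sub>0: "distr \<mu>\<^sub>0 borel F = \<mu>\<^sub>0"
  using inv by (auto simp: invariant_prob_def)

sublocale \<mu>0: prob_space \<mu>\<^sub>0 by (rule prob_\<mu>\<^sub>0)

definition \<sigma> :: "('m \<times> 'k) signed_measure" where "\<sigma> = signed_of \<mu>\<^sub>0"

lemma space_\<mu>\<^sub>0 [simp]: "space \<mu>\<^sub>0 = UNIV"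
  using sets_eq_imp_space_eq[OF sets_\<mu>\<^sub>0] by simp

lemma sm_val_\<sigma>: "sm_val \<sigma> A = measure \<mu>\<^sub>0 A"
  unfolding \<sigma>_def by (rule sm_val_signed_of) (simp_all add: \<mu>0.finite_measure_axioms)

lemma mass_\<sigma> [simp]: "sm_val \<sigma> UNIV = 1"
  using \<mu>0.prob_space by (simp add: sm_val_\<sigma>)

lemma T_\<sigma>: "T \<sigma> = \<sigma>"
proof (rule sm_eqI)
  fix A :: "('m \<times> 'k) set" assume A: "A \<in> sets borel"
  have "measure \<mu>\<^sub>0 A = measure (distr \<mu>\<^sub>0 borel F) A" by (simp add: distr_\<mu>\<^sub>0)
  also have "\<dots> = measure \<mu>\<^sub>0 (F -` A)"
    using A by (subst measure_distr) simp_all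
  finally show "sm_val (T \<sigma>) A = sm_val \<sigma> A"
    using A by (simp add: sm_val_push sm_val_\<sigma>)
qed

lemma Tn_\<sigma>: "(T ^^ n) \<sigma> = \<sigma>"
  by (induction n) (simp_all add: T_\<sigma>)

text \<open>The marginal is m, so the density is 1, which lies in \<open>Bs\<close>; almost every
  restriction is then a probability, of fibre norm 1 by the normalisation.\<close>

lemma \<sigma>_S: "\<sigma> \<in> S" and dens_\<sigma>: "AE \<gamma> in \<nu>. dens \<sigma> \<gamma> = 1"
proof -
  have "\<exists>\<kappa> e. disintegration m \<mu>\<^sub>0 \<kappa> e"
    by (rule ex_disintegration[OF \<mu>0.finite_measure_axioms sets_\<mu>\<^sub>0 sigma_finite_measure_axioms sets_m])
       (simp add: marg_\<mu>\<^sub>0 absolutely_continuous_def)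
  then obtain \<kappa> e where de: "disintegration m \<mu>\<^sub>0 \<kappa> e" by blast
  define r where "r \<gamma> = e \<gamma> *\<^sub>R signed_of (distr (\<kappa> \<gamma>) borel (snd :: _ \<Rightarrow> 'k))" for \<gamma>
  have r: "fibre_version m \<sigma> r"
    unfolding \<sigma>_def r_def by (rule disintegration_fibre_version[OF \<mu>0.finite_measure_axioms sets_\<mu>\<^sub>0 de])
  have e0: "0 \<le> e \<gamma>" for \<gamma> using de by (auto simp: disintegration_def)
  have p: "prob_space (distr (\<kappa> \<gamma>) borel (snd :: _ \<Rightarrow> 'k))" for \<gamma>
  proof -
    have "\<kappa> \<gamma> \<in> space (prob_algebra borel)"
      using de measurable_space[of \<kappa> borel "prob_algebra borel" \<gamma>] by (simp add: disintegration_def)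
    then have k: "prob_space (\<kappa> \<gamma>)" "sets (\<kappa> \<gamma>) = sets borel" by (auto simp: space_prob_algebra)
    have "snd \<in> measurable (\<kappa> \<gamma>) borel"
      unfolding measurable_cong_sets[OF k(2) refl] borel_prod[symmetric] by measurable
    then show ?thesis by (rule prob_space.prob_space_distr[OF k(1)])
  qed
  have No_r: "No (r \<gamma>) = e \<gamma>" for \<gamma>
    using normalized p[of \<gamma>] e0[of \<gamma>] by (simp add: r_def No_scale normalized_on_probs_def)
  have r_U: "sm_val (r \<gamma>) UNIV = e \<gamma>" for \<gamma>
  proof -
    have "sm_val (signed_of (distr (\<kappa> \<gamma>) borel (snd :: _ \<Rightarrow> 'k))) UNIV = 1"
      using p[of \<gamma>] prob_space.prob_space[OF p[of \<gamma>]]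
      by (subst sm_val_signed_of) (auto intro: prob_space.finite_measure)
    then show ?thesis by (simp add: r_def)
  qed
  have e1: "AE \<gamma> in m. e \<gamma> = 1"
  proof (rule density_unique_real)
    show "integrable m e" using fibre_version_integrable_Times[OF r, of UNIV] by (simp add: r_U)
    show "(LINT \<gamma>:B|m. e \<gamma>) = (LINT \<gamma>:B|m. 1)" if "B \<in> sets m" for B
    proof -
      have B: "B \<in> sets borel" using that by simp
      have fst: "fst \<in> measurable \<mu>\<^sub>0 borel"
        unfolding measurable_cong_sets[OF sets_\<mu>\<^sub>0 refl] borel_prod[symmetric] by measurable
      have "(LINT \<gamma>:B|m. e \<gamma>) = measure \<mu>\<^sub>0 (B \<times> UNIV)"
        using fibre_version_Times[OF r B, of UNIV] by (simp add: r_U sm_val_\<sigma>)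
      also have "B \<times> UNIV = fst -` B \<inter> space \<mu>\<^sub>0" by auto
      also have "measure \<mu>\<^sub>0 \<dots> = measure m B"
        by (subst marg_\<mu>\<^sub>0[symmetric]) (rule measure_distr[OF fst B, symmetric])
      finally show ?thesis
        using B by (simp add: set_lebesgue_integral_def)
    qed
  qed simp
  have 1: "AE \<gamma> in m. No (r \<gamma>) \<le> 1" and 2: "AE \<gamma> in m. sm_val (r \<gamma>) UNIV = 1"
    using e1 by (simp_all add: No_r r_U) (auto elim: eventually_mono)
  note * = S_I[OF r 1 one_Bs 2]
  show "\<sigma> \<in> S" "AE \<gamma> in \<nu>. dens \<sigma> \<gamma> = 1" using * by auto
qed

lemma nS_\<sigma>_pos: "0 < nS \<sigma>"
  using mass_le_nS[OF \<sigma>_S] by simp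

lemma \<sigma>_neq_0: "\<sigma> \<noteq> 0"
  using mass_\<sigma> by (metis zero_neq_one zero_signed_measure.rep_eq)

lemma mass_Tn [simp]: "sm_val ((T ^^ n) \<mu>) UNIV = sm_val \<mu> UNIV"
  by (induction n) simp_all

section \<open>The projection, the remainder and their decay\<close>

definition P :: "('m \<times> 'k) signed_measure \<Rightarrow> ('m \<times> 'k) signed_measure" where
  "P \<mu> = sm_val \<mu> UNIV *\<^sub>R \<sigma>"

definition N :: "('m \<times> 'k) signed_measure \<Rightarrow> ('m \<times> 'k) signed_measure" where
  "N \<mu> = T \<mu> - P \<mu>"

lemma P_S: "\<mu> \<in> S \<Longrightarrow> P \<mu> \<in> S"
  unfolding P_def by (rule S_scale(1)[OF \<sigma>_S])

lemma Tn_diff: "(T ^^ n) (\<mu> - \<eta>) = (T ^^ n) \<mu> - (T ^^ n) \<eta>"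
  and Tn_scale: "(T ^^ n) (c *\<^sub>R \<mu>) = c *\<^sub>R (T ^^ n) \<mu>"
  by (induction n) (simp_all add: push_signed_diff[OF F_measurable]
    push_signed_scaleR[OF F_measurable])

text \<open>The push-forward preserves mass and fixes \<sigma>, so the difference has mass 0 and
  \<open>P\<close> kills it at the next step. The formula starts at power 1, because
  \<open>N ^^ 0\<close> is the identity.\<close>

lemma N_funpow: "(N ^^ Suc n) \<mu> = (T ^^ Suc n) \<mu> - P \<mu>"
proof (induction n)
  case (Suc n)
  have "(N ^^ Suc (Suc n)) \<mu> = N ((N ^^ Suc n) \<mu>)" by simp
  also have "\<dots> = N ((T ^^ Suc n) \<mu> - P \<mu>)" by (simp only: Suc.IH)
  also have "\<dots> = T ((T ^^ Suc n) \<mu>) - P \<mu>"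
    by (simp add: N_def P_def push_signed_diff[OF F_measurable] push_signed_scaleR[OF F_measurable] T_\<sigma>)
  finally show ?case by simp
qed (simp add: N_def)

text \<open>The projection of the base splits off the total mass: comparing masses in
  \<open>h\<phi>\<^sub>1(F\<^sub>*\<^sup>n\<mu>) = \<P>g + \<N>\<^sup>ng\<close>, \<open>g = h\<phi>\<^sub>1(\<mu>)\<close>, identifies the coefficient of \<open>h\<close> in \<open>\<P>g\<close>.\<close>

lemma base_decay:
  "\<exists>K r. 0 \<le> K \<and> 0 \<le> r \<and> r < 1 \<and>
     (\<forall>\<mu>\<in>S. \<forall>n\<ge>1. Ns (dens ((T ^^ n) \<mu> - P \<mu>)) \<le> K * r ^ n * Ns (dens \<mu>))"
proof -
  obtain Pf Nf C r where ops: "ae_linear_op_on \<nu> Bs Pf" "ae_linear_op_on \<nu> Bs Nf"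
    and dec': "\<forall>g\<in>Bs. AE x in \<nu>. transfer f \<phi> g x / lam = Pf g x + Nf g x"
    and PP': "\<forall>g\<in>Bs. AE x in \<nu>. Pf (Pf g) x = Pf g x"
    and rank: "\<exists>e\<in>Bs. \<not> (AE x in \<nu>. Pf e x = 0) \<and> (\<forall>g\<in>Bs. \<exists>c. AE x in \<nu>. Pf g x = c * Pf e x)"
    and NP': "\<forall>g\<in>Bs. AE x in \<nu>. Nf (Pf g) x = 0"
    and PN': "\<forall>g\<in>Bs. AE x in \<nu>. Pf (Nf g) x = 0"
    and Cr: "0 < C" "0 \<le> r" "r < 1"
    and decay': "\<forall>g\<in>Bs. \<forall>n\<ge>1. Ns ((Nf ^^ n) g) \<le> C * r ^ n * Ns g"
    using base_gap unfolding base_spectral_gap_def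
    by (elim conjE exE) (rule that; assumption)
  note dec = dec'[rule_format] and PP = PP'[rule_format] and NP = NP'[rule_format]
    and PN = PN'[rule_format] and decay = decay'[rule_format]
  note Pl = ops(1)[unfolded ae_linear_op_on_def] and Nl = ops(2)[unfolded ae_linear_op_on_def]
  note PB = Pl[THEN conjunct1, rule_format] and NB = Nl[THEN conjunct1, rule_format]
  have NnB: "(Nf ^^ n) g \<in> Bs" if "g \<in> Bs" for g n
    using that by (induction n) (auto intro: NB)
  note Padd = Pl[THEN conjunct2, THEN conjunct2, THEN conjunct1, rule_format]
    and Nadd = Nl[THEN conjunct2, THEN conjunct2, THEN conjunct1, rule_format]
  note Pcong = Pl[THEN conjunct2, THEN conjunct1, rule_format, OF _ Bs_cong]
    and Ncong = Nl[THEN conjunct2, THEN conjunct1, rule_format, OF _ Bs_cong]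
  define g where "g \<mu> x = h x * dens \<mu> x" for \<mu> x
  obtain C2 where C2: "0 \<le> C2" "\<And>k. k \<in> Bs \<Longrightarrow> (\<lambda>x. h x * k x) \<in> Bs \<and> Ns (\<lambda>x. h x * k x) \<le> C2 * Ns k"
    using h_mult_bound by blast
  obtain C1 where C1: "0 \<le> C1" "\<And>k. k \<in> Bs \<Longrightarrow> (\<lambda>x. k x / h x) \<in> Bs \<and> Ns (\<lambda>x. k x / h x) \<le> C1 * Ns k"
    using inv_h_mult_bound by blast
  have gB: "g \<mu> \<in> Bs" "Ns (g \<mu>) \<le> C2 * Ns (dens \<mu>)" if "\<mu> \<in> S" for \<mu>
    using C2(2)[of "dens \<mu>"] that by (auto simp: g_def[abs_def] S_iff)
  have Ns_dens: "Ns (dens \<mu>) \<le> C1 * Ns (g \<mu>)" if "\<mu> \<in> S" for \<mu>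
    using C1(2)[OF gB(1)[OF that]] by (simp add: g_def[abs_def])
  have gT: "AE x in \<nu>. g (T \<mu>) x = Pf (g \<mu>) x + Nf (g \<mu>) x" if "\<mu> \<in> S" for \<mu>
    using dens_T[OF that] dec[OF gB(1)[OF that]] unfolding g_def by eventually_elim simp
  have gTn: "AE x in \<nu>. g ((T ^^ Suc n) \<mu>) x = Pf (g \<mu>) x + (Nf ^^ Suc n) (g \<mu>) x" if \<mu>: "\<mu> \<in> S" for \<mu> n
  proof (induction n)
    case 0
    show ?case using gT[OF \<mu>] by simp
  next
    case (Suc n)
    let ?\<eta> = "(T ^^ Suc n) \<mu>" and ?k = "(Nf ^^ Suc n) (g \<mu>)" and ?l = "(Nf ^^ n) (g \<mu>)"
    have \<eta>: "?\<eta> \<in> S" by (rule Tn_S[OF \<mu>])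
    have B: "g \<mu> \<in> Bs" "Pf (g \<mu>) \<in> Bs" "?k \<in> Bs" "?l \<in> Bs" "g ?\<eta> \<in> Bs"
      using gB(1)[OF \<mu>] gB(1)[OF \<eta>] PB NnB[of "g \<mu>" "Suc n"] NnB[of "g \<mu>" n] by auto
    \<comment> \<open>Here \<open>?k\<close> is \<open>Nf\<close> applied to \<open>?l\<close>,
      because at least one application of \<open>Nf\<close> has been made; this removes the mixed
      term.\<close>
    have "AE x in \<nu>. Pf ?k x = 0" using PN[OF B(4)] by simp
    with gT[OF \<eta>] Pcong[OF B(5) B(5) Suc Suc] Ncong[OF B(5) B(5) Suc Suc] Padd[OF B(2,3)] Nadd[OF B(2,3)]
      PP[OF B(1)] NP[OF B(1)]
    have "AE x in \<nu>. g (T ?\<eta>) x = Pf (g \<mu>) x + Nf ?k x"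
      by eventually_elim simp
    then show ?case by simp
  qed
  \<comment> \<open>Constants are identified by bounding their difference with a geometric
    sequence.\<close>
  have zero: "x = 0" if le: "\<And>n. \<bar>x\<bar> \<le> c * r ^ Suc n" for x c :: real
  proof -
    have "(\<lambda>n. c * r ^ Suc n) \<longlonglongrightarrow> c * 0"
      using Cr by (intro tendsto_mult tendsto_const LIMSEQ_Suc LIMSEQ_realpow_zero) auto
    then have "\<bar>x\<bar> \<le> c * 0"
      using le by (intro LIMSEQ_le_const[of _ _ "\<bar>x\<bar>"]) auto
    then show "x = 0" by simp
  qed
  have g\<sigma>h: "AE x in \<nu>. g \<sigma> x = h x"
    using dens_\<sigma> by eventually_elim (simp add: g_def)
  \<comment> \<open>As \<sigma> is invariant, its remainder is the same for all n; it also decays,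
    hence it vanishes and h is a fixed vector of the base projection.\<close>
  have Pg\<sigma>: "AE x in \<nu>. Pf (g \<sigma>) x = h x"
  proof -
    have B: "(\<lambda>x. g \<sigma> x + (-1) * Pf (g \<sigma>) x) \<in> Bs"
      using gB(1)[OF \<sigma>_S] by (intro Bs_add Bs_scale PB)
    have "\<bar>Ns (\<lambda>x. g \<sigma> x + (-1) * Pf (g \<sigma>) x)\<bar> \<le> (C * Ns (g \<sigma>)) * r ^ Suc n" for n
    proof -
      have "AE x in \<nu>. g \<sigma> x + (-1) * Pf (g \<sigma>) x = (Nf ^^ Suc n) (g \<sigma>) x"
        using gTn[OF \<sigma>_S, of n] unfolding Tn_\<sigma> by eventually_elim simp
      then have "Ns (\<lambda>x. g \<sigma> x + (-1) * Pf (g \<sigma>) x) = Ns ((Nf ^^ Suc n) (g \<sigma>))"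
        by (rule Ns_cong[OF B])
      then show ?thesis
        using decay[OF gB(1)[OF \<sigma>_S], of "Suc n"] Ns_nonneg[OF B] by (simp add: mult_ac)
    qed
    then have "Ns (\<lambda>x. g \<sigma> x + (-1) * Pf (g \<sigma>) x) = 0" by (rule zero)
    then have "AE x in \<nu>. g \<sigma> x + (-1) * Pf (g \<sigma>) x = 0" by (simp only: Ns_eq_0[OF B])
    then show ?thesis using g\<sigma>h by eventually_elim simp
  qed
  \<comment> \<open>The range of the base projection is one-dimensional and contains h, which is not
    null, so h spans it.\<close>
  have Pc: "\<exists>c. AE x in \<nu>. Pf k x = c * h x" if k: "k \<in> Bs" for k
  proof -
    obtain e where e: "e \<in> Bs" "\<And>k. k \<in> Bs \<Longrightarrow> \<exists>c. AE x in \<nu>. Pf k x = c * Pf e x"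
      using rank by blast
    obtain c0 where c0: "AE x in \<nu>. Pf (g \<sigma>) x = c0 * Pf e x" using e(2)[OF gB(1)[OF \<sigma>_S]] by blast
    obtain c where c: "AE x in \<nu>. Pf k x = c * Pf e x" using e(2)[OF k] by blast
    have c0_neq_0: "c0 \<noteq> 0"
    proof
      assume c00: "c0 = 0"
      have "AE x in \<nu>. h x = 0"
        using c0 Pg\<sigma> by eventually_elim (simp add: c00)
      then have "AE x in m. False" unfolding AE_m_iff by simp
      then show False by (simp only: m.AE_const)
    qed
    have "AE x in \<nu>. Pf k x = (c / c0) * h x"
      using c c0 Pg\<sigma> by eventually_elim (simp add: c0_neq_0)
    then show ?thesis by blast
  qed
  define K where "K = C1 * C * C2"
  have "Ns (dens ((T ^^ n) \<mu> - P \<mu>)) \<le> K * r ^ n * Ns (dens \<mu>)" if \<mu>: "\<mu> \<in> S" and n: "1 \<le> n" for \<mu> n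
  proof -
    obtain c where c: "AE x in \<nu>. Pf (g \<mu>) x = c * h x" using Pc[OF gB(1)[OF \<mu>]] by blast
    have \<zeta>S: "(T ^^ Suc n) \<mu> - c *\<^sub>R \<sigma> \<in> S" for n
      by (rule S_diff_scale(1)[OF Tn_S[OF \<mu>] \<sigma>_S])
    have bd: "Ns (dens ((T ^^ Suc n) \<mu> - c *\<^sub>R \<sigma>)) \<le> K * r ^ Suc n * Ns (dens \<mu>)" for n
    proof -
      let ?\<zeta> = "(T ^^ Suc n) \<mu> - c *\<^sub>R \<sigma>"
      have "AE x in \<nu>. g ?\<zeta> x = (Nf ^^ Suc n) (g \<mu>) x"
        using S_diff_scale(2)[OF Tn_S[OF \<mu>, of "Suc n"] \<sigma>_S, of c] gTn[OF \<mu>, of n] c dens_\<sigma>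
      proof eventually_elim
        case (elim x)
        have "g ?\<zeta> x = g ((T ^^ Suc n) \<mu>) x - c * h x"
          unfolding g_def elim(1) elim(4) by (simp add: right_diff_distrib)
        then show ?case using elim(2,3) by linarith
      qed
      then have "Ns (g ?\<zeta>) = Ns ((Nf ^^ Suc n) (g \<mu>))"
        by (rule Ns_cong[OF gB(1)[OF \<zeta>S]])
      also have "\<dots> \<le> C * r ^ Suc n * Ns (g \<mu>)" by (rule decay[OF gB(1)[OF \<mu>]]) simp
      also have "\<dots> \<le> C * r ^ Suc n * (C2 * Ns (dens \<mu>))"
        using Cr gB(2)[OF \<mu>] by (intro mult_left_mono) auto
      finally have "C1 * Ns (g ?\<zeta>) \<le> C1 * (C * r ^ Suc n * (C2 * Ns (dens \<mu>)))"
        using C1(1) by (rule mult_left_mono)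
      with Ns_dens[OF \<zeta>S[of n]] show ?thesis by (simp add: K_def mult_ac)
    qed
    \<comment> \<open>The difference with c \<sigma> has mass \<open>sm_val \<mu> UNIV - c\<close>
      for every n, while its strong norm decays and bounds that mass; hence c is the mass of
      \<mu>.\<close>
    have "sm_val \<mu> UNIV - c = 0"
    proof (rule zero)
      fix n
      show "\<bar>sm_val \<mu> UNIV - c\<bar> \<le> (K * Ns (dens \<mu>)) * r ^ Suc n"
        using order_trans[OF mass_le[OF \<zeta>S[of n]] bd[of n]] mass_Tn[of "Suc n" \<mu>]
        by (simp add: mult_ac)
    qed
    then have "P \<mu> = c *\<^sub>R \<sigma>" by (simp add: P_def)
    with bd[of "n - 1"] n show ?thesis by simp
  qed
  then show ?thesis
    using Cr C1(1) C2(1) by (intro exI[of _ K] exI[of _ r]) (auto simp: K_def)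
qed

text \<open>The density decays at the base rate and feeds the fibre norm through the Lasota-Yorke
  inequality; the resulting linear recursion is solved with a common rate.\<close>

lemma spectral_gap:
  "\<exists>\<xi> R. 0 < \<xi> \<and> \<xi> < 1 \<and> 0 < R \<and> (\<forall>\<mu>\<in>S. \<forall>n\<ge>1. nS ((N ^^ n) \<mu>) \<le> R * \<xi> ^ n * nS \<mu>)"
proof -
  obtain \<alpha> where \<alpha>: "0 \<le> \<alpha>" "\<alpha> < 1"
    "AE \<gamma> in \<nu>. \<forall>\<mu>. No (push_signed (\<lambda>y. G (\<gamma>, y)) \<mu>) \<le> \<alpha> * No \<mu> + \<bar>sm_val \<mu> UNIV\<bar>"
    using ex_contraction by blast
  obtain K r where K: "0 \<le> K" "0 \<le> r" "r < 1"
    "\<And>\<mu> n. \<mu> \<in> S \<Longrightarrow> 1 \<le> n \<Longrightarrow> Ns (dens ((T ^^ n) \<mu> - P \<mu>)) \<le> K * r ^ n * Ns (dens \<mu>)"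
    using base_decay by blast
  \<comment> \<open>Midpoint between 1 and the larger rate: strictly above \<alpha>, at least r, and
    positive even if both rates are 0.\<close>
  define \<xi> where "\<xi> = (1 + max \<alpha> r) / 2"
  have \<xi>: "0 < \<xi>" "\<xi> < 1" "\<alpha> < \<xi>" "r \<le> \<xi>" using \<alpha> K by (auto simp: \<xi>_def)
  \<comment> \<open>One constant for the base decay and, through 1 + \<open>nS \<sigma>\<close>, for
    the norm of \<open>\<mu> - P \<mu>\<close> at n = 0.\<close>
  define L where "L = K + 1 + nS \<sigma>"
  \<comment> \<open>Chosen so that \<alpha> A + L <= \<xi> A, which closes the induction, and L <=
    A, which starts it.\<close>
  define A where "A = L + L / (\<xi> - \<alpha>)"
  have L: "0 < L" "K \<le> L" "1 + nS \<sigma> \<le> L" using K nS_\<sigma>_pos by (auto simp: L_def)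
  have A: "0 < A" "L \<le> A" "L \<le> (\<xi> - \<alpha>) * A"
    using L \<xi> by (auto simp: A_def distrib_left intro!: add_pos_nonneg divide_nonneg_pos)
  \<comment> \<open>The bounds include n = 0, where the base decay does not apply, because the
    recursion starts there.\<close>
  have bound: "Ns (dens ((T ^^ n) \<mu> - P \<mu>)) \<le> L * \<xi> ^ n * nS \<mu> \<and> fsup ((T ^^ n) \<mu> - P \<mu>) \<le> A * \<xi> ^ n * nS \<mu>"
    if \<mu>: "\<mu> \<in> S" for \<mu> n
  proof -
    have \<zeta>S: "(T ^^ n) \<mu> - P \<mu> \<in> S" for n
      unfolding P_def by (rule S_diff_scale(1)[OF Tn_S[OF \<mu>] \<sigma>_S])
    have n0: "0 \<le> nS \<mu>" by (rule S_nonneg(3)[OF \<mu>])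
    have "nS (\<mu> - P \<mu>) \<le> nS \<mu> + \<bar>sm_val \<mu> UNIV\<bar> * nS \<sigma>"
      unfolding P_def by (rule S_diff_scale(3)[OF \<mu> \<sigma>_S])
    also have "\<dots> \<le> nS \<mu> + nS \<mu> * nS \<sigma>"
      using mass_le_nS[OF \<mu>] nS_\<sigma>_pos by (intro add_left_mono mult_right_mono) auto
    also have "\<dots> = (1 + nS \<sigma>) * nS \<mu>" by (simp add: algebra_simps)
    also have "\<dots> \<le> L * nS \<mu>" using L n0 by (intro mult_right_mono)
    finally have init: "nS (\<mu> - P \<mu>) \<le> L * nS \<mu>" .
    have base: "Ns (dens ((T ^^ n) \<mu> - P \<mu>)) \<le> L * \<xi> ^ n * nS \<mu>" for n
    proof (cases "n = 0")
      case True
      then show ?thesis using init S_nonneg(2)[OF \<zeta>S[of 0]] by (simp add: nS_eq[of "\<mu> - P \<mu>"])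
    next
      case False
      then have "Ns (dens ((T ^^ n) \<mu> - P \<mu>)) \<le> K * r ^ n * Ns (dens \<mu>)" using K(4)[OF \<mu>] by simp
      also have "\<dots> \<le> L * \<xi> ^ n * nS \<mu>"
        using L \<xi> K S_nonneg[OF \<mu>]
        by (intro mult_mono power_mono) (auto simp: nS_eq)
      finally show ?thesis .
    qed
    have "fsup ((T ^^ n) \<mu> - P \<mu>) \<le> A * \<xi> ^ n * nS \<mu>" for n
    proof (induction n)
      case 0
      have "fsup (\<mu> - P \<mu>) \<le> L * nS \<mu>"
        using init S_nonneg(1)[OF \<zeta>S[of 0]] by (simp add: nS_eq[of "\<mu> - P \<mu>"])
      also have "\<dots> \<le> A * nS \<mu>" using A n0 by (intro mult_right_mono)
      finally show ?case by simp
    next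
      case (Suc n)
      \<comment> \<open>\<open>P \<mu>\<close> is fixed by the push-forward, so the differences form
        an orbit and the inequality can be iterated along it.\<close>
      have "(T ^^ Suc n) \<mu> - P \<mu> = T ((T ^^ n) \<mu> - P \<mu>)"
        by (simp add: P_def push_signed_diff[OF F_measurable] push_signed_scaleR[OF F_measurable] T_\<sigma>)
      then have "fsup ((T ^^ Suc n) \<mu> - P \<mu>) \<le> \<alpha> * fsup ((T ^^ n) \<mu> - P \<mu>) + Ns (dens ((T ^^ n) \<mu> - P \<mu>))"
        using S_T(2)[OF \<alpha>(1,3) \<zeta>S[of n]] by simp
      also have "\<dots> \<le> \<alpha> * (A * \<xi> ^ n * nS \<mu>) + L * \<xi> ^ n * nS \<mu>"
        using Suc base[of n] \<alpha>(1) by (intro add_mono mult_left_mono)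
      also have "\<dots> = (\<alpha> * A + L) * (\<xi> ^ n * nS \<mu>)" by (simp add: algebra_simps)
      also have "\<dots> \<le> (\<xi> * A) * (\<xi> ^ n * nS \<mu>)"
        using A(3) \<xi> n0 by (intro mult_right_mono) (auto simp: algebra_simps)
      finally show ?case by (simp add: mult_ac)
    qed
    with base show ?thesis by blast
  qed
  have "nS ((N ^^ n) \<mu>) \<le> (L + A) * \<xi> ^ n * nS \<mu>" if \<mu>: "\<mu> \<in> S" and n: "1 \<le> n" for \<mu> n
  proof -
    have eq: "(N ^^ n) \<mu> = (T ^^ n) \<mu> - P \<mu>"
      using N_funpow[of "n - 1" \<mu>] n by simp
    show ?thesis
      unfolding eq nS_eq[of "(T ^^ n) \<mu> - P \<mu>"] using bound[OF \<mu>, of n] by (simp add: algebra_simps)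
  qed
  then show ?thesis
    using \<xi> L A by (intro exI[of _ \<xi>] exI[of _ "L + A"]) auto
qed

section \<open>Correlations as integrals against iterates\<close>

lemma pos_measure_\<sigma>: "pos_measure \<sigma> = \<mu>\<^sub>0"
proof -
  have "jordan_pair \<sigma> \<mu>\<^sub>0 (null_measure borel)"
    unfolding jordan_pair_def
    by (auto simp: \<mu>0.finite_measure_axioms sm_val_\<sigma> measure_def intro!: bexI[of _ UNIV] finite_measureI)
  then show ?thesis using jordan_pair_unique[OF jordan_pair_pos_neg] by blast
qed

lemma Fn_measurable [measurable]: "F ^^ n \<in> borel_measurable borel"
  by (induction n) (auto intro: measurable_comp simp: id_def)

lemma distr_Fn: "distr \<mu>\<^sub>0 borel (F ^^ n) = \<mu>\<^sub>0"
proof (induction n)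
  case 0
  show ?case by (simp add: id_def distr_id2)
next
  case (Suc n)
  have "distr \<mu>\<^sub>0 borel (F ^^ Suc n) = distr (distr \<mu>\<^sub>0 borel (F ^^ n)) borel F"
    by (subst distr_distr) (simp_all add: measurable_cong_sets[OF sets_\<mu>\<^sub>0 refl])
  then show ?case by (simp only: Suc distr_\<mu>\<^sub>0)
qed

text \<open>Subtracting the mean of v absorbs the projection: \<open>N ^^ n\<close> applied to v
  \<mu>_0 is the n-th push-forward of the measure with density v minus its mean, and one change of
  variables evaluates the integral.\<close>

lemma correlation_integral:
  assumes u: "u \<in> borel_measurable borel" "integrable \<mu>\<^sub>0 u"
    and v: "integrable \<mu>\<^sub>0 v" and uv: "integrable \<mu>\<^sub>0 (\<lambda>z. u ((F ^^ n) z) * v z)" and n: "1 \<le> n"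
  shows "(LINT z|\<mu>\<^sub>0. u ((F ^^ n) z) * v z) - (LINT z|\<mu>\<^sub>0. u z) * (LINT z|\<mu>\<^sub>0. v z) =
    signed_integral ((N ^^ n) (weighted_measure \<mu>\<^sub>0 v)) u"
proof -
  let ?c = "LINT z|\<mu>\<^sub>0. v z"
  have um: "u \<in> borel_measurable (distr \<mu>\<^sub>0 borel (F ^^ n))" using u(1) by simp
  have Fm: "F ^^ n \<in> measurable \<mu>\<^sub>0 borel" by (simp add: measurable_cong_sets[OF sets_\<mu>\<^sub>0 refl])
  have uF: "integrable \<mu>\<^sub>0 (\<lambda>z. u ((F ^^ n) z))" "(LINT z|\<mu>\<^sub>0. u ((F ^^ n) z)) = (LINT z|\<mu>\<^sub>0. u z)"
    using integrable_distr_eq[OF Fm u(1)] integral_distr[OF Fm u(1)] u(2) by (simp_all add: distr_Fn)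
  have w: "weighted_measure \<mu>\<^sub>0 (\<lambda>z. v z - ?c) = weighted_measure \<mu>\<^sub>0 v - ?c *\<^sub>R \<sigma>"
  proof (rule sm_eqI)
    fix A :: "('m \<times> 'k) set" assume A: "A \<in> sets borel"
    have "set_integrable \<mu>\<^sub>0 A v"
      unfolding set_integrable_def using integrable_mult_indicator[OF _ v, of A] A by simp
    moreover have "set_integrable \<mu>\<^sub>0 A (\<lambda>z. ?c)"
      unfolding set_integrable_def using integrable_mult_indicator[of A \<mu>\<^sub>0 "\<lambda>z. ?c"] A by simp
    ultimately show "sm_val (weighted_measure \<mu>\<^sub>0 (\<lambda>z. v z - ?c)) A = sm_val (weighted_measure \<mu>\<^sub>0 v - ?c *\<^sub>R \<sigma>) A"
      using A v by (simp add: sm_val_weighted sm_val_\<sigma> set_integral_diff) (simp add: set_lebesgue_integral_def)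
  qed
  have mass: "sm_val (weighted_measure \<mu>\<^sub>0 v) UNIV = ?c"
    using v by (simp add: sm_val_weighted set_lebesgue_integral_def)
  have "(N ^^ n) (weighted_measure \<mu>\<^sub>0 v) = (T ^^ n) (weighted_measure \<mu>\<^sub>0 v) - ?c *\<^sub>R \<sigma>"
    using N_funpow[of "n - 1" "weighted_measure \<mu>\<^sub>0 v"] n by (simp add: P_def mass)
  also have "\<dots> = (T ^^ n) (weighted_measure \<mu>\<^sub>0 (\<lambda>z. v z - ?c))"
    by (simp add: w Tn_diff Tn_scale Tn_\<sigma>)
  also have "\<dots> = push_signed (F ^^ n) (weighted_measure \<mu>\<^sub>0 (\<lambda>z. v z - ?c))"
    by (rule push_signed_funpow[OF F_measurable])
  finally have "signed_integral ((N ^^ n) (weighted_measure \<mu>\<^sub>0 v)) u =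
      signed_integral (push_signed (F ^^ n) (weighted_measure \<mu>\<^sub>0 (\<lambda>z. v z - ?c))) u" by simp
  also have "\<dots> = (LINT z|\<mu>\<^sub>0. u ((F ^^ n) z) * (v z - ?c))"
    using v uv uF(1) by (intro signed_integral_push_weighted u) (auto simp: right_diff_distrib)
  also have "\<dots> = (LINT z|\<mu>\<^sub>0. u ((F ^^ n) z) * v z) - (LINT z|\<mu>\<^sub>0. u z) * ?c"
    using uv uF by (simp add: right_diff_distrib)
  finally show ?thesis by simp
qed

end

theorem theoremG:
  fixes f :: "'m::polish_space \<Rightarrow> 'm"
    and G :: "'m \<times> 'k::polish_space \<Rightarrow> 'k"
    and \<phi> h :: "'m \<Rightarrow> real"
    and m \<nu> :: "'m measure"
    and lam :: real
    and Bs Bw :: "('m \<Rightarrow> real) set"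
    and Ns Nw :: "('m \<Rightarrow> real) \<Rightarrow> real"
    and d :: nat
    and Q :: "nat \<Rightarrow> 'm set"
    and \<mu>\<^sub>0 :: "('m \<times> 'k) measure"
    and No :: "'k signed_measure \<Rightarrow> real"
  defines "F \<equiv> skew_product f G"
    and "S \<equiv> S_inf No m Bs"
    and "nS \<equiv> S_inf_norm No m Ns"
    and "Fbar \<equiv> (\<lambda>\<mu>. (1 / lam) *\<^sub>R skew_transfer f G \<phi> h m d Q \<mu>)"
  assumes compact_fibre: "compact (UNIV :: 'k set)"
    and f_measurable: "f \<in> borel_measurable borel"
    and G_measurable: "G \<in> borel_measurable borel"
    and phi_measurable: "\<phi> \<in> borel_measurable borel"
    and P1_1: "conformal_equilibrium f \<phi> m h \<nu> lam"
    and P1_2: "base_spectral_gap f \<phi> h \<nu> lam Bs Ns Bw Nw"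
    and P2: "full_branches f \<nu> d Q"
    and P3: "invariant_prob F \<mu>\<^sub>0" "distr \<mu>\<^sub>0 borel fst = m"
    and norm_o: "is_norm No"
    and G1: "fibre_contraction G \<nu> No"
    and G2: "weak_norm_bounds No m \<nu> Bw Nw"
    and G3: "normalized_on_probs No"
  shows "\<exists>\<xi> R. 0 < \<xi> \<and> \<xi> < 1 \<and> 0 < R \<and>
    linear_op_on S Fbar \<and>
    (\<exists>P N. linear_op_on S P \<and> linear_op_on S N \<and>
       (\<forall>\<mu>\<in>S. Fbar \<mu> = P \<mu> + N \<mu>) \<and>
       (\<forall>\<mu>\<in>S. P (P \<mu>) = P \<mu>) \<and> dim (P ` S) = 1 \<and>
       (\<forall>\<mu>\<in>S. P (N \<mu>) = 0 \<and> N (P \<mu>) = 0) \<and>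
       (\<forall>\<mu>\<in>S. \<forall>n\<ge>1. nS ((N ^^ n) \<mu>) \<le> R * \<xi> ^ n * nS \<mu>)) \<and>
    (\<forall>u R\<^sub>4. admissible_observable No m Bs Ns u R\<^sub>4 \<longrightarrow>
       (\<forall>v\<in>admissible_densities No m Bs \<mu>\<^sub>0. \<forall>n\<ge>1.
          integrable \<mu>\<^sub>0 (\<lambda>z. u ((F ^^ n) z) * v z) \<longrightarrow>
          \<bar>(LINT z|\<mu>\<^sub>0. u ((F ^^ n) z) * v z) - (LINT z|\<mu>\<^sub>0. u z) * (LINT z|\<mu>\<^sub>0. v z)\<bar>
            \<le> nS (weighted_measure \<mu>\<^sub>0 v) * R * R\<^sub>4 * \<xi> ^ n))"
proof -
  interpret K: skew_setting f \<phi> h m \<nu> lam d Q G Bs Bw Ns Nw \<mu>\<^sub>0 No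
    using assms by unfold_locales (simp_all add: F_def)
  obtain \<xi> R where \<xi>: "0 < \<xi>" "\<xi> < 1" and R: "0 < R"
    and gap: "\<And>\<mu> n. \<mu> \<in> S \<Longrightarrow> 1 \<le> n \<Longrightarrow> nS ((K.N ^^ n) \<mu>) \<le> R * \<xi> ^ n * nS \<mu>"
    using K.spectral_gap unfolding S_def nS_def by metis
  have Fbar: "Fbar \<mu> = push_signed F \<mu>" if "\<mu> \<in> S" for \<mu>
    using K.skew_transfer_eq[OF K.S_AB] that K.lam_pos by (simp add: Fbar_def S_def F_def)
  have FS: "push_signed F \<mu> \<in> S" if "\<mu> \<in> S" for \<mu>
    using K.T_S that by (simp add: S_def F_def)
  have Sa: "\<mu> + \<eta> \<in> S" "c *\<^sub>R \<mu> \<in> S" if "\<mu> \<in> S" "\<eta> \<in> S" for \<mu> \<eta> c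
    using K.S_add(1) K.S_scale(1) that by (simp_all add: S_def)
  have Fm: "F \<in> borel_measurable borel" unfolding F_def by (rule K.F_measurable)
  note push = push_signed_add[OF Fm] push_signed_scaleR[OF Fm]
  have NF: "K.N \<mu> = push_signed F \<mu> - K.P \<mu>" for \<mu> by (simp add: K.N_def F_def)
  have lF: "linear_op_on S Fbar"
    unfolding linear_op_on_def using Sa by (auto simp: Fbar FS push)
  have PS: "K.P \<mu> \<in> S" if "\<mu> \<in> S" for \<mu> using K.P_S that by (simp add: S_def)
  have lP: "linear_op_on S K.P"
    unfolding linear_op_on_def using PS by (auto simp: K.P_def scaleR_add_left)
  have NS: "K.N \<mu> \<in> S" if "\<mu> \<in> S" for \<mu>
    using Sa(1)[OF FS[OF that] Sa(2)[OF PS[OF that] PS[OF that], of "-1"]] by (simp add: NF)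
  have lN: "linear_op_on S K.N"
    unfolding linear_op_on_def using NS
    by (auto simp: NF K.P_def push scaleR_add_left scaleR_diff_right)
  have dec: "\<forall>\<mu>\<in>S. Fbar \<mu> = K.P \<mu> + K.N \<mu>" by (simp add: Fbar NF)
  have PP: "\<forall>\<mu>\<in>S. K.P (K.P \<mu>) = K.P \<mu>" by (simp add: K.P_def)
  have T\<sigma>: "push_signed F K.\<sigma> = K.\<sigma>" using K.T_\<sigma> by (simp add: F_def)
  have PN: "\<forall>\<mu>\<in>S. K.P (K.N \<mu>) = 0 \<and> K.N (K.P \<mu>) = 0"
    by (simp add: NF K.P_def push T\<sigma> sm_val_push_UNIV[OF Fm])
  have "K.P ` S = span {K.\<sigma>}"
  proof
    show "K.P ` S \<subseteq> span {K.\<sigma>}" by (auto simp: K.P_def span_singleton)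
    have "c *\<^sub>R K.\<sigma> = K.P (c *\<^sub>R K.\<sigma>)" "c *\<^sub>R K.\<sigma> \<in> S" for c
      using Sa(2)[of K.\<sigma> K.\<sigma>] K.\<sigma>_S by (simp_all add: K.P_def S_def)
    then show "span {K.\<sigma>} \<subseteq> K.P ` S" unfolding span_singleton by blast
  qed
  \<comment> \<open>The range is the span of the single vector \<sigma>, which is nonzero because it
    has mass 1.\<close>
  then have dim: "dim (K.P ` S) = 1"
    using K.\<sigma>_neq_0 by (simp add: dim_eq_card_independent dependent_single)
  have cor: "\<bar>(LINT z|\<mu>\<^sub>0. u ((F ^^ n) z) * v z) - (LINT z|\<mu>\<^sub>0. u z) * (LINT z|\<mu>\<^sub>0. v z)\<bar>
      \<le> nS (weighted_measure \<mu>\<^sub>0 v) * R * R\<^sub>4 * \<xi> ^ n"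
    if u: "admissible_observable No m Bs Ns u R\<^sub>4" and v: "v \<in> admissible_densities No m Bs \<mu>\<^sub>0"
      and n: "1 \<le> n" and uv: "integrable \<mu>\<^sub>0 (\<lambda>z. u ((F ^^ n) z) * v z)" for u R\<^sub>4 v n
  proof -
    let ?w = "weighted_measure \<mu>\<^sub>0 v"
    have um: "u \<in> borel_measurable borel"
      and ui: "\<And>\<mu>. \<mu> \<in> S \<Longrightarrow> signed_integrable \<mu> u \<and> \<bar>signed_integral \<mu> u\<bar> \<le> R\<^sub>4 * nS \<mu>"
      using u by (auto simp: admissible_observable_def S_def nS_def)
    have \<sigma>S: "K.\<sigma> \<in> S" using K.\<sigma>_S by (simp add: S_def)
    have u0: "integrable \<mu>\<^sub>0 u"
      using ui[OF \<sigma>S] by (simp add: signed_integrable_def K.pos_measure_\<sigma>)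
    \<comment> \<open>Testing the observable on \<sigma>, whose norm is positive, shows that
      \<open>R\<^sub>4\<close> is nonnegative; multiplying the decay estimate by it requires
      this.\<close>
    have "0 \<le> R\<^sub>4 * nS K.\<sigma>" using ui[OF \<sigma>S] by linarith
    then have R4: "0 \<le> R\<^sub>4" using K.nS_\<sigma>_pos by (simp add: nS_def zero_le_mult_iff)
    have v': "integrable \<mu>\<^sub>0 v" "?w \<in> S" using v by (auto simp: admissible_densities_def S_def)
    have NnS: "(K.N ^^ n) ?w \<in> S" using v'(2) by (induction n) (auto intro: NS)
    have "\<bar>(LINT z|\<mu>\<^sub>0. u ((F ^^ n) z) * v z) - (LINT z|\<mu>\<^sub>0. u z) * (LINT z|\<mu>\<^sub>0. v z)\<bar> =
        \<bar>signed_integral ((K.N ^^ n) ?w) u\<bar>"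
      using K.correlation_integral[OF um u0 v'(1) uv[unfolded F_def] n] by (simp add: F_def)
    also have "\<dots> \<le> R\<^sub>4 * nS ((K.N ^^ n) ?w)" using ui[OF NnS] by blast
    also have "\<dots> \<le> R\<^sub>4 * (R * \<xi> ^ n * nS ?w)"
      using gap[OF v'(2) n] R4 by (rule mult_left_mono)
    finally show ?thesis by (simp add: mult_ac)
  qed
  show ?thesis
    using \<xi> R lF lP lN dec PP dim PN gap cor
    by (intro exI[of _ \<xi>] exI[of _ R] conjI exI[of _ K.P] exI[of _ K.N]) auto
qed

end
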